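(* Let $\Gamma:U_{\mathbf q}^+\to(\mathcal F,\star)$ be the $\mathbb K$-linear map defined by $\Gamma(x)=\sum_{w:\,|w|=\mu}\partial_w(x)\,w$ for $x\in(U_{\mathbf q}^+)_\mu$, $\mu\in Q^+$. Then for all $x,y\in U_{\mathbf q}^+$, $$\Gamma(xy)=\Gamma(x)\star\Gamma(y).$$
   Context: Let $A=(a_{ij})_{i,j\in I}$ be a symmetrizable generalized Cartan matrix ($I$ finite); $Q=\bigoplus_i\mathbb Z\alpha_i$, $Q^+=\bigoplus_i\mathbb Z_{\ge0}\alpha_i$. Let $q_{ij}$ ($i,j\in I$) be indeterminates over $\mathbb Q$ subject to $q_{ij}q_{ji}=q_{ii}^{a_{ij}}$, and $\mathbb K\supset\mathbb Q(q_{ij}\mid i,j\in I)$ a field containing $q_{ii}^{1/m}$ for all positive integers $m$. The $q_{ii}$ are not roots of unity. For $\mu=\sum\mu_i\alpha_i,\nu=\sum\nu_j\alpha_j\in Q$ put $q_{\mu\nu}=\prod_{i,j}q_{ij}^{\mu_i\nu_j}$. Notation: $(n)_v=\frac{v^n-1}{v-1}$, $(n)_v!=(n)_v\cdots(1)_v$, $(0)_v!=1$, $\binom nk_v=\frac{(n)_v!}{(k)_v!(n-k)_v!}$. $U_{\mathbf q}=U_{\mathbf q}(\mathfrak g_A)$ is the associative unital $\mathbb K$-algebra generated by $e_i,f_i,\omega_i^{\pm1},\omega_i'^{\pm1}$ ($i\in I$) with relations: all $\omega_i^{\pm1},\omega_j'^{\pm1}$ commute with each other, $\omega_i\omega_i^{-1}=\omega_i'\omega_i'^{-1}=1$;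 $\omega_ie_j\omega_i^{-1}=q_{ij}e_j$, $\omega_i'e_j\omega_i'^{-1}=q_{ji}^{-1}e_j$; $\omega_if_j\omega_i^{-1}=q_{ij}^{-1}f_j$, $\omega_i'f_j\omega_i'^{-1}=q_{ji}f_j$; $e_if_j-f_je_i=\delta_{ij}\frac{q_{ii}}{q_{ii}-1}(\omega_i-\omega_i')$; and for $i\neq j$ $$\sum_{k=0}^{1-a_{ij}}(-1)^k\tbinom{1-a_{ij}}{k}_{q_{ii}}q_{ii}^{k(k-1)/2}q_{ij}^k e_i^{1-a_{ij}-k}e_je_i^k=0,\qquad \sum_{k=0}^{1-a_{ij}}(-1)^k\tbinom{1-a_{ij}}{k}_{q_{ii}}q_{ii}^{k(k-1)/2}q_{ij}^k f_i^kf_jf_i^{1-a_{ij}-k}=0.$$ It is a Hopf algebra with $\omega_i^{\pm1},\omega_i'^{\pm1}$ group-like, $\Delta(e_i)=e_i\otimes1+\omega_i\otimes e_i$, $\Delta(f_i)=1\otimes f_i+f_i\otimes\omega_i'$. $U_{\mathbf q}^+$ is the subalgebra generated by all $e_i$, graded by $\deg e_i=\alpha_i$ with components $(U_{\mathbf q}^+)_\beta$, $\beta\in Q^+$; $\omega_\nu=\prod\omega_i^{\nu_i}$. Skew derivations: for $x\in(U_{\mathbf q}^+)_\beta$ one has $\Delta(x)\in\bigoplus_{0\le\nu\le\beta}(U_{\mathbf q}^+)_{\beta-\nu}\omega_\nu\otimes(U_{\mathbf q}^+)_\nu$; define $\hat\partial_i(x)\in(U_{\mathbf q}^+)_{\beta-\alpha_i}$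 by requiring that the component of $\Delta(x)$ in $(U_{\mathbf q}^+)_{\beta-\alpha_i}\omega_i\otimes(U_{\mathbf q}^+)_{\alpha_i}$ be $\hat\partial_i(x)\omega_i\otimes e_i$ (zero if $\beta-\alpha_i\notin Q^+$), and set $\partial_i=\frac{q_{ii}}{1-q_{ii}}\hat\partial_i$, extended linearly to $U_{\mathbf q}^+$. Quantum shuffle algebra: $\mathcal F$ is the free associative unital $\mathbb K$-algebra on letters $w_i$ ($i\in I$), graded by $|w_i|=\alpha_i$, with components $\mathcal F_\nu$. The quantum shuffle product $\star$ on $\mathcal F$ is the bilinear product with $1\star x=x\star1=x$ and $$xw_i\star yw_j=(xw_i\star y)w_j+q_{\alpha_i,\nu+\alpha_j}(x\star yw_j)w_i\qquad(x\in\mathcal F,\ y\in\mathcal F_\nu,\ i,j\in I).$$ For a word $w=w_{i_1}\cdots w_{i_k}$ put $\partial_w=\partial_{i_1}\cdots\partial_{i_k}$, and $\partial_1=\mathrm{Id}$. In the definition of $\Gamma$ the sum runs over all words $w$ in the letters $w_i$ of degree $\mu$, and for such $w$, $\partial_w(x)\in(U_{\mathbf q}^+)_0=\mathbb K$. *)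

theory Defs
  imports
    "HOL-Algebra.QuotRing"
    "HOL-Algebra.Generated_Rings"
    "HOL-Library.Poly_Mapping"
    "HOL-Library.Product_Plus"
begin

section \<open>Cartan data and parameters\<close>

definition generalized_cartan_matrix :: "('i \<Rightarrow> 'i \<Rightarrow> int) \<Rightarrow> bool" where
  "generalized_cartan_matrix a \<longleftrightarrow>
     (\<forall>i. a i i = 2) \<and>
     (\<forall>i j. i \<noteq> j \<longrightarrow> a i j \<le> 0) \<and>
     (\<forall>i j. a i j = 0 \<longleftrightarrow> a j i = 0)"

definition symmetrizable :: "('i \<Rightarrow> 'i \<Rightarrow> int) \<Rightarrow> bool" where
  "symmetrizable a \<longleftrightarrow> (\<exists>d :: 'i \<Rightarrow> int. (\<forall>i. d i > 0) \<and> (\<forall>i j. d i * a i j = d j * a j i))"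

text \<open>
  ``The \<open>q i j\<close> are indeterminates over the rationals subject to
  \<open>q i j * q j i = q i i powi a i j\<close>'' means that, apart from these relations, there are no
  algebraic relations among them.  A Laurent monomial in the \<open>q i j\<close> is given by its exponent
  matrix \<open>m\<close>.  The exponent matrices of the defining relations, namely
  \<open>e\<^sub>i\<^sub>j + e\<^sub>j\<^sub>i - a i j * e\<^sub>i\<^sub>i\<close>, span a lattice; two monomials whose exponents agree modulo a
  rational multiple of that lattice are forced by the relations to agree up to a root of unity, and
  all other families of monomials have to be linearly independent over the rationals.
  (If the lattice is not saturated, as for \<open>a i j = a j i = -2\<close>, a field necessarily satisfies
  further torsion relations such as \<open>q i i = q j j \<or> q i i = - q j j\<close>; passing to rational
  multiples allows any of these choices.)
\<close>

definition laurent_monomial :: "('i::finite \<Rightarrow> 'i \<Rightarrow> 'k::field) \<Rightarrow> ('i \<Rightarrow> 'i \<Rightarrow> int) \<Rightarrow> 'k" where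
  "laurent_monomial q m = (\<Prod>i\<in>UNIV. \<Prod>j\<in>UNIV. q i j powi m i j)"

definition relation_exponent :: "('i \<Rightarrow> 'i \<Rightarrow> int) \<Rightarrow> 'i \<Rightarrow> 'i \<Rightarrow> 'i \<Rightarrow> 'i \<Rightarrow> int" where
  "relation_exponent a i j =
     (\<lambda>k l. of_bool (k = i \<and> l = j) + of_bool (k = j \<and> l = i) - a i j * of_bool (k = i \<and> l = i))"

definition saturated_relations :: "('i::finite \<Rightarrow> 'i \<Rightarrow> int) \<Rightarrow> ('i \<Rightarrow> 'i \<Rightarrow> int) set" where
  "saturated_relations a =
     {m. \<exists>N>0. \<exists>c. \<forall>k l. N * m k l = (\<Sum>i\<in>UNIV. \<Sum>j\<in>UNIV. c i j * relation_exponent a i j k l)}"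

definition no_further_relations ::
  "('i::finite \<Rightarrow> 'i \<Rightarrow> int) \<Rightarrow> ('i \<Rightarrow> 'i \<Rightarrow> 'k::field_char_0) \<Rightarrow> bool" where
  "no_further_relations a q \<longleftrightarrow>
     (\<forall>M (c :: ('i \<Rightarrow> 'i \<Rightarrow> int) \<Rightarrow> rat).
        finite M \<longrightarrow>
        (\<forall>m\<in>M. \<forall>n\<in>M. m \<noteq> n \<longrightarrow> (\<lambda>k l. m k l - n k l) \<notin> saturated_relations a) \<longrightarrow>
        (\<Sum>m\<in>M. of_rat (c m) * laurent_monomial q m) = 0 \<longrightarrow>
        (\<forall>m\<in>M. c m = 0))"

definition quantum_parameters ::
  "('i::finite \<Rightarrow> 'i \<Rightarrow> int) \<Rightarrow> ('i \<Rightarrow> 'i \<Rightarrow> 'k::field_char_0) \<Rightarrow> bool" where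
  "quantum_parameters a q \<longleftrightarrow>
     (\<forall>i j. q i j \<noteq> 0) \<and>
     (\<forall>i j. q i j * q j i = q i i powi a i j) \<and>
     no_further_relations a q \<and>
     (\<forall>i. \<forall>n>0. q i i ^ n \<noteq> 1) \<and>
     (\<forall>i. \<forall>m>0. \<exists>r. r ^ m = q i i)"

text \<open>Elements of \<open>Q\<^sup>+\<close> are functions \<open>'i \<Rightarrow> nat\<close>.\<close>

definition simple_root :: "'i \<Rightarrow> 'i \<Rightarrow> nat" where
  "simple_root i = (\<lambda>k. of_bool (k = i))"

definition q_pairing :: "('i::finite \<Rightarrow> 'i \<Rightarrow> 'k::field) \<Rightarrow> ('i \<Rightarrow> nat) \<Rightarrow> ('i \<Rightarrow> nat) \<Rightarrow> 'k" where
  "q_pairing q \<mu> \<nu> = (\<Prod>i\<in>UNIV. \<Prod>j\<in>UNIV. q i j ^ (\<mu> i * \<nu> j))"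

definition q_int :: "'k::field \<Rightarrow> nat \<Rightarrow> 'k" where
  "q_int v n = (v ^ n - 1) / (v - 1)"

definition q_fact :: "'k::field \<Rightarrow> nat \<Rightarrow> 'k" where
  "q_fact v n = (\<Prod>m=1..n. q_int v m)"

definition q_binom :: "'k::field \<Rightarrow> nat \<Rightarrow> nat \<Rightarrow> 'k" where
  "q_binom v n k = q_fact v n / (q_fact v k * q_fact v (n - k))"


section \<open>Free algebras and their tensor squares\<close>

datatype 'a fmon = Word (letters: "'a list")

instantiation fmon :: (type) monoid_add
begin

definition zero_fmon :: "'a fmon" where
  "zero_fmon = Word []"

definition plus_fmon :: "'a fmon \<Rightarrow> 'a fmon \<Rightarrow> 'a fmon" where
  "plus_fmon u v = Word (letters u @ letters v)"

instance
  by standard (simp_all add: zero_fmon_def plus_fmon_def)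

end

text \<open>
  The free associative unital algebra is the monoid algebra of the free monoid (written additively,
  so that \<open>Word u + Word v\<close> is concatenation).  The tensor product of two free algebras is the monoid
  algebra of the product monoid: \<open>Poly_Mapping.single (u, v) c\<close> is \<open>c\<close> times the tensor of the
  words \<open>u\<close> and \<open>v\<close>.
\<close>

type_synonym ('a, 'k) free_alg = "'a fmon \<Rightarrow>\<^sub>0 'k"
type_synonym ('a, 'k) free_alg2 = "('a fmon \<times> 'a fmon) \<Rightarrow>\<^sub>0 'k"

definition const :: "'k::field \<Rightarrow> ('m::monoid_add \<Rightarrow>\<^sub>0 'k)" where
  "const c = Poly_Mapping.single 0 c"

definition letter :: "'a \<Rightarrow> ('a, 'k::field) free_alg" where
  "letter x = Poly_Mapping.single (Word [x]) 1"

definition free_tensor :: "('a, 'k::field) free_alg \<Rightarrow> ('a, 'k) free_alg \<Rightarrow> ('a, 'k) free_alg2" where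
  "free_tensor p r =
     (\<Sum>u\<in>Poly_Mapping.keys p. \<Sum>v\<in>Poly_Mapping.keys r.
        Poly_Mapping.single (u, v) (Poly_Mapping.lookup p u * Poly_Mapping.lookup r v))"

definition full_ring :: "'r::ring_1 ring" where
  "full_ring = \<lparr>carrier = UNIV, mult = (*), one = 1, zero = 0, add = (+)\<rparr>"

lemma full_ring_simps [simp]:
  "carrier full_ring = UNIV" "x \<otimes>\<^bsub>full_ring\<^esub> y = x * y" "\<one>\<^bsub>full_ring\<^esub> = 1"
  "\<zero>\<^bsub>full_ring\<^esub> = 0" "x \<oplus>\<^bsub>full_ring\<^esub> y = x + y"
  by (simp_all add: full_ring_def)

lemma ring_full_ring: "ring (full_ring :: 'r::ring_1 ring)"
proof (rule ringI)
  show "abelian_group (full_ring :: 'r ring)"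
  proof (rule abelian_groupI)
    fix x :: 'r
    show "\<exists>y\<in>carrier full_ring. y \<oplus>\<^bsub>full_ring\<^esub> x = \<zero>\<^bsub>full_ring\<^esub>"
      by (rule bexI[of _ "- x"]) simp_all
  qed (simp_all add: add_ac)
  show "monoid (full_ring :: 'r ring)"
    by (rule monoidI) (simp_all add: mult.assoc)
qed (simp_all add: algebra_simps)


section \<open>The multiparameter quantum group\<close>

text \<open>\<open>Gom i\<close>, \<open>Gom' i\<close> stand for \<open>\<omega>\<^sub>i\<close>, \<open>\<omega>'\<^sub>i\<close>, and \<open>Gom_inv i\<close>, \<open>Gom'_inv i\<close> for their inverses.\<close>

datatype 'i gen = Ge 'i | Gf 'i | Gom 'i | Gom_inv 'i | Gom' 'i | Gom'_inv 'i

definition torus_generators :: "'i gen set" where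
  "torus_generators = range Gom \<union> range Gom_inv \<union> range Gom' \<union> range Gom'_inv"

definition serre_coeff :: "('i \<Rightarrow> 'i \<Rightarrow> int) \<Rightarrow> ('i \<Rightarrow> 'i \<Rightarrow> 'k::field) \<Rightarrow> 'i \<Rightarrow> 'i \<Rightarrow> nat \<Rightarrow> 'k" where
  "serre_coeff a q i j k =
     (-1) ^ k * q_binom (q i i) (nat (1 - a i j)) k * q i i ^ (k * (k - 1) div 2) * q i j ^ k"

inductive_set relators ::
  "('i \<Rightarrow> 'i \<Rightarrow> int) \<Rightarrow> ('i \<Rightarrow> 'i \<Rightarrow> 'k::field) \<Rightarrow> ('i gen, 'k) free_alg set"
  for a :: "'i \<Rightarrow> 'i \<Rightarrow> int" and q :: "'i \<Rightarrow> 'i \<Rightarrow> 'k"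
where
  torus_commute: "x \<in> torus_generators \<Longrightarrow> y \<in> torus_generators \<Longrightarrow>
     letter x * letter y - letter y * letter x \<in> relators a q"
| om_inverse: "letter (Gom i) * letter (Gom_inv i) - 1 \<in> relators a q"
| om'_inverse: "letter (Gom' i) * letter (Gom'_inv i) - 1 \<in> relators a q"
| om_e: "letter (Gom i) * letter (Ge j) * letter (Gom_inv i)
           - const (q i j) * letter (Ge j) \<in> relators a q"
| om'_e: "letter (Gom' i) * letter (Ge j) * letter (Gom'_inv i)
           - const (inverse (q j i)) * letter (Ge j) \<in> relators a q"
| om_f: "letter (Gom i) * letter (Gf j) * letter (Gom_inv i)
           - const (inverse (q i j)) * letter (Gf j) \<in> relators a q"
| om'_f: "letter (Gom' i) * letter (Gf j) * letter (Gom'_inv i)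
           - const (q j i) * letter (Gf j) \<in> relators a q"
| e_f: "letter (Ge i) * letter (Gf j) - letter (Gf j) * letter (Ge i)
          - (if i = j then const (q i i / (q i i - 1)) * (letter (Gom i) - letter (Gom' i)) else 0)
        \<in> relators a q"
| serre_e: "i \<noteq> j \<Longrightarrow>
     (\<Sum>k\<le>nat (1 - a i j). const (serre_coeff a q i j k)
        * letter (Ge i) ^ (nat (1 - a i j) - k) * letter (Ge j) * letter (Ge i) ^ k) \<in> relators a q"
| serre_f: "i \<noteq> j \<Longrightarrow>
     (\<Sum>k\<le>nat (1 - a i j). const (serre_coeff a q i j k)
        * letter (Gf i) ^ k * letter (Gf j) * letter (Gf i) ^ (nat (1 - a i j) - k)) \<in> relators a q"

definition U_ideal ::
  "('i \<Rightarrow> 'i \<Rightarrow> int) \<Rightarrow> ('i \<Rightarrow> 'i \<Rightarrow> 'k::field) \<Rightarrow> ('i gen, 'k) free_alg set" where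
  "U_ideal a q = genideal full_ring (relators a q)"

definition Uq ::
  "('i \<Rightarrow> 'i \<Rightarrow> int) \<Rightarrow> ('i \<Rightarrow> 'i \<Rightarrow> 'k::field) \<Rightarrow> ('i gen, 'k) free_alg set ring" where
  "Uq a q = full_ring Quot U_ideal a q"

definition U_class ::
  "('i \<Rightarrow> 'i \<Rightarrow> int) \<Rightarrow> ('i \<Rightarrow> 'i \<Rightarrow> 'k::field) \<Rightarrow> ('i gen, 'k) free_alg \<Rightarrow> ('i gen, 'k) free_alg set"
where
  "U_class a q p = U_ideal a q +>\<^bsub>full_ring\<^esub> p"

text \<open>
  With \<open>A\<close> the free algebra and \<open>I\<close> the ideal of relations, the tensor square of \<open>A / I\<close> is the
  quotient of the tensor square of \<open>A\<close> by the ideal generated by all \<open>x \<otimes> 1\<close> and \<open>1 \<otimes> x\<close>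
  with \<open>x \<in> I\<close>.
\<close>

definition UU_ideal ::
  "('i \<Rightarrow> 'i \<Rightarrow> int) \<Rightarrow> ('i \<Rightarrow> 'i \<Rightarrow> 'k::field) \<Rightarrow> ('i gen, 'k) free_alg2 set" where
  "UU_ideal a q = genideal full_ring
     ((\<lambda>x. free_tensor x 1) ` U_ideal a q \<union> (\<lambda>x. free_tensor 1 x) ` U_ideal a q)"

definition UUq ::
  "('i \<Rightarrow> 'i \<Rightarrow> int) \<Rightarrow> ('i \<Rightarrow> 'i \<Rightarrow> 'k::field) \<Rightarrow> ('i gen, 'k) free_alg2 set ring" where
  "UUq a q = full_ring Quot UU_ideal a q"

definition UU_class ::
  "('i \<Rightarrow> 'i \<Rightarrow> int) \<Rightarrow> ('i \<Rightarrow> 'i \<Rightarrow> 'k::field) \<Rightarrow> ('i gen, 'k) free_alg2 \<Rightarrow> ('i gen, 'k) free_alg2 set"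
where
  "UU_class a q t = UU_ideal a q +>\<^bsub>full_ring\<^esub> t"

text \<open>The maps induced on the quotients by \<open>free_tensor\<close> and, below, by \<open>free_coproduct\<close>.\<close>

definition U_tensor ::
  "('i \<Rightarrow> 'i \<Rightarrow> int) \<Rightarrow> ('i \<Rightarrow> 'i \<Rightarrow> 'k::field) \<Rightarrow>
   ('i gen, 'k) free_alg set \<Rightarrow> ('i gen, 'k) free_alg set \<Rightarrow> ('i gen, 'k) free_alg2 set"
where
  "U_tensor a q X Y = the_elem ((\<lambda>(p, r). UU_class a q (free_tensor p r)) ` (X \<times> Y))"

fun coproduct_gen :: "'i gen \<Rightarrow> ('i gen, 'k::field) free_alg2" where
  "coproduct_gen (Ge i) =
     free_tensor (letter (Ge i)) 1 + free_tensor (letter (Gom i)) (letter (Ge i))"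
| "coproduct_gen (Gf i) =
     free_tensor 1 (letter (Gf i)) + free_tensor (letter (Gf i)) (letter (Gom' i))"
| "coproduct_gen (Gom i) = free_tensor (letter (Gom i)) (letter (Gom i))"
| "coproduct_gen (Gom_inv i) = free_tensor (letter (Gom_inv i)) (letter (Gom_inv i))"
| "coproduct_gen (Gom' i) = free_tensor (letter (Gom' i)) (letter (Gom' i))"
| "coproduct_gen (Gom'_inv i) = free_tensor (letter (Gom'_inv i)) (letter (Gom'_inv i))"

definition free_coproduct :: "('i gen, 'k::field) free_alg \<Rightarrow> ('i gen, 'k) free_alg2" where
  "free_coproduct p =
     (\<Sum>w\<in>Poly_Mapping.keys p.
        const (Poly_Mapping.lookup p w) * prod_list (map coproduct_gen (letters w)))"

definition coproduct ::
  "('i \<Rightarrow> 'i \<Rightarrow> int) \<Rightarrow> ('i \<Rightarrow> 'i \<Rightarrow> 'k::field) \<Rightarrow>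
   ('i gen, 'k) free_alg set \<Rightarrow> ('i gen, 'k) free_alg2 set"
where
  "coproduct a q X = the_elem ((\<lambda>p. UU_class a q (free_coproduct p)) ` X)"


section \<open>The positive part and its skew derivations\<close>

definition Uplus ::
  "('i \<Rightarrow> 'i \<Rightarrow> int) \<Rightarrow> ('i \<Rightarrow> 'i \<Rightarrow> 'k::field) \<Rightarrow> ('i gen, 'k) free_alg set set" where
  "Uplus a q = generate_ring (Uq a q)
     (range (\<lambda>c. U_class a q (const c)) \<union> range (\<lambda>i. U_class a q (letter (Ge i))))"

text \<open>The degree of a word is the function counting the occurrences of each letter.\<close>

definition word_degree :: "'i list \<Rightarrow> 'i \<Rightarrow> nat" where
  "word_degree w = (\<lambda>k. count_list w k)"

definition Uplus_comp ::
  "('i \<Rightarrow> 'i \<Rightarrow> int) \<Rightarrow> ('i \<Rightarrow> 'i \<Rightarrow> 'k::field) \<Rightarrow> ('i \<Rightarrow> nat) \<Rightarrow> ('i gen, 'k) free_alg set set" where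
  "Uplus_comp a q \<beta> =
     U_class a q ` {p. \<forall>u\<in>Poly_Mapping.keys p. \<exists>w. u = Word (map Ge w) \<and> word_degree w = \<beta>}"

text \<open>The torus generators commute, so any word of degree \<open>\<nu>\<close> may be used for \<open>\<omega>\<^sub>\<nu>\<close>.\<close>

definition omega ::
  "('i \<Rightarrow> 'i \<Rightarrow> int) \<Rightarrow> ('i \<Rightarrow> 'i \<Rightarrow> 'k::field) \<Rightarrow> ('i \<Rightarrow> nat) \<Rightarrow> ('i gen, 'k) free_alg set" where
  "omega a q \<nu> =
     U_class a q (Poly_Mapping.single (Word (map Gom (SOME w. word_degree w = \<nu>))) 1)"

text \<open>
  The summand \<open>(U\<^sup>+)\<^bsub>\<beta>-\<nu>\<^esub> \<omega>\<^sub>\<nu> \<otimes> (U\<^sup>+)\<^sub>\<nu>\<close>; the additive span suffices since the spanning set is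
  closed under scalars.
\<close>

definition coproduct_summand ::
  "('i \<Rightarrow> 'i \<Rightarrow> int) \<Rightarrow> ('i \<Rightarrow> 'i \<Rightarrow> 'k::field) \<Rightarrow> ('i \<Rightarrow> nat) \<Rightarrow> ('i \<Rightarrow> nat) \<Rightarrow>
   ('i gen, 'k) free_alg2 set set"
where
  "coproduct_summand a q \<beta> \<nu> = generate (add_monoid (UUq a q))
     {U_tensor a q (y \<otimes>\<^bsub>Uq a q\<^esub> omega a q \<nu>) z | y z.
        y \<in> Uplus_comp a q (\<lambda>k. \<beta> k - \<nu> k) \<and> z \<in> Uplus_comp a q \<nu>}"

definition hat_partial_comp ::
  "('i::finite \<Rightarrow> 'i \<Rightarrow> int) \<Rightarrow> ('i \<Rightarrow> 'i \<Rightarrow> 'k::field) \<Rightarrow> 'i \<Rightarrow> ('i \<Rightarrow> nat) \<Rightarrow>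
   ('i gen, 'k) free_alg set \<Rightarrow> ('i gen, 'k) free_alg set"
where
  "hat_partial_comp a q i \<beta> x =
     (if \<beta> i = 0 then \<zero>\<^bsub>Uq a q\<^esub>
      else THE y. y \<in> Uplus_comp a q (\<lambda>k. \<beta> k - simple_root i k) \<and>
        (\<exists>t. (\<forall>\<nu>\<in>{\<nu>. \<nu> \<le> \<beta>}. t \<nu> \<in> coproduct_summand a q \<beta> \<nu>) \<and>
             coproduct a q x = finsum (UUq a q) t {\<nu>. \<nu> \<le> \<beta>} \<and>
             t (simple_root i) =
               U_tensor a q (y \<otimes>\<^bsub>Uq a q\<^esub> U_class a q (letter (Gom i))) (U_class a q (letter (Ge i)))))"

text \<open>
  \<open>homogeneous_parts a q x \<beta>\<close> is the component of \<open>x \<in> Uplus a q\<close> in degree \<open>\<beta>\<close>.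
\<close>

definition homogeneous_parts ::
  "('i \<Rightarrow> 'i \<Rightarrow> int) \<Rightarrow> ('i \<Rightarrow> 'i \<Rightarrow> 'k::field) \<Rightarrow>
   ('i gen, 'k) free_alg set \<Rightarrow> ('i \<Rightarrow> nat) \<Rightarrow> ('i gen, 'k) free_alg set"
where
  "homogeneous_parts a q x = (THE h.
     (\<forall>\<beta>. h \<beta> \<in> Uplus_comp a q \<beta>) \<and>
     finite {\<beta>. h \<beta> \<noteq> \<zero>\<^bsub>Uq a q\<^esub>} \<and>
     x = finsum (Uq a q) h {\<beta>. h \<beta> \<noteq> \<zero>\<^bsub>Uq a q\<^esub>})"

definition degree_support ::
  "('i \<Rightarrow> 'i \<Rightarrow> int) \<Rightarrow> ('i \<Rightarrow> 'i \<Rightarrow> 'k::field) \<Rightarrow> ('i gen, 'k) free_alg set \<Rightarrow> ('i \<Rightarrow> nat) set"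
where
  "degree_support a q x = {\<beta>. homogeneous_parts a q x \<beta> \<noteq> \<zero>\<^bsub>Uq a q\<^esub>}"

definition hat_partial ::
  "('i::finite \<Rightarrow> 'i \<Rightarrow> int) \<Rightarrow> ('i \<Rightarrow> 'i \<Rightarrow> 'k::field) \<Rightarrow> 'i \<Rightarrow>
   ('i gen, 'k) free_alg set \<Rightarrow> ('i gen, 'k) free_alg set"
where
  "hat_partial a q i x = finsum (Uq a q)
     (\<lambda>\<beta>. hat_partial_comp a q i \<beta> (homogeneous_parts a q x \<beta>)) (degree_support a q x)"

definition skew_partial ::
  "('i::finite \<Rightarrow> 'i \<Rightarrow> int) \<Rightarrow> ('i \<Rightarrow> 'i \<Rightarrow> 'k::field) \<Rightarrow> 'i \<Rightarrow>
   ('i gen, 'k) free_alg set \<Rightarrow> ('i gen, 'k) free_alg set"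
where
  "skew_partial a q i x =
     U_class a q (const (q i i / (1 - q i i))) \<otimes>\<^bsub>Uq a q\<^esub> hat_partial a q i x"

text \<open>The operator of the last letter of the word is applied first.\<close>

definition word_partial ::
  "('i::finite \<Rightarrow> 'i \<Rightarrow> int) \<Rightarrow> ('i \<Rightarrow> 'i \<Rightarrow> 'k::field) \<Rightarrow> 'i list \<Rightarrow>
   ('i gen, 'k) free_alg set \<Rightarrow> ('i gen, 'k) free_alg set"
where
  "word_partial a q w = foldr (skew_partial a q) w"


section \<open>The quantum shuffle product\<close>

text \<open>
  Shuffle product of two words, both given in reversed order, so that the last letters of the words
  are the heads of the lists.
\<close>

fun shuffle_rev ::
  "('i::finite \<Rightarrow> 'i \<Rightarrow> 'k::field) \<Rightarrow> 'i list \<Rightarrow> 'i list \<Rightarrow> ('i, 'k) free_alg"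
where
  "shuffle_rev q [] ys = Poly_Mapping.single (Word (rev ys)) 1"
| "shuffle_rev q (i # xs) [] = Poly_Mapping.single (Word (rev (i # xs))) 1"
| "shuffle_rev q (i # xs) (j # ys) =
     shuffle_rev q (i # xs) ys * letter j
     + const (q_pairing q (simple_root i) (word_degree (j # ys)))
         * shuffle_rev q xs (j # ys) * letter i"

definition quantum_shuffle ::
  "('i::finite \<Rightarrow> 'i \<Rightarrow> 'k::field) \<Rightarrow> ('i, 'k) free_alg \<Rightarrow> ('i, 'k) free_alg \<Rightarrow> ('i, 'k) free_alg"
where
  "quantum_shuffle q p r =
     (\<Sum>u\<in>Poly_Mapping.keys p. \<Sum>v\<in>Poly_Mapping.keys r.
        const (Poly_Mapping.lookup p u * Poly_Mapping.lookup r v)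
          * shuffle_rev q (rev (letters u)) (rev (letters v)))"


text \<open>
  The characterisation \<open>1 \<star> x = x \<star> 1 = x\<close> and
  \<open>x w\<^sub>i \<star> y w\<^sub>j = (x w\<^sub>i \<star> y) w\<^sub>j + q\<^bsub>\<alpha>\<^sub>i,\<nu>+\<alpha>\<^sub>j\<^esub> (x \<star> y w\<^sub>j) w\<^sub>i\<close>, for all \<open>x\<close> and all \<open>y\<close> homogeneous
  of degree \<open>\<nu>\<close>, is proved in \<open>quantum_shuffle_unit\<close> and \<open>quantum_shuffle_rec\<close>.
\<close>

lemma pm_induct [consumes 1, case_names zero single add]:
  fixes p :: "'m \<Rightarrow>\<^sub>0 'b::comm_monoid_add"
  assumes "Poly_Mapping.keys p \<subseteq> S" and "P 0" and "\<And>k v. k \<in> S \<Longrightarrow> P (Poly_Mapping.single k v)"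
    and "\<And>f g. P f \<Longrightarrow> P g \<Longrightarrow> P (f + g)"
  shows "P p"
proof -
  have *: "P (\<Sum>u\<in>T. Poly_Mapping.single u (Poly_Mapping.lookup p u))"
    if "finite T" "T \<subseteq> S" for T
    using that by (induction T rule: finite_induct) (use assms in auto)
  have "p = (\<Sum>u\<in>Poly_Mapping.keys p. Poly_Mapping.single u (Poly_Mapping.lookup p u))"
    by (rule poly_mapping_eqI)
       (auto simp: lookup_sum lookup_single when_def in_keys_iff)
  then show ?thesis
    using *[of "Poly_Mapping.keys p"] assms(1) by simp
qed

lemmas pm_induct_UNIV = pm_induct[OF subset_UNIV, case_names zero single add]

lemma quantum_shuffle_superset:
  assumes "finite S" "finite T" "Poly_Mapping.keys p \<subseteq> S" "Poly_Mapping.keys r \<subseteq> T"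
  shows "quantum_shuffle q p r =
     (\<Sum>u\<in>S. \<Sum>v\<in>T. const (Poly_Mapping.lookup p u * Poly_Mapping.lookup r v)
        * shuffle_rev q (rev (letters u)) (rev (letters v)))"
proof -
  have "quantum_shuffle q p r = (\<Sum>u\<in>Poly_Mapping.keys p. \<Sum>v\<in>T.
      const (Poly_Mapping.lookup p u * Poly_Mapping.lookup r v)
        * shuffle_rev q (rev (letters u)) (rev (letters v)))"
    unfolding quantum_shuffle_def using assms
    by (intro sum.cong refl sum.mono_neutral_left) (auto simp: const_def in_keys_iff)
  also have "\<dots> = (\<Sum>u\<in>S. \<Sum>v\<in>T. const (Poly_Mapping.lookup p u * Poly_Mapping.lookup r v)
        * shuffle_rev q (rev (letters u)) (rev (letters v)))"
    using assms by (intro sum.mono_neutral_left) (auto simp: const_def in_keys_iff)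
  finally show ?thesis .
qed

lemma const_add: "const (c + d) = const c + const d"
  by (simp add: const_def single_add)

lemma const_mult: "const (c * d) = const c * const d"
  by (simp add: const_def mult_single)

lemma const_commute: "const c * p = (p :: ('a, 'k::field) free_alg) * const c"
proof (induction p rule: pm_induct_UNIV)
  case zero then show ?case by simp
next
  case (single k v) then show ?case by (simp add: const_def mult_single mult.commute)
next
  case (add p1 p2) then show ?case by (simp add: algebra_simps)
qed

lemma quantum_shuffle_add_left:
  "quantum_shuffle q (p + p') r = quantum_shuffle q p r + quantum_shuffle q p' r"
proof -
  let ?S = "Poly_Mapping.keys p \<union> Poly_Mapping.keys p'"
  have "Poly_Mapping.keys (p + p') \<subseteq> ?S" by (rule Poly_Mapping.keys_add)
  then show ?thesis
    by (simp add: quantum_shuffle_superset[of ?S "Poly_Mapping.keys r"] lookup_add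
        distrib_right const_add sum.distrib)
qed

lemma quantum_shuffle_add_right:
  "quantum_shuffle q p (r + r') = quantum_shuffle q p r + quantum_shuffle q p r'"
proof -
  let ?S = "Poly_Mapping.keys r \<union> Poly_Mapping.keys r'"
  have "Poly_Mapping.keys (r + r') \<subseteq> ?S" by (rule Poly_Mapping.keys_add)
  then show ?thesis
    by (simp add: quantum_shuffle_superset[of "Poly_Mapping.keys p" ?S] lookup_add
        distrib_left distrib_right const_add sum.distrib)
qed

lemma quantum_shuffle_single:
  "quantum_shuffle q (Poly_Mapping.single u c) (Poly_Mapping.single v d) =
     const (c * d) * shuffle_rev q (rev (letters u)) (rev (letters v))"
  by (subst quantum_shuffle_superset[of "{u}" "{v}"]) (auto split: if_splits)

lemma word_degree_rev: "word_degree (rev w) = word_degree w"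
  by (simp add: word_degree_def)

lemma word_degree_Cons: "word_degree (j # w) = (\<lambda>k. word_degree w k + simple_root j k)"
  by (auto simp: word_degree_def simple_root_def)

lemma quantum_shuffle_zero [simp]: "quantum_shuffle q 0 r = 0" "quantum_shuffle q p 0 = 0"
  by (simp_all add: quantum_shuffle_def)

lemma quantum_shuffle_unit: "quantum_shuffle q 1 x = x" "quantum_shuffle q x 1 = x"
proof -
  have 1: "shuffle_rev q xs [] = Poly_Mapping.single (Word (rev xs)) 1" for xs
    by (cases xs) auto
  have one: "(1 :: ('a, 'b) free_alg) = Poly_Mapping.single (Word []) 1"
    by (metis single_one zero_fmon_def)
  show "quantum_shuffle q 1 x = x"
    by (induction x rule: pm_induct_UNIV)
       (auto simp: one quantum_shuffle_single quantum_shuffle_add_right const_def mult_single)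
  show "quantum_shuffle q x 1 = x"
    by (induction x rule: pm_induct_UNIV)
       (auto simp: one quantum_shuffle_single quantum_shuffle_add_left 1 const_def mult_single)
qed

lemma quantum_shuffle_rec:
  assumes "\<And>v. v \<in> Poly_Mapping.keys y \<Longrightarrow> word_degree (letters v) = \<nu>"
  shows "quantum_shuffle q (x * letter i) (y * letter j) =
     quantum_shuffle q (x * letter i) y * letter j
     + const (q_pairing q (simple_root i) (\<lambda>k. \<nu> k + simple_root j k))
         * quantum_shuffle q x (y * letter j) * letter i"
proof -
  let ?Q = "const (q_pairing q (simple_root i) (\<lambda>k. \<nu> k + simple_root j k))"
  have *: "quantum_shuffle q (x * letter i) (Poly_Mapping.single v d * letter j) =
     quantum_shuffle q (x * letter i) (Poly_Mapping.single v d) * letter j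
     + ?Q * quantum_shuffle q x (Poly_Mapping.single v d * letter j) * letter i"
    if v: "word_degree (letters v) = \<nu>" for v d
  proof (induction x rule: pm_induct_UNIV)
    case zero then show ?case by simp
  next
    case (single u c)
    let ?A = "shuffle_rev q (i # rev (letters u)) (rev (letters v))"
    let ?B = "shuffle_rev q (rev (letters u)) (j # rev (letters v))"
    have snoc: "Poly_Mapping.single w b * letter h = Poly_Mapping.single (Word (letters w @ [h])) b"
      for w :: "'a fmon" and b :: 'b and h
      by (simp add: letter_def mult_single plus_fmon_def)
    have deg: "word_degree (j # rev (letters v)) = (\<lambda>k. \<nu> k + simple_root j k)"
      by (simp only: word_degree_Cons word_degree_rev v)
    have "const (c * d) * (?A * letter j + ?Q * ?B * letter i) =
        const (c * d) * ?A * letter j + ?Q * (const (c * d) * ?B) * letter i"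
      by (simp only: distrib_left mult.assoc[symmetric] const_commute[of "c * d" ?Q])
    then show ?case
      by (simp only: snoc quantum_shuffle_single fmon.sel rev_append rev.simps append.simps
          shuffle_rev.simps deg)
  next
    case (add p1 p2) then show ?case
      by (simp only: quantum_shuffle_add_left distrib_left distrib_right) (simp only: add_ac)
  qed
  have "Poly_Mapping.keys y \<subseteq> {v. word_degree (letters v) = \<nu>}"
    using assms by auto
  then show ?thesis
  proof (induction y rule: pm_induct)
    case zero then show ?case by simp
  next
    case (single v d) then show ?case using * by simp
  next
    case (add p1 p2) then show ?case
      by (simp only: quantum_shuffle_add_right distrib_left distrib_right) (simp only: add_ac)
  qed
qed


section \<open>The map \<open>\<Gamma>\<close>\<close>

definition scalar_of ::
  "('i \<Rightarrow> 'i \<Rightarrow> int) \<Rightarrow> ('i \<Rightarrow> 'i \<Rightarrow> 'k::field) \<Rightarrow> ('i gen, 'k) free_alg set \<Rightarrow> 'k" where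
  "scalar_of a q x = (THE c. x = U_class a q (const c))"

definition Gamma_comp ::
  "('i::finite \<Rightarrow> 'i \<Rightarrow> int) \<Rightarrow> ('i \<Rightarrow> 'i \<Rightarrow> 'k::field) \<Rightarrow> ('i \<Rightarrow> nat) \<Rightarrow>
   ('i gen, 'k) free_alg set \<Rightarrow> ('i, 'k) free_alg"
where
  "Gamma_comp a q \<mu> x =
     (\<Sum>w | word_degree w = \<mu>. Poly_Mapping.single (Word w) (scalar_of a q (word_partial a q w x)))"

definition Gamma ::
  "('i::finite \<Rightarrow> 'i \<Rightarrow> int) \<Rightarrow> ('i \<Rightarrow> 'i \<Rightarrow> 'k::field) \<Rightarrow>
   ('i gen, 'k) free_alg set \<Rightarrow> ('i, 'k) free_alg"
where
  "Gamma a q x =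
     (\<Sum>\<mu>\<in>degree_support a q x. Gamma_comp a q \<mu> (homogeneous_parts a q x \<mu>))"

end

theory Submission
  imports Defs "HOL-Library.Multiset"
begin

text \<open>
  On the free algebra on the letters \<open>w\<^sub>i\<close> let \<open>D\<^sub>i\<close> be the skew derivation with
  \<open>D\<^sub>i(xy) = x D\<^sub>i(y) + q\<^bsub>\<alpha>\<^sub>i,|y|\<^esub> D\<^sub>i(x) y\<close> and \<open>D\<^sub>i(w\<^sub>j) = \<delta>\<^sub>i\<^sub>j\<close>.  Since the last letters of the
  words in \<open>\<Gamma>(x)\<close> record the derivation applied first, \<open>\<Gamma>(x) = \<Sum>\<^sub>i \<Gamma>(\<partial>\<^sub>i x) w\<^sub>i\<close> in positive degree, and
  this skew Leibniz rule turns into the recursion that defines the quantum shuffle product.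

  It remains to see that \<open>D\<^sub>i\<close> computes the operator that \<open>U\<^sub>q\<^sup>+\<close> gets from the coproduct.  The coproduct
  respects the Serre relations because \<open>\<Delta>(e\<^sub>i) = X + Y\<close> with \<open>YX = q\<^sub>i\<^sub>i XY\<close>, so that the iterated braided
  commutators of \<open>X + Y\<close> expand with Gaussian binomial coefficients times factors
  \<open>1 - q\<^sub>i\<^sub>i\<^sup>l q\<^sub>i\<^sub>j q\<^sub>j\<^sub>i\<close>, one of which is zero.  The components of \<open>\<Delta>(x)\<close> are determined by \<open>x\<close> because
  the ideals of relations are graded, and \<open>y \<omega>\<^sub>i \<otimes> e\<^sub>i\<close> determines \<open>y\<close> by contraction with a linear
  functional that is \<open>1\<close> on \<open>e\<^sub>i\<close>.
\<close>

section \<open>Congruences modulo two-sided ideals\<close>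

text \<open>U_q^+ is only given as a subalgebra of U_q, so the elements of the free algebra on the
  w_i that become zero in it are not known by generators, and the D_i cannot be pushed down by
  checking relators. Descent goes the other way: \<partial>_i is characterised by the coproduct, D_i
  satisfies this characterisation on every homogeneous representative without vanishing letters, and
  uniqueness then forces D_i to preserve the elements that vanish. The price is that the coproduct
  has to be well defined on all of U_q, including the relations for the f_i and the torus. The
  f-relations are e-relations in an opposite algebra, so the commutator calculus is set up for an
  abstract algebra with scalars and serves both. The normalisation q_ii/(1-q_ii) multiplies both
  terms of the skew Leibniz rule alike and therefore passes unchanged through the recursion of the
  shuffle product.\<close>

locale two_sided_ideal =
  fixes J :: "'r::ring_1 set"
  assumes zero_mem: "0 \<in> J"
    and add_mem: "x \<in> J \<Longrightarrow> y \<in> J \<Longrightarrow> x + y \<in> J"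
    and mult_left_mem: "x \<in> J \<Longrightarrow> r * x \<in> J"
    and mult_right_mem: "x \<in> J \<Longrightarrow> x * r \<in> J"
begin

lemma uminus_mem: "x \<in> J \<Longrightarrow> - x \<in> J"
  using mult_left_mem[of x "-1"] by simp

lemma diff_mem: "x \<in> J \<Longrightarrow> y \<in> J \<Longrightarrow> x - y \<in> J"
  using add_mem[of x "- y"] uminus_mem[of y] by simp

lemma sum_mem: "(\<And>x. x \<in> S \<Longrightarrow> f x \<in> J) \<Longrightarrow> sum f S \<in> J"
  by (induction S rule: infinite_finite_induct) (auto simp: zero_mem add_mem)

lemma ideal_full_ring: "ideal J full_ring"
proof (rule idealI)
  have inv: "inv\<^bsub>add_monoid full_ring\<^esub> x = - x" for x :: 'r
    using abelian_group.minus_equality[OF ring.is_abelian_group[OF ring_full_ring], of "- x" x]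
    by (simp add: a_inv_def)
  show "subgroup J (add_monoid full_ring)"
    by (rule subgroup.intro) (auto simp: zero_mem add_mem inv[simplified] uminus_mem)
qed (auto simp: ring_full_ring mult_left_mem mult_right_mem)

end

lemma ideal_full_ringD:
  assumes "ideal J (full_ring :: 'r::ring_1 ring)"
  shows "two_sided_ideal J"
proof -
  interpret ideal J full_ring by (rule assms)
  show ?thesis
  proof
    show "0 \<in> J" using additive_subgroup.zero_closed[OF is_additive_subgroup] by simp
  next
    fix x y assume "x \<in> J" "y \<in> J" then show "x + y \<in> J"
      using additive_subgroup.a_closed[OF is_additive_subgroup, of x y] by simp
  next
    fix x r assume "x \<in> J" then show "r * x \<in> J" "x * r \<in> J"
      using I_l_closed[of x r] I_r_closed[of x r] by simp_all
  qed
qed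

lemma two_sided_ideal_genideal: "two_sided_ideal (genideal full_ring S)"
  by (rule ideal_full_ringD, rule ring.genideal_ideal[OF ring_full_ring]) simp

lemma genideal_incl: "x \<in> S \<Longrightarrow> x \<in> genideal full_ring S"
  using ring.genideal_self[OF ring_full_ring, of S] by auto

lemma genideal_subset:
  assumes "two_sided_ideal K" "S \<subseteq> K"
  shows "genideal full_ring S \<subseteq> K"
  by (rule ring.genideal_minimal[OF ring_full_ring two_sided_ideal.ideal_full_ring]) (use assms in auto)

text \<open>Reduces the descent of a homomorphism to generators: together with
  \<open>genideal_subset\<close> it suffices to send each generator into \<open>K\<close>.\<close>

lemma two_sided_ideal_vimage:
  fixes \<phi> :: "'r::ring_1 \<Rightarrow> 's::ring_1"
  assumes "two_sided_ideal K"
    and "\<And>x y. \<phi> (x + y) = \<phi> x + \<phi> y" and "\<And>x y. \<phi> (x * y) = \<phi> x * \<phi> y"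
  shows "two_sided_ideal {x. \<phi> x \<in> K}"
proof -
  interpret two_sided_ideal K by (rule assms)
  have "\<phi> 0 = 0" using assms(2)[of 0 0] by simp
  then show ?thesis
    by unfold_locales (auto simp: assms zero_mem add_mem mult_left_mem mult_right_mem)
qed

text \<open>Congruences live in the type-class ring, where ring terms can be simplified; cosets and
  the operations of the quotient record enter only through \<open>coset_eq_iff\<close> and the rules
  after it.\<close>

definition ideal_cong :: "'r::ring_1 set \<Rightarrow> 'r \<Rightarrow> 'r \<Rightarrow> bool" where
  "ideal_cong J x y \<longleftrightarrow> x - y \<in> J"

context two_sided_ideal
begin

lemma cong_refl [simp]: "ideal_cong J x x"
  by (simp add: ideal_cong_def zero_mem)

lemma cong_sym: "ideal_cong J x y \<Longrightarrow> ideal_cong J y x"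
  using uminus_mem[of "x - y"] by (simp add: ideal_cong_def)

lemma cong_trans [trans]: "ideal_cong J x y \<Longrightarrow> ideal_cong J y z \<Longrightarrow> ideal_cong J x z"
  using add_mem[of "x - y" "y - z"] by (simp add: ideal_cong_def)

lemma cong_add: "ideal_cong J x x' \<Longrightarrow> ideal_cong J y y' \<Longrightarrow> ideal_cong J (x + y) (x' + y')"
  using add_mem[of "x - x'" "y - y'"] by (simp add: ideal_cong_def algebra_simps)

lemma cong_diff: "ideal_cong J x x' \<Longrightarrow> ideal_cong J y y' \<Longrightarrow> ideal_cong J (x - y) (x' - y')"
  using diff_mem[of "x - x'" "y - y'"] by (simp add: ideal_cong_def algebra_simps)

lemma cong_mult:
  assumes "ideal_cong J x x'" "ideal_cong J y y'"
  shows "ideal_cong J (x * y) (x' * y')"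
proof -
  have "x * y - x' * y' = (x - x') * y + x' * (y - y')" by (simp add: algebra_simps)
  then show ?thesis using assms
    by (simp add: ideal_cong_def add_mem mult_left_mem mult_right_mem)
qed

lemma cong_left: "ideal_cong J y y' \<Longrightarrow> ideal_cong J (x * y) (x * y')"
  by (rule cong_mult) simp_all

lemma cong_right: "ideal_cong J x x' \<Longrightarrow> ideal_cong J (x * y) (x' * y)"
  by (rule cong_mult) simp_all

lemma cong_sum: "(\<And>x. x \<in> S \<Longrightarrow> ideal_cong J (f x) (g x)) \<Longrightarrow> ideal_cong J (sum f S) (sum g S)"
  using sum_mem[of S "\<lambda>x. f x - g x"] by (simp add: ideal_cong_def sum_subtractf)

lemma cong_zero_iff: "ideal_cong J x 0 \<longleftrightarrow> x \<in> J"
  by (simp add: ideal_cong_def)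

lemma cong_mem: "ideal_cong J x y \<Longrightarrow> y \<in> J \<Longrightarrow> x \<in> J"
  using add_mem[of "x - y" y] by (simp add: ideal_cong_def)

lemma coset_eq_iff: "J +>\<^bsub>full_ring\<^esub> x = J +>\<^bsub>full_ring\<^esub> y \<longleftrightarrow> ideal_cong J x y"
proof -
  have coset: "z \<in> J +>\<^bsub>full_ring\<^esub> x \<longleftrightarrow> ideal_cong J z x" for x z
  proof -
    have "z \<in> J +>\<^bsub>full_ring\<^esub> x \<longleftrightarrow> (\<exists>j\<in>J. z = j + x)"
      by (auto simp: a_r_coset_def r_coset_def)
    also have "\<dots> \<longleftrightarrow> z - x \<in> J"
      by (metis add_diff_cancel_right' diff_add_cancel)
    finally show ?thesis by (simp add: ideal_cong_def)
  qed
  show ?thesis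
    using coset cong_refl cong_sym cong_trans by blast
qed

lemma coset_mem_iff: "z \<in> J +>\<^bsub>full_ring\<^esub> x \<longleftrightarrow> ideal_cong J z x"
  by (auto simp: a_r_coset_def r_coset_def ideal_cong_def intro!: bexI[of _ "z - x"])

lemma coset_mult: "(J +>\<^bsub>full_ring\<^esub> x) \<otimes>\<^bsub>full_ring Quot J\<^esub> (J +>\<^bsub>full_ring\<^esub> y) = J +>\<^bsub>full_ring\<^esub> (x * y)"
  using ideal.rcoset_mult_add[OF ideal_full_ring, of x y] by (simp add: FactRing_def)

lemma coset_add: "(J +>\<^bsub>full_ring\<^esub> x) \<oplus>\<^bsub>full_ring Quot J\<^esub> (J +>\<^bsub>full_ring\<^esub> y) = J +>\<^bsub>full_ring\<^esub> (x + y)"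
  using ideal.a_rcos_sum[OF ideal_full_ring, of x y] by (simp add: FactRing_def)

lemma coset_one: "\<one>\<^bsub>full_ring Quot J\<^esub> = J +>\<^bsub>full_ring\<^esub> 1"
  by (simp add: FactRing_def)

lemma coset_zero: "\<zero>\<^bsub>full_ring Quot J\<^esub> = J +>\<^bsub>full_ring\<^esub> 0"
  by (auto simp: FactRing_def a_r_coset_def r_coset_def)

lemma coset_carrier: "J +>\<^bsub>full_ring\<^esub> x \<in> carrier (full_ring Quot J)"
  by (auto simp: FactRing_def A_RCOSETS_def RCOSETS_def a_r_coset_def)

lemma ring_quot: "ring (full_ring Quot J)"
  by (rule ideal.quotient_is_ring[OF ideal_full_ring])

lemma coset_uminus: "\<ominus>\<^bsub>full_ring Quot J\<^esub> (J +>\<^bsub>full_ring\<^esub> x) = J +>\<^bsub>full_ring\<^esub> (- x)"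
proof -
  interpret ring "full_ring Quot J" by (rule ring_quot)
  show ?thesis
    by (rule minus_equality) (simp_all add: coset_add coset_zero coset_carrier)
qed

lemma coset_finsum:
  assumes "finite S"
  shows "finsum (full_ring Quot J) (\<lambda>x. J +>\<^bsub>full_ring\<^esub> (f x)) S = J +>\<^bsub>full_ring\<^esub> (sum f S)"
proof -
  interpret ring "full_ring Quot J" by (rule ring_quot)
  show ?thesis using assms
    by (induction S rule: finite_induct) (simp_all add: coset_zero coset_add coset_carrier Pi_def)
qed

lemma coset_finsum':
  assumes "finite S" "\<And>x. x \<in> S \<Longrightarrow> t x = J +>\<^bsub>full_ring\<^esub> (f x)"
  shows "finsum (full_ring Quot J) t S = J +>\<^bsub>full_ring\<^esub> (sum f S)"
proof -
  interpret ring "full_ring Quot J" by (rule ring_quot)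
  have "finsum (full_ring Quot J) t S = finsum (full_ring Quot J) (\<lambda>x. J +>\<^bsub>full_ring\<^esub> (f x)) S"
    by (rule finsum_cong') (auto simp: assms coset_carrier)
  then show ?thesis by (simp add: coset_finsum assms)
qed

end


section \<open>Monoid algebras\<close>

text \<open>\<open>const_commute\<close> covers algebras of words; the tensor square is the algebra
  of a product monoid and requires this form.\<close>

lemma const_central: "const c * p = (p :: 'm::monoid_add \<Rightarrow>\<^sub>0 'k::field) * const c"
proof (induction p rule: pm_induct_UNIV)
  case zero then show ?case by simp
next
  case (single k v) then show ?case by (simp add: const_def mult_single mult.commute)
next
  case (add p1 p2) then show ?case by (simp add: algebra_simps)
qed

lemma const_left_commute:
  "p * (const c * r) = const c * ((p :: 'm::monoid_add \<Rightarrow>\<^sub>0 'k::field) * r)"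
  by (simp only: mult.assoc[symmetric] const_central[of c p])

lemma const_0 [simp]: "const 0 = 0" and const_1 [simp]: "const 1 = 1"
  by (simp_all add: const_def)

lemma const_times_single: "const c * Poly_Mapping.single m d = Poly_Mapping.single m (c * d)"
  by (simp add: const_def mult_single)

lemma lookup_const_mult: "Poly_Mapping.lookup (const c * p) m = c * Poly_Mapping.lookup p m"
proof (induction p rule: pm_induct_UNIV)
  case (single k v) then show ?case by (simp add: const_times_single lookup_single when_def)
qed (simp_all add: lookup_add distrib_left)

text \<open>Homomorphisms, derivations, projections to a degree and contractions are all obtained in
  this way, so that their linearity is proved once.\<close>

definition lin_ext :: "('m \<Rightarrow> 'n::monoid_add \<Rightarrow>\<^sub>0 'k::field) \<Rightarrow> ('m \<Rightarrow>\<^sub>0 'k) \<Rightarrow> ('n \<Rightarrow>\<^sub>0 'k)" where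
  "lin_ext f p = (\<Sum>m\<in>Poly_Mapping.keys p. const (Poly_Mapping.lookup p m) * f m)"

lemma lin_ext_superset:
  assumes "finite S" "Poly_Mapping.keys p \<subseteq> S"
  shows "lin_ext f p = (\<Sum>m\<in>S. const (Poly_Mapping.lookup p m) * f m)"
  unfolding lin_ext_def using assms
  by (intro sum.mono_neutral_left) (auto simp: in_keys_iff)

lemma lin_ext_0 [simp]: "lin_ext f 0 = 0"
  by (simp add: lin_ext_def)

lemma lin_ext_single: "lin_ext f (Poly_Mapping.single m c) = const c * f m"
  by (subst lin_ext_superset[of "{m}"]) auto

lemma lin_ext_add: "lin_ext f (p + r) = lin_ext f p + lin_ext f r"
proof -
  let ?S = "Poly_Mapping.keys p \<union> Poly_Mapping.keys r"
  have "Poly_Mapping.keys (p + r) \<subseteq> ?S" by (rule Poly_Mapping.keys_add)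
  then show ?thesis
    by (simp add: lin_ext_superset[of ?S] lookup_add const_add distrib_right sum.distrib)
qed

lemma lin_ext_uminus: "lin_ext f (- p) = - lin_ext f p"
  using lin_ext_add[of f p "- p"] by (simp add: eq_neg_iff_add_eq_0 add.commute)

lemma lin_ext_diff: "lin_ext f (p - r) = lin_ext f p - lin_ext f r"
  using lin_ext_add[of f p "- r"] by (simp add: lin_ext_uminus)

lemma lin_ext_sum: "lin_ext f (\<Sum>x\<in>S. g x) = (\<Sum>x\<in>S. lin_ext f (g x))"
  by (induction S rule: infinite_finite_induct) (simp_all add: lin_ext_add)

lemma lin_ext_const_mult:
  "lin_ext f (const c * (p :: 'm::monoid_add \<Rightarrow>\<^sub>0 'k::field)) = const c * lin_ext f p"
proof (induction p rule: pm_induct_UNIV)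
  case (single m d)
  then show ?case by (simp add: const_times_single lin_ext_single const_mult mult.assoc)
qed (simp_all add: lin_ext_add distrib_left)

lemma lin_ext_mult:
  fixes f :: "'m::monoid_add \<Rightarrow> 'n::monoid_add \<Rightarrow>\<^sub>0 'k::field"
  assumes "\<And>m n. f (m + n) = f m * f n"
  shows "lin_ext f (p * r) = lin_ext f p * lin_ext f r"
proof (induction p rule: pm_induct_UNIV)
  case (single m c)
  show ?case
  proof (induction r rule: pm_induct_UNIV)
    case (single n d)
    have "const c * f m * (const d * f n) = const c * (f m * const d) * f n"
      by (simp only: mult.assoc)
    also have "\<dots> = const c * const d * (f m * f n)"
      by (simp only: const_central[of d "f m", symmetric] mult.assoc)
    finally show ?case
      by (simp add: mult_single lin_ext_single assms const_mult)
  qed (simp_all add: lin_ext_add distrib_left)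
qed (simp_all add: lin_ext_add distrib_right)

text \<open>Nested over its arguments, this reduces a multilinear identity to monomials; the set
  \<open>S\<close> carries a restriction on degrees through the induction.\<close>

lemma additive_eqI:
  fixes \<phi> \<psi> :: "('m \<Rightarrow>\<^sub>0 'k::field) \<Rightarrow> 'b::ab_group_add"
  assumes "Poly_Mapping.keys p \<subseteq> S"
    and "\<And>x y. \<phi> (x + y) = \<phi> x + \<phi> y" "\<And>x y. \<psi> (x + y) = \<psi> x + \<psi> y"
    and "\<And>m c. m \<in> S \<Longrightarrow> \<phi> (Poly_Mapping.single m c) = \<psi> (Poly_Mapping.single m c)"
  shows "\<phi> p = \<psi> p"
  using assms(1)
proof (induction p rule: pm_induct)
  case zero
  show ?case using assms(2)[of 0 0] assms(3)[of 0 0] by simp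
qed (simp_all add: assms)

lemma single_sum_keys:
  "(\<Sum>m\<in>Poly_Mapping.keys p. Poly_Mapping.single m (Poly_Mapping.lookup p m)) = p"
  by (rule poly_mapping_eqI) (auto simp: lookup_sum lookup_single when_def in_keys_iff)


section \<open>Gradings of monoid algebras\<close>

definition hom_part :: "('m::monoid_add \<Rightarrow> 'g) \<Rightarrow> 'g \<Rightarrow> ('m \<Rightarrow>\<^sub>0 'k::field) \<Rightarrow> ('m \<Rightarrow>\<^sub>0 'k)" where
  "hom_part gr g = lin_ext (\<lambda>m. if gr m = g then Poly_Mapping.single m 1 else 0)"

lemma hom_part_single:
  "hom_part gr g (Poly_Mapping.single m c) = (if gr m = g then Poly_Mapping.single m c else 0)"
  by (simp add: hom_part_def lin_ext_single const_times_single)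

lemma hom_part_0 [simp]: "hom_part gr g 0 = 0"
  by (simp add: hom_part_def)

lemma hom_part_add: "hom_part gr g (p + r) = hom_part gr g p + hom_part gr g r"
  by (simp add: hom_part_def lin_ext_add)

lemma hom_part_diff: "hom_part gr g (p - r) = hom_part gr g p - hom_part gr g r"
  by (simp add: hom_part_def lin_ext_diff)

lemma hom_part_sum: "hom_part gr g (\<Sum>x\<in>S. f x) = (\<Sum>x\<in>S. hom_part gr g (f x))"
  by (simp add: hom_part_def lin_ext_sum)

lemma lookup_hom_part:
  "Poly_Mapping.lookup (hom_part gr g p) m = (if gr m = g then Poly_Mapping.lookup p m else 0)"
proof (induction p rule: pm_induct_UNIV)
  case (single k v) then show ?case by (auto simp: hom_part_single lookup_single when_def)
qed (simp_all add: hom_part_add lookup_add)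

lemma keys_hom_part: "Poly_Mapping.keys (hom_part gr g p) = {m \<in> Poly_Mapping.keys p. gr m = g}"
  by (auto simp: in_keys_iff lookup_hom_part split: if_splits)

lemma hom_part_homogeneous:
  assumes "\<And>m. m \<in> Poly_Mapping.keys p \<Longrightarrow> gr m = d"
  shows "hom_part gr g p = (if d = g then p else 0)"
  using assms by (intro poly_mapping_eqI) (auto simp: lookup_hom_part in_keys_iff)

lemma sum_hom_part:
  assumes "finite S" "gr ` Poly_Mapping.keys p \<subseteq> S"
  shows "(\<Sum>g\<in>S. hom_part gr g p) = p"
proof (rule poly_mapping_eqI)
  fix m
  have "Poly_Mapping.lookup p m = 0" if "gr m \<notin> S"
    using assms(2) that by (auto simp: in_keys_iff image_subset_iff)
  then show "Poly_Mapping.lookup (\<Sum>g\<in>S. hom_part gr g p) m = Poly_Mapping.lookup p m"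
    using assms(1) by (auto simp: lookup_sum lookup_hom_part)
qed

lemma hom_part_mult_single:
  fixes gr :: "'m::monoid_add \<Rightarrow> 'g::ab_group_add"
  assumes gr: "\<And>m n. gr (m + n) = gr m + gr n"
  shows "hom_part gr g (Poly_Mapping.single m c * p) = Poly_Mapping.single m c * hom_part gr (g - gr m) p"
    and "hom_part gr g (p * Poly_Mapping.single m c) = hom_part gr (g - gr m) p * Poly_Mapping.single m c"
proof -
  show "hom_part gr g (Poly_Mapping.single m c * p) = Poly_Mapping.single m c * hom_part gr (g - gr m) p"
  proof (induction p rule: pm_induct_UNIV)
    case (single n d) show ?case by (auto simp: mult_single hom_part_single gr algebra_simps)
  qed (simp_all add: distrib_left hom_part_add)
  show "hom_part gr g (p * Poly_Mapping.single m c) = hom_part gr (g - gr m) p * Poly_Mapping.single m c"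
  proof (induction p rule: pm_induct_UNIV)
    case (single n d) show ?case by (auto simp: mult_single hom_part_single gr algebra_simps)
  qed (simp_all add: distrib_right hom_part_add)
qed

text \<open>The elements all of whose components lie in the ideal form an ideal themselves, because
  multiplication by a monomial only shifts degrees. Treating all degrees at once is what survives
  the shift.\<close>

lemma hom_part_genideal:
  fixes gr :: "'m::monoid_add \<Rightarrow> 'g::ab_group_add" and S :: "('m \<Rightarrow>\<^sub>0 'k::field) set"
  assumes gr: "\<And>m n. gr (m + n) = gr m + gr n"
    and gen: "\<And>s g. s \<in> S \<Longrightarrow> hom_part gr g s \<in> genideal full_ring S"
    and x: "x \<in> genideal full_ring S"
  shows "hom_part gr g x \<in> genideal full_ring S"
proof -
  interpret two_sided_ideal "genideal full_ring S" by (rule two_sided_ideal_genideal)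
  let ?K = "{x. \<forall>g. hom_part gr g x \<in> genideal full_ring S}"
  have "two_sided_ideal ?K"
  proof
    show "0 \<in> ?K" by (simp add: zero_mem)
  next
    fix x y assume "x \<in> ?K" "y \<in> ?K" then show "x + y \<in> ?K" by (simp add: hom_part_add add_mem)
  next
    fix x r assume x: "x \<in> ?K"
    show "r * x \<in> ?K"
      by (induction r rule: pm_induct_UNIV)
         (use x in \<open>auto simp: zero_mem distrib_right hom_part_add add_mem hom_part_mult_single[OF gr] mult_left_mem\<close>)
    show "x * r \<in> ?K"
      by (induction r rule: pm_induct_UNIV)
         (use x in \<open>auto simp: zero_mem distrib_left hom_part_add add_mem hom_part_mult_single[OF gr] mult_right_mem\<close>)
  qed
  then have "genideal full_ring S \<subseteq> ?K"
    by (rule genideal_subset) (use gen in auto)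
  then show ?thesis using x by auto
qed


section \<open>Free algebras\<close>

lemma Word_plus: "Word u + Word v = Word (u @ v)"
  by (simp add: plus_fmon_def)

lemma letters_plus [simp]: "letters (m + n) = letters m @ letters n"
  by (simp add: plus_fmon_def)

lemma letters_0 [simp]: "letters 0 = []"
  by (simp add: zero_fmon_def)

abbreviation word :: "'a list \<Rightarrow> ('a, 'k::field) free_alg" where
  "word w \<equiv> Poly_Mapping.single (Word w) 1"

lemma word_Nil [simp]: "word [] = 1"
  by (simp flip: zero_fmon_def)

lemma word_append: "word (u @ v) = word u * word v"
  by (simp add: mult_single Word_plus)

lemma word_Cons: "word (i # v) = letter i * word v"
  by (simp add: letter_def mult_single Word_plus)

definition free_lift :: "('a \<Rightarrow> 'n::monoid_add \<Rightarrow>\<^sub>0 'k::field) \<Rightarrow> ('a, 'k) free_alg \<Rightarrow> ('n \<Rightarrow>\<^sub>0 'k)" where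
  "free_lift f = lin_ext (\<lambda>w. prod_list (map f (letters w)))"

lemma free_lift_mult: "free_lift f (p * r) = free_lift f p * free_lift f r"
  unfolding free_lift_def by (rule lin_ext_mult) simp

lemma free_lift_add: "free_lift f (p + r) = free_lift f p + free_lift f r"
  by (simp add: free_lift_def lin_ext_add)

lemma free_lift_diff: "free_lift f (p - r) = free_lift f p - free_lift f r"
  by (simp add: free_lift_def lin_ext_diff)

lemma free_lift_uminus: "free_lift f (- p) = - free_lift f p"
  by (simp add: free_lift_def lin_ext_uminus)

lemma free_lift_sum: "free_lift f (\<Sum>x\<in>S. g x) = (\<Sum>x\<in>S. free_lift f (g x))"
  by (simp add: free_lift_def lin_ext_sum)

lemma free_lift_0 [simp]: "free_lift f 0 = 0"
  by (simp add: free_lift_def)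

lemma free_lift_single: "free_lift f (Poly_Mapping.single m c) = const c * prod_list (map f (letters m))"
  by (simp add: free_lift_def lin_ext_single)

lemma free_lift_const [simp]: "free_lift f (const c) = const c"
  by (subst const_def) (simp add: free_lift_single)

lemma free_lift_1 [simp]: "free_lift f 1 = 1"
  using free_lift_const[of f 1] by simp

lemma free_lift_letter [simp]: "free_lift f (letter x) = f x"
  by (simp add: letter_def free_lift_single)

lemma free_coproduct_eq: "free_coproduct = free_lift coproduct_gen"
  by (rule ext) (simp add: free_coproduct_def free_lift_def lin_ext_def)


section \<open>Tensor products of free algebras\<close>

lemma free_tensor_superset:
  assumes "finite S" "finite T" "Poly_Mapping.keys p \<subseteq> S" "Poly_Mapping.keys r \<subseteq> T"
  shows "free_tensor p r = (\<Sum>u\<in>S. \<Sum>v\<in>T.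
    Poly_Mapping.single (u, v) (Poly_Mapping.lookup p u * Poly_Mapping.lookup r v))"
proof -
  have "free_tensor p r = (\<Sum>u\<in>Poly_Mapping.keys p. \<Sum>v\<in>T.
    Poly_Mapping.single (u, v) (Poly_Mapping.lookup p u * Poly_Mapping.lookup r v))"
    unfolding free_tensor_def using assms
    by (intro sum.cong refl sum.mono_neutral_left) (auto simp: in_keys_iff)
  also have "\<dots> = (\<Sum>u\<in>S. \<Sum>v\<in>T.
    Poly_Mapping.single (u, v) (Poly_Mapping.lookup p u * Poly_Mapping.lookup r v))"
    using assms by (intro sum.mono_neutral_left) (auto simp: in_keys_iff)
  finally show ?thesis .
qed

lemma free_tensor_add_left: "free_tensor (p + p') r = free_tensor p r + free_tensor p' r"
proof -
  let ?S = "Poly_Mapping.keys p \<union> Poly_Mapping.keys p'"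
  have "Poly_Mapping.keys (p + p') \<subseteq> ?S" by (rule Poly_Mapping.keys_add)
  then show ?thesis
    by (simp add: free_tensor_superset[of ?S "Poly_Mapping.keys r"] lookup_add
        distrib_right single_add sum.distrib)
qed

lemma free_tensor_add_right: "free_tensor p (r + r') = free_tensor p r + free_tensor p r'"
proof -
  let ?S = "Poly_Mapping.keys r \<union> Poly_Mapping.keys r'"
  have "Poly_Mapping.keys (r + r') \<subseteq> ?S" by (rule Poly_Mapping.keys_add)
  then show ?thesis
    by (simp add: free_tensor_superset[of "Poly_Mapping.keys p" ?S] lookup_add
        distrib_left single_add sum.distrib)
qed

lemma free_tensor_single:
  "free_tensor (Poly_Mapping.single u c) (Poly_Mapping.single v d) = Poly_Mapping.single (u, v) (c * d)"
  by (subst free_tensor_superset[of "{u}" "{v}"]) auto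

lemma free_tensor_0 [simp]: "free_tensor 0 r = 0" "free_tensor p 0 = 0"
  by (simp_all add: free_tensor_def)

lemma free_tensor_1 [simp]: "free_tensor 1 1 = 1"
  by (simp add: free_tensor_single zero_prod_def flip: single_one)

lemma free_tensor_uminus:
  "free_tensor (- p) r = - free_tensor p r" "free_tensor p (- r) = - free_tensor p r"
  using free_tensor_add_left[of p "- p" r] free_tensor_add_right[of p r "- r"]
  by (simp_all add: eq_neg_iff_add_eq_0 add.commute)

lemma free_tensor_diff:
  "free_tensor (p - p') r = free_tensor p r - free_tensor p' r"
  "free_tensor p (r - r') = free_tensor p r - free_tensor p r'"
  using free_tensor_add_left[of p "- p'" r] free_tensor_add_right[of p r "- r'"]
  by (simp_all add: free_tensor_uminus)

lemma free_tensor_mult: "free_tensor p r * free_tensor p' r' = free_tensor (p * p') (r * r')"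
proof (induction p rule: pm_induct_UNIV)
  case (single u c)
  show ?case
  proof (induction r rule: pm_induct_UNIV)
    case (single v d)
    show ?case
    proof (induction p' rule: pm_induct_UNIV)
      case (single u' c')
      show ?case
      proof (induction r' rule: pm_induct_UNIV)
        case (single v' d')
        show ?case by (simp add: free_tensor_single mult_single mult_ac)
      qed (simp_all add: free_tensor_add_right distrib_left)
    qed (simp_all add: free_tensor_add_left distrib_left)
  qed (simp_all add: free_tensor_add_right distrib_right)
qed (simp_all add: free_tensor_add_left distrib_right)

lemma free_tensor_const_left: "free_tensor (const c * p) r = const c * free_tensor p r"
proof (induction p rule: pm_induct_UNIV)
  case (single u d)
  show ?case
  proof (induction r rule: pm_induct_UNIV)
    case (single v e)
    show ?case by (simp add: free_tensor_single const_times_single mult_ac)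
  qed (simp_all add: free_tensor_add_right distrib_left)
qed (simp_all add: free_tensor_add_left distrib_left)

lemma free_tensor_const_right: "free_tensor p (const c * r) = const c * free_tensor p r"
proof (induction p rule: pm_induct_UNIV)
  case (single u d)
  show ?case
  proof (induction r rule: pm_induct_UNIV)
    case (single v e)
    show ?case by (simp add: free_tensor_single const_times_single mult_ac)
  qed (simp_all add: free_tensor_add_right distrib_left)
qed (simp_all add: free_tensor_add_left distrib_left)

section \<open>Gaussian binomial coefficients\<close>

text \<open>For k > n the value of \<open>q_binom\<close> need not vanish, because n - k is
  truncated to 0. The Pascal rules and the summation bounds rely on the value 0 there.\<close>

definition gauss_binom :: "'k::field \<Rightarrow> nat \<Rightarrow> nat \<Rightarrow> 'k" where
  "gauss_binom v n k = (if k \<le> n then q_binom v n k else 0)"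

lemma q_fact_Suc: "q_fact v (Suc n) = q_int v (Suc n) * q_fact v n"
  by (simp add: q_fact_def mult.commute)

lemma q_fact_0 [simp]: "q_fact v 0 = 1"
  by (simp add: q_fact_def)

lemma q_int_add: "q_int v (m + n) = q_int v m + v ^ m * q_int v n"
  by (simp add: q_int_def power_add right_diff_distrib flip: add_divide_distrib)

lemma q_fact_nonzero:
  assumes "\<forall>n>0. v ^ n \<noteq> (1 :: 'k::field)"
  shows "q_fact v n \<noteq> 0"
  unfolding q_fact_def using assms assms[rule_format, of 1] by (auto simp: q_int_def)

lemma gauss_binom_0 [simp]:
  assumes "\<forall>n>0. v ^ n \<noteq> (1 :: 'k::field)"
  shows "gauss_binom v n 0 = 1"
  using q_fact_nonzero[OF assms] by (simp add: gauss_binom_def q_binom_def)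

lemma gauss_binom_self:
  assumes "\<forall>n>0. v ^ n \<noteq> (1 :: 'k::field)"
  shows "gauss_binom v n n = 1"
  using q_fact_nonzero[OF assms] by (simp add: gauss_binom_def q_binom_def)

lemma gauss_binom_gt: "k > n \<Longrightarrow> gauss_binom v n k = 0"
  by (simp add: gauss_binom_def)

text \<open>The two rules come from splitting n + 1 = (n - k) + (k + 1) in either order with
  \<open>q_int_add\<close>. The first drives \<open>braided_ad_expand\<close>;
  \<open>ad_coeff_Suc\<close> plays one against the other.\<close>

lemma gauss_binom_pascal:
  assumes v: "\<forall>n>0. v ^ n \<noteq> (1 :: 'k::field)" and "k \<le> n"
  shows "gauss_binom v (Suc n) (Suc k) = gauss_binom v n (Suc k) + v ^ (n - k) * gauss_binom v n k"
    and "gauss_binom v (Suc n) (Suc k) = v ^ Suc k * gauss_binom v n (Suc k) + gauss_binom v n k"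
proof -
  note nz = q_fact_nonzero[OF v]
  have "gauss_binom v (Suc n) (Suc k) = gauss_binom v n (Suc k) + v ^ (n - k) * gauss_binom v n k \<and>
    gauss_binom v (Suc n) (Suc k) = v ^ Suc k * gauss_binom v n (Suc k) + gauss_binom v n k"
  proof (cases "k = n")
    case True
    then show ?thesis by (simp add: gauss_binom_self[OF v] gauss_binom_gt)
  next
    case False
    then obtain d where n: "n = k + Suc d" using \<open>k \<le> n\<close> by (metis less_iff_Suc_add le_neq_implies_less add_Suc_right)
    let ?N = "q_fact v n" and ?K = "q_fact v k" and ?D = "q_fact v d"
      and ?a = "q_int v (Suc k)" and ?b = "q_int v (Suc d)"
    have nz': "?a \<noteq> 0" "?b \<noteq> 0" "?K \<noteq> 0" "?D \<noteq> 0"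
      using nz[of "Suc k"] nz[of "Suc d"] nz[of k] nz[of d] by (auto simp: q_fact_Suc)
    have 1: "gauss_binom v (Suc n) (Suc k) = q_int v (Suc n) * ?N / (?a * ?K * (?b * ?D))"
      "gauss_binom v n (Suc k) = ?N / (?a * ?K * ?D)" "gauss_binom v n k = ?N / (?K * (?b * ?D))"
      using n by (simp_all add: gauss_binom_def q_binom_def q_fact_Suc)
    have "Suc n = Suc d + Suc k" using n by simp
    then have 2: "q_int v (Suc n) = ?b + v ^ Suc d * ?a" using q_int_add by metis
    have "Suc n = Suc k + Suc d" using n by simp
    then have 3: "q_int v (Suc n) = ?a + v ^ Suc k * ?b" using q_int_add by metis
    have d: "n - k = Suc d" using n by simp
    have "(?b + v ^ Suc d * ?a) * ?N / (?a * ?K * (?b * ?D)) = ?N / (?a * ?K * ?D) + v ^ Suc d * (?N / (?K * (?b * ?D)))"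
      using nz' by (simp add: field_simps del: power_Suc)
    moreover have "(?a + v ^ Suc k * ?b) * ?N / (?a * ?K * (?b * ?D)) = v ^ Suc k * (?N / (?a * ?K * ?D)) + ?N / (?K * (?b * ?D))"
      using nz' by (simp add: field_simps del: power_Suc)
    ultimately show ?thesis unfolding 1 d using 2 3 by metis
  qed
  then show "gauss_binom v (Suc n) (Suc k) = gauss_binom v n (Suc k) + v ^ (n - k) * gauss_binom v n k"
    and "gauss_binom v (Suc n) (Suc k) = v ^ Suc k * gauss_binom v n (Suc k) + gauss_binom v n k"
    by blast+
qed


section \<open>Iterated braided commutators\<close>

text \<open>Scalars act through an operation of their own rather than by multiplication with
  constants, so that the simplifier collects them in front of products and the same lemmas apply in
  an opposite ring.\<close>

locale scalar_algebra =
  fixes sc :: "'k::field \<Rightarrow> 'r::ring_1 \<Rightarrow> 'r" (infixr "\<cdot>" 75)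
  assumes sc_add_left: "(c + d) \<cdot> x = c \<cdot> x + d \<cdot> x"
    and sc_add_right: "c \<cdot> (x + y) = c \<cdot> x + c \<cdot> y"
    and sc_sc [simp]: "c \<cdot> (d \<cdot> x) = (c * d) \<cdot> x"
    and sc_one [simp]: "1 \<cdot> x = x"
    and sc_mult_left [simp]: "(c \<cdot> x) * y = c \<cdot> (x * y)"
    and sc_mult_right [simp]: "x * (c \<cdot> y) = c \<cdot> (x * y)"
begin

lemma sc_zero_left [simp]: "0 \<cdot> x = 0"
  using sc_add_left[of 0 0 x] by simp

lemma sc_zero_right [simp]: "c \<cdot> 0 = 0"
  using sc_add_right[of c 0 0] by simp

lemma sc_uminus_left: "(- c) \<cdot> x = - (c \<cdot> x)"
  using sc_add_left[of c "- c" x] by (simp add: eq_neg_iff_add_eq_0 add.commute)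

lemma sc_uminus_right: "c \<cdot> (- x) = - (c \<cdot> x)"
  using sc_add_right[of c x "- x"] by (simp add: eq_neg_iff_add_eq_0 add.commute)

lemma sc_diff_left: "(c - d) \<cdot> x = c \<cdot> x - d \<cdot> x"
  using sc_add_left[of c "- d" x] by (simp add: sc_uminus_left)

lemma sc_diff_right: "c \<cdot> (x - y) = c \<cdot> x - c \<cdot> y"
  using sc_add_right[of c x "- y"] by (simp add: sc_uminus_right)

lemma sc_sum: "c \<cdot> (\<Sum>x\<in>S. f x) = (\<Sum>x\<in>S. c \<cdot> f x)"
  by (induction S rule: infinite_finite_induct) (simp_all add: sc_add_right)

text \<open>This is (ad x)^m (y) for the braided adjoint action: v^m s is the braiding of x with x^m
  y, where v belongs to x with itself and s to x with y. For x = e_i, y = e_j, v = q_ii, s = q_ij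
  and m = 1 - a_ij it is the left side of a Serre relation.\<close>

primrec braided_ad :: "'k \<Rightarrow> 'k \<Rightarrow> 'r \<Rightarrow> 'r \<Rightarrow> nat \<Rightarrow> 'r" where
  "braided_ad v s x y 0 = y"
| "braided_ad v s x y (Suc m) = x * braided_ad v s x y m - (v ^ m * s) \<cdot> (braided_ad v s x y m * x)"

text \<open>The coefficients follow the first Pascal rule: passing from k to k + 1 raises the
  exponent k(k-1)/2 by k, and v^k v^(m-k) = v^m is the scalar of the commutator step.\<close>

lemma braided_ad_expand:
  assumes v: "\<forall>n>0. v ^ n \<noteq> 1"
  shows "braided_ad v s x y m =
    (\<Sum>k\<le>m. ((-1) ^ k * gauss_binom v m k * v ^ (k * (k - 1) div 2) * s ^ k) \<cdot> (x ^ (m - k) * y * x ^ k))"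
proof (induction m)
  case 0
  show ?case by (simp add: gauss_binom_0[OF v])
next
  case (Suc m)
  let ?g = "gauss_binom v"
  define C where "C m k = (-1) ^ k * ?g m k * v ^ (k * (k - 1) div 2) * s ^ k" for m k
  define T where "T k = x ^ (Suc m - k) * y * x ^ k" for k
  have C_Suc: "C (Suc m) (Suc k) = C m (Suc k) - v ^ m * s * C m k" if "k \<le> m" for k
  proof -
    define e e' where "e = k * (k - 1) div 2" and "e' = Suc k * (Suc k - 1) div 2"
    have "e' = e + k"
      by (cases k) (auto simp: e_def e'_def algebra_simps)
    then have pw: "v ^ e' * v ^ (m - k) = v ^ e * v ^ m"
      using that by (simp flip: power_add)
    have C': "C n (Suc k) = (-1) ^ Suc k * ?g n (Suc k) * v ^ e' * s ^ Suc k" for n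
      by (simp only: C_def e'_def)
    have "C (Suc m) (Suc k) = C m (Suc k) - (-1) ^ k * ?g m k * (v ^ e' * v ^ (m - k)) * (s * s ^ k)"
      unfolding C' gauss_binom_pascal(1)[OF v that] by (simp add: ring_distribs mult_ac)
    also have "\<dots> = C m (Suc k) - v ^ m * s * C m k"
      unfolding pw by (simp only: C_def flip: e_def) (simp add: mult_ac)
    finally show ?thesis .
  qed
  have C0: "C (Suc m) 0 = C m 0" "C m (Suc m) = 0"
    by (simp_all add: C_def gauss_binom_0[OF v] gauss_binom_gt)
  have "braided_ad v s x y (Suc m) = (\<Sum>k\<le>m. C m k \<cdot> (x * (x ^ (m - k) * y * x ^ k)))
      - (\<Sum>k\<le>m. (v ^ m * s * C m k) \<cdot> (x ^ (m - k) * y * x ^ k * x))"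
    unfolding braided_ad.simps Suc.IH
    by (simp add: sum_distrib_left sum_distrib_right sc_sum C_def mult.assoc)
  also have "(\<Sum>k\<le>m. C m k \<cdot> (x * (x ^ (m - k) * y * x ^ k))) = (\<Sum>k\<le>Suc m. C m k \<cdot> T k)"
    by (simp add: C0 T_def Suc_diff_le mult.assoc)
  also have "(\<Sum>k\<le>m. (v ^ m * s * C m k) \<cdot> (x ^ (m - k) * y * x ^ k * x)) =
      (\<Sum>k\<le>m. (v ^ m * s * C m k) \<cdot> T (Suc k))"
    by (simp add: T_def mult.assoc power_commutes)
  also have "(\<Sum>k\<le>Suc m. C m k \<cdot> T k) - \<dots> = C m 0 \<cdot> T 0 + (\<Sum>k\<le>m. C (Suc m) (Suc k) \<cdot> T (Suc k))"
    by (simp only: sum.atMost_Suc_shift) (simp add: C_Suc sc_diff_left sum_subtractf)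
  also have "\<dots> = (\<Sum>k\<le>Suc m. C (Suc m) k \<cdot> T k)"
    by (simp only: sum.atMost_Suc_shift C0)
  finally show ?case by (simp only: C_def T_def)
qed

end

locale scalar_algebra_ideal = scalar_algebra sc + two_sided_ideal J
  for sc :: "'k::field \<Rightarrow> 'r::ring_1 \<Rightarrow> 'r" (infixr "\<cdot>" 75) and J :: "'r set"
begin

abbreviation cong (infix "\<approx>" 50) where "x \<approx> y \<equiv> ideal_cong J x y"

lemma cong_sc: "x \<approx> y \<Longrightarrow> c \<cdot> x \<approx> c \<cdot> y"
  using mult_left_mem[of "x - y" "c \<cdot> 1"] by (simp add: ideal_cong_def sc_diff_right)

lemma skew_commute_power:
  assumes "y * x \<approx> v \<cdot> (x * y)"
  shows "y * x ^ n \<approx> v ^ n \<cdot> (x ^ n * y)"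
proof (induction n)
  case (Suc n)
  have "y * x ^ Suc n = (y * x) * x ^ n" by (simp add: mult.assoc)
  also have "\<dots> \<approx> (v \<cdot> (x * y)) * x ^ n" by (rule cong_right[OF assms])
  also have "\<dots> = v \<cdot> (x * (y * x ^ n))" by (simp add: mult.assoc)
  also have "\<dots> \<approx> v \<cdot> (x * (v ^ n \<cdot> (x ^ n * y)))" by (intro cong_sc cong_left Suc.IH)
  finally show ?case by (simp add: mult.assoc)
qed simp

text \<open>Every term of the commutator contains m factors x and one p, and y passes these with the
  scalars v and s. The parameters \<open>v'\<close>, \<open>s'\<close> of the commutator are
  independent of v and s.\<close>

lemma braided_ad_skew_left:
  assumes yx: "y * x \<approx> v \<cdot> (x * y)" and yp: "y * p \<approx> s \<cdot> (p * y)"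
  shows "y * braided_ad v' s' x p m \<approx> (v ^ m * s) \<cdot> (braided_ad v' s' x p m * y)"
proof (induction m)
  case 0 then show ?case using yp by simp
next
  case (Suc m)
  let ?A = "braided_ad v' s' x p m" and ?c = "v ^ m * s"
  have 1: "y * (x * ?A) \<approx> (v * ?c) \<cdot> (x * ?A * y)"
  proof -
    have "y * (x * ?A) \<approx> (v \<cdot> (x * y)) * ?A" using cong_right[OF yx] by (simp add: mult.assoc)
    also have "\<dots> = v \<cdot> (x * (y * ?A))" by (simp add: mult.assoc)
    also have "\<dots> \<approx> v \<cdot> (x * (?c \<cdot> (?A * y)))" by (intro cong_sc cong_left Suc.IH)
    finally show ?thesis by (simp add: mult.assoc)
  qed
  have 2: "y * (?A * x) \<approx> (v * ?c) \<cdot> (?A * x * y)"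
  proof -
    have "y * (?A * x) \<approx> ?c \<cdot> (?A * y) * x" using cong_right[OF Suc.IH] by (simp add: mult.assoc)
    also have "\<dots> = ?c \<cdot> (?A * (y * x))" by (simp add: mult.assoc)
    also have "\<dots> \<approx> ?c \<cdot> (?A * (v \<cdot> (x * y)))" by (intro cong_sc cong_left yx)
    finally show ?thesis by (simp add: mult.assoc mult.commute[of v])
  qed
  have "y * braided_ad v' s' x p (Suc m) = y * (x * ?A) - (v' ^ m * s') \<cdot> (y * (?A * x))"
    by (simp add: right_diff_distrib)
  also have "\<dots> \<approx> (v * ?c) \<cdot> (x * ?A * y) - (v' ^ m * s') \<cdot> ((v * ?c) \<cdot> (?A * x * y))"
    by (intro cong_diff cong_sc 1 2)
  also have "\<dots> = (v * ?c) \<cdot> (braided_ad v' s' x p (Suc m) * y)"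
    by (simp add: left_diff_distrib sc_diff_right mult.commute)
  finally show ?case by (simp add: mult.assoc)
qed

lemma braided_ad_skew_right:
  assumes yx: "y * x \<approx> v \<cdot> (x * y)" and wx: "w * x \<approx> r \<cdot> (x * w)"
  shows "braided_ad v' s' y w k * x \<approx> (v ^ k * r) \<cdot> (x * braided_ad v' s' y w k)"
proof (induction k)
  case 0 then show ?case using wx by simp
next
  case (Suc k)
  let ?A = "braided_ad v' s' y w k" and ?c = "v ^ k * r"
  have 1: "y * ?A * x \<approx> (v * ?c) \<cdot> (x * (y * ?A))"
  proof -
    have "y * ?A * x \<approx> y * (?c \<cdot> (x * ?A))" using cong_left[OF Suc.IH] by (simp add: mult.assoc)
    also have "\<dots> = ?c \<cdot> ((y * x) * ?A)" by (simp add: mult.assoc)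
    also have "\<dots> \<approx> ?c \<cdot> ((v \<cdot> (x * y)) * ?A)" by (intro cong_sc cong_right yx)
    finally show ?thesis by (simp add: mult.assoc mult.commute[of v])
  qed
  have 2: "?A * y * x \<approx> (v * ?c) \<cdot> (x * (?A * y))"
  proof -
    have "?A * y * x \<approx> ?A * (v \<cdot> (x * y))" using cong_left[OF yx] by (simp add: mult.assoc)
    also have "\<dots> = v \<cdot> ((?A * x) * y)" by (simp add: mult.assoc)
    also have "\<dots> \<approx> v \<cdot> ((?c \<cdot> (x * ?A)) * y)" by (intro cong_sc cong_right Suc.IH)
    finally show ?thesis by (simp add: mult.assoc)
  qed
  have "braided_ad v' s' y w (Suc k) * x = y * ?A * x - (v' ^ k * s') \<cdot> (?A * y * x)"
    by (simp add: left_diff_distrib)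
  also have "\<dots> \<approx> (v * ?c) \<cdot> (x * (y * ?A)) - (v' ^ k * s') \<cdot> ((v * ?c) \<cdot> (x * (?A * y)))"
    by (intro cong_diff cong_sc 1 2)
  also have "\<dots> = (v * ?c) \<cdot> (x * braided_ad v' s' y w (Suc k))"
    by (simp add: right_diff_distrib sc_diff_right mult.commute)
  finally show ?case by (simp add: mult.assoc)
qed

text \<open>Coefficient of x^(m-k) (ad y)^k (w) in (ad (x+y))^m (p+w), where t = s r collects the
  scalars of y past p and of w past x. The product makes the Serre exponent special: it contains a
  zero factor as soon as v^l t = 1 for some l with k \<le> l < m.\<close>

definition ad_coeff :: "'k \<Rightarrow> 'k \<Rightarrow> nat \<Rightarrow> nat \<Rightarrow> 'k" where
  "ad_coeff v t m k = gauss_binom v m k * (\<Prod>l=k..<m. 1 - v ^ l * t)"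

lemma ad_coeff_Suc:
  assumes v: "\<forall>n>0. v ^ n \<noteq> (1 :: 'k)"
  shows "ad_coeff v t (Suc m) 0 = ad_coeff v t m 0 * (1 - v ^ m * t)"
    and "k \<le> m \<Longrightarrow> ad_coeff v t (Suc m) (Suc k) =
      ad_coeff v t m (Suc k) * (1 - v ^ (m + Suc k) * t) + v ^ (m - k) * ad_coeff v t m k"
proof -
  show "ad_coeff v t (Suc m) 0 = ad_coeff v t m 0 * (1 - v ^ m * t)"
    by (simp add: ad_coeff_def gauss_binom_0[OF v])
  assume k: "k \<le> m"
  show "ad_coeff v t (Suc m) (Suc k) =
      ad_coeff v t m (Suc k) * (1 - v ^ (m + Suc k) * t) + v ^ (m - k) * ad_coeff v t m k"
  proof (cases "k = m")
    case True
    then show ?thesis by (simp add: ad_coeff_def gauss_binom_self[OF v] gauss_binom_gt)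
  next
    case False
    let ?G = "gauss_binom v m (Suc k)" and ?H = "gauss_binom v m k" and ?P = "\<Prod>l=Suc k..<m. 1 - v ^ l * t"
    have P: "(\<Prod>l=k..<m. 1 - v ^ l * t) = (1 - v ^ k * t) * ?P"
      using False k by (simp add: prod.atLeast_Suc_lessThan)
    have P': "(\<Prod>l=Suc k..<Suc m. 1 - v ^ l * t) = (1 - v ^ m * t) * ?P"
      using False k by (simp add: mult.commute)
    have vm: "v ^ m = v ^ (m - k) * v ^ k" using k by (simp flip: power_add)
    have "?G + v ^ (m - k) * ?H = v ^ Suc k * ?G + ?H"
      using gauss_binom_pascal[OF v k] by simp
    \<comment> \<open>The 1 meets the first Pascal form and v^m t the second; then \<open>?G\<close>
      collects the factor 1 - v^(m+k+1) t and \<open>?H\<close> the factor v^(m-k) (1 - v^k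
      t).\<close>
    then have "(?G + v ^ (m - k) * ?H) * (1 - v ^ m * t) =
        (?G + v ^ (m - k) * ?H) - (v ^ Suc k * ?G + ?H) * (v ^ m * t)"
      by (simp add: right_diff_distrib)
    also have "\<dots> = ?G * (1 - v ^ (m + Suc k) * t) + v ^ (m - k) * (?H * (1 - v ^ k * t))"
      unfolding power_add by (simp add: algebra_simps vm)
    finally have *: "(?G + v ^ (m - k) * ?H) * (1 - v ^ m * t) = \<dots>" .
    have "ad_coeff v t (Suc m) (Suc k) = ((?G + v ^ (m - k) * ?H) * (1 - v ^ m * t)) * ?P"
      unfolding ad_coeff_def P' gauss_binom_pascal(1)[OF v k] by (simp add: mult.assoc)
    also have "\<dots> = ad_coeff v t m (Suc k) * (1 - v ^ (m + Suc k) * t) + v ^ (m - k) * ad_coeff v t m k"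
      unfolding * ad_coeff_def P by (simp add: algebra_simps)
    finally show ?thesis .
  qed
qed

text \<open>Induction on m, with \<open>S\<close> as one commutator step by x + y. On the pure term
  in x and p the two contributions of y cancel by \<open>braided_ad_skew_left\<close>; on x^(m-k)
  (ad y)^k (w), x lengthens the power and y raises k.\<close>

lemma braided_ad_sum:
  assumes v: "\<forall>n>0. v ^ n \<noteq> (1 :: 'k)"
    and yx: "y * x \<approx> v \<cdot> (x * y)" and yp: "y * p \<approx> s \<cdot> (p * y)" and wx: "w * x \<approx> r \<cdot> (x * w)"
  shows "braided_ad v s (x + y) (p + w) m \<approx>
    braided_ad v s x p m + (\<Sum>k\<le>m. ad_coeff v (s * r) m k \<cdot> (x ^ (m - k) * braided_ad v s y w k))"
proof (induction m)
  case 0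
  show ?case by (simp add: ad_coeff_def gauss_binom_self[OF v])
next
  case (Suc m)
  let ?c = "ad_coeff v (s * r)" and ?W = "braided_ad v s y w" and ?P = "braided_ad v s x p"
  define S where "S T = (x + y) * T - (v ^ m * s) \<cdot> (T * (x + y))" for T
  have S_add: "S (T + T') = S T + S T'" for T T'
    by (simp add: S_def algebra_simps sc_add_right)
  have S_0: "S 0 = 0" by (simp add: S_def)
  have S_sum: "S (\<Sum>k\<in>K. f k) = (\<Sum>k\<in>K. S (f k))" for K :: "nat set" and f
    by (induction K rule: infinite_finite_induct) (simp_all add: S_add S_0)
  have S_sc: "S (c \<cdot> T) = c \<cdot> S T" for c T
    by (simp add: S_def algebra_simps sc_diff_right sc_add_right)
  have S_cong: "S T \<approx> S T'" if "T \<approx> T'" for T T'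
    unfolding S_def using that by (intro cong_diff cong_sc cong_mult) simp_all
  have S_P: "S (?P m) \<approx> ?P (Suc m)"
  proof -
    have "S (?P m) = x * ?P m + y * ?P m - (v ^ m * s) \<cdot> (?P m * x) - (v ^ m * s) \<cdot> (?P m * y)"
      by (simp add: S_def algebra_simps sc_add_right)
    also have "\<dots> \<approx> x * ?P m + (v ^ m * s) \<cdot> (?P m * y) - (v ^ m * s) \<cdot> (?P m * x) - (v ^ m * s) \<cdot> (?P m * y)"
      by (intro cong_diff cong_add braided_ad_skew_left yx yp) simp_all
    finally show ?thesis by simp
  qed
  \<comment> \<open>The two contributions of x are multiples of x^(m-k+1) (ad y)^k (w), one with
    coefficient v^(m+k) s r after x has moved to the left. For those of y, v^m s = v^(m-k) v^k s, so
    the next commutator splits off behind v^(m-k).\<close>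
  have S_W: "S (x ^ (m - k) * ?W k) \<approx>
      (1 - v ^ (m + k) * (s * r)) \<cdot> (x ^ (Suc m - k) * ?W k) + v ^ (m - k) \<cdot> (x ^ (m - k) * ?W (Suc k))"
    if "k \<le> m" for k
  proof -
    let ?n = "m - k"
    have vm: "v ^ m = v ^ ?n * v ^ k" using that by (simp flip: power_add)
    have "S (x ^ ?n * ?W k) = x ^ (Suc m - k) * ?W k + (y * x ^ ?n) * ?W k
        - (v ^ m * s) \<cdot> (x ^ ?n * (?W k * x)) - (v ^ m * s) \<cdot> (x ^ ?n * (?W k * y))"
      using that by (simp add: S_def algebra_simps sc_add_right Suc_diff_le)
    also have "\<dots> \<approx> x ^ (Suc m - k) * ?W k + (v ^ ?n \<cdot> (x ^ ?n * y)) * ?W k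
        - (v ^ m * s) \<cdot> (x ^ ?n * ((v ^ k * r) \<cdot> (x * ?W k))) - (v ^ m * s) \<cdot> (x ^ ?n * (?W k * y))"
      by (intro cong_diff cong_add cong_sc cong_left cong_right braided_ad_skew_right
          skew_commute_power yx wx) simp_all
    also have "x ^ ?n * ((v ^ k * r) \<cdot> (x * ?W k)) = (v ^ k * r) \<cdot> (x ^ (Suc m - k) * ?W k)"
      using that by (simp add: Suc_diff_le power_commutes mult.assoc[symmetric])
    also have "x ^ (Suc m - k) * ?W k + (v ^ ?n \<cdot> (x ^ ?n * y)) * ?W k
        - (v ^ m * s) \<cdot> ((v ^ k * r) \<cdot> (x ^ (Suc m - k) * ?W k)) - (v ^ m * s) \<cdot> (x ^ ?n * (?W k * y))
      = (1 - v ^ (m + k) * (s * r)) \<cdot> (x ^ (Suc m - k) * ?W k) + v ^ (m - k) \<cdot> (x ^ (m - k) * ?W (Suc k))"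
    proof -
      have "(v ^ m * s) * (v ^ k * r) = v ^ (m + k) * (s * r)" by (simp add: power_add mult_ac)
      moreover have "v ^ ?n * (v ^ k * s) = v ^ m * s" unfolding vm by (simp only: mult.assoc)
      ultimately show ?thesis
        by (simp only: braided_ad.simps right_diff_distrib sc_diff_left sc_diff_right sc_sc
            sc_mult_left sc_mult_right sc_one mult.assoc) simp
    qed
    finally show ?thesis .
  qed
  have "braided_ad v s (x + y) (p + w) (Suc m) = S (braided_ad v s (x + y) (p + w) m)"
    by (simp add: S_def)
  also have "\<dots> \<approx> S (?P m + (\<Sum>k\<le>m. ?c m k \<cdot> (x ^ (m - k) * ?W k)))"
    by (intro S_cong Suc.IH)
  also have "\<dots> = S (?P m) + (\<Sum>k\<le>m. ?c m k \<cdot> S (x ^ (m - k) * ?W k))"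
    by (simp add: S_add S_sum S_sc)
  also have "\<dots> \<approx> ?P (Suc m) + (\<Sum>k\<le>m. ?c m k \<cdot> ((1 - v ^ (m + k) * (s * r)) \<cdot> (x ^ (Suc m - k) * ?W k)
      + v ^ (m - k) \<cdot> (x ^ (m - k) * ?W (Suc k))))"
    by (intro cong_add cong_sum cong_sc S_P S_W) simp
  also have "(\<Sum>k\<le>m. ?c m k \<cdot> ((1 - v ^ (m + k) * (s * r)) \<cdot> (x ^ (Suc m - k) * ?W k)
      + v ^ (m - k) \<cdot> (x ^ (m - k) * ?W (Suc k)))) =
      (\<Sum>k\<le>m. (?c m k * (1 - v ^ (m + k) * (s * r))) \<cdot> (x ^ (Suc m - k) * ?W k))
      + (\<Sum>k\<le>m. (v ^ (m - k) * ?c m k) \<cdot> (x ^ (m - k) * ?W (Suc k)))"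
    by (simp add: sc_add_right sum.distrib mult.commute)
  \<comment> \<open>The summand for k = m + 1 is 0 because the Gaussian binomial vanishes; including
    it permits the index shift that aligns this sum with the other one.\<close>
  also have "(\<Sum>k\<le>m. (?c m k * (1 - v ^ (m + k) * (s * r))) \<cdot> (x ^ (Suc m - k) * ?W k)) =
      (\<Sum>k\<le>Suc m. (?c m k * (1 - v ^ (m + k) * (s * r))) \<cdot> (x ^ (Suc m - k) * ?W k))"
    by (simp add: ad_coeff_def gauss_binom_gt)
  also have "\<dots> = ?c (Suc m) 0 \<cdot> (x ^ Suc m * ?W 0) +
      (\<Sum>k\<le>m. (?c m (Suc k) * (1 - v ^ (m + Suc k) * (s * r))) \<cdot> (x ^ (m - k) * ?W (Suc k)))"
    by (simp only: sum.atMost_Suc_shift ad_coeff_Suc(1)[OF v] diff_Suc_Suc) (simp del: braided_ad.simps)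
  also have "\<dots> + (\<Sum>k\<le>m. (v ^ (m - k) * ?c m k) \<cdot> (x ^ (m - k) * ?W (Suc k))) =
      ?c (Suc m) 0 \<cdot> (x ^ Suc m * ?W 0) + (\<Sum>k\<le>m. ?c (Suc m) (Suc k) \<cdot> (x ^ (m - k) * ?W (Suc k)))"
    by (simp add: ad_coeff_Suc(2)[OF v] sc_add_left sum.distrib add.assoc del: braided_ad.simps)
  also have "\<dots> = (\<Sum>k\<le>Suc m. ?c (Suc m) k \<cdot> (x ^ (Suc m - k) * ?W k))"
    by (simp only: sum.atMost_Suc_shift diff_Suc_Suc) (simp del: braided_ad.simps)
  finally show ?case .
qed

text \<open>At the exponent of the Serre relation all the mixed terms of \<open>braided_ad_sum\<close> drop out.\<close>

lemma braided_ad_serre: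
  assumes v: "\<forall>n>0. v ^ n \<noteq> (1 :: 'k)"
    and yx: "y * x \<approx> v \<cdot> (x * y)" and yp: "y * p \<approx> s \<cdot> (p * y)" and wx: "w * x \<approx> r \<cdot> (x * w)"
    and t: "v ^ m * (s * r) = 1"
  shows "braided_ad v s (x + y) (p + w) (Suc m) \<approx> braided_ad v s x p (Suc m) + braided_ad v s y w (Suc m)"
proof -
  \<comment> \<open>The product contains the factor for l = m, which is 1 - v^m s r = 0.\<close>
  have "ad_coeff v (s * r) (Suc m) k = 0" if "k \<le> m" for k
    using that t by (auto simp: ad_coeff_def prod_zero_iff intro!: bexI[of _ m])
  moreover have "ad_coeff v (s * r) (Suc m) (Suc m) = 1"
    by (simp add: ad_coeff_def gauss_binom_self[OF v])
  ultimately have "(\<Sum>k\<le>Suc m. ad_coeff v (s * r) (Suc m) k \<cdot> (x ^ (Suc m - k) * braided_ad v s y w k))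
      = braided_ad v s y w (Suc m)"
    by (simp del: braided_ad.simps)
  then show ?thesis using braided_ad_sum[OF v yx yp wx, of "Suc m"] by simp
qed

end


section \<open>Opposite rings\<close>

text \<open>Reading products backwards turns the shape of the Serre relations for the f_i into that
  for the e_i, so the commutator lemmas cover both.\<close>

datatype 'a opp = Opp (unopp: 'a)

instantiation opp :: (ring_1) ring_1
begin

definition zero_opp :: "'a opp" where "zero_opp = Opp 0"
definition one_opp :: "'a opp" where "one_opp = Opp 1"
definition plus_opp :: "'a opp \<Rightarrow> 'a opp \<Rightarrow> 'a opp" where "plus_opp x y = Opp (unopp x + unopp y)"
definition minus_opp :: "'a opp \<Rightarrow> 'a opp \<Rightarrow> 'a opp" where "minus_opp x y = Opp (unopp x - unopp y)"
definition uminus_opp :: "'a opp \<Rightarrow> 'a opp" where "uminus_opp x = Opp (- unopp x)"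
definition times_opp :: "'a opp \<Rightarrow> 'a opp \<Rightarrow> 'a opp" where "times_opp x y = Opp (unopp y * unopp x)"

instance
  by standard (auto simp: zero_opp_def one_opp_def plus_opp_def minus_opp_def uminus_opp_def
      times_opp_def algebra_simps)

end

lemma unopp_simps [simp]:
  "unopp 0 = 0" "unopp 1 = 1" "unopp (x + y) = unopp x + unopp y" "unopp (x - y) = unopp x - unopp y"
  "unopp (- x) = - unopp x" "unopp (x * y) = unopp y * unopp x"
  by (simp_all add: zero_opp_def one_opp_def plus_opp_def minus_opp_def uminus_opp_def times_opp_def)

lemma unopp_power [simp]: "unopp (x ^ n) = unopp x ^ n"
  by (induction n) (simp_all add: power_commutes)

lemma unopp_sum: "unopp (\<Sum>x\<in>S. f x) = (\<Sum>x\<in>S. unopp (f x))"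
  by (induction S rule: infinite_finite_induct) simp_all

lemma (in two_sided_ideal) two_sided_ideal_opp: "two_sided_ideal {x. unopp x \<in> J}"
  by unfold_locales (simp_all add: zero_mem add_mem mult_left_mem mult_right_mem)

lemma ideal_cong_opp: "ideal_cong {x. unopp x \<in> J} x y \<longleftrightarrow> ideal_cong J (unopp x) (unopp y)"
  by (simp add: ideal_cong_def)

definition scale :: "'k::field \<Rightarrow> ('m::monoid_add \<Rightarrow>\<^sub>0 'k) \<Rightarrow> ('m \<Rightarrow>\<^sub>0 'k)" where
  "scale c x = const c * x"

interpretation scale: scalar_algebra scale
proof
  fix c :: "'k::field" and x y :: "'m::monoid_add \<Rightarrow>\<^sub>0 'k"
  show "x * scale c y = scale c (x * y)" unfolding scale_def by (rule const_left_commute)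
qed (simp_all only: scale_def const_add const_mult distrib_left distrib_right mult.assoc const_1 mult_1_left)

definition scale_opp :: "'k::field \<Rightarrow> ('m::monoid_add \<Rightarrow>\<^sub>0 'k) opp \<Rightarrow> ('m \<Rightarrow>\<^sub>0 'k) opp" where
  "scale_opp c x = Opp (scale c (unopp x))"

interpretation scale_opp: scalar_algebra scale_opp
  by unfold_locales
    (simp_all add: scale_opp_def plus_opp_def times_opp_def scale.sc_add_left scale.sc_add_right)

lemma unopp_scale [simp]: "unopp (scale_opp c x) = scale c (unopp x)"
  by (simp add: scale_opp_def)

section \<open>The coproduct on the quotient\<close>

lemma scale_1_left: "scale c 1 = const c"
  by (simp add: scale_def)

lemma free_lift_scale: "free_lift g (scale c p) = scale c (free_lift g p)"
  by (simp add: scale_def free_lift_mult)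

abbreviation tensor (infixl "\<^bold>\<otimes>" 68) where "p \<^bold>\<otimes> r \<equiv> free_tensor p r"

lemma scale_tensor [simp]:
  "scale c p \<^bold>\<otimes> r = scale c (p \<^bold>\<otimes> r)" "p \<^bold>\<otimes> scale c r = scale c (p \<^bold>\<otimes> r)"
  by (simp_all add: scale_def free_tensor_const_left free_tensor_const_right)

lemma hom_braided_ad:
  fixes \<phi> :: "('m::monoid_add \<Rightarrow>\<^sub>0 'k::field) \<Rightarrow> ('n::monoid_add \<Rightarrow>\<^sub>0 'k)"
  assumes "\<And>x y. \<phi> (x - y) = \<phi> x - \<phi> y" "\<And>x y. \<phi> (x * y) = \<phi> x * \<phi> y"
    and "\<And>c x. \<phi> (scale c x) = scale c (\<phi> x)"
  shows "\<phi> (scale.braided_ad v s x y m) = scale.braided_ad v s (\<phi> x) (\<phi> y) m"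
    and "\<phi> (unopp (scale_opp.braided_ad v s (Opp x) (Opp y) m)) =
      unopp (scale_opp.braided_ad v s (Opp (\<phi> x)) (Opp (\<phi> y)) m)"
  by (induction m) (simp_all add: assms)

locale quantum_data =
  fixes a :: "'i \<Rightarrow> 'i \<Rightarrow> int" and q :: "'i \<Rightarrow> 'i \<Rightarrow> 'k::field"
  assumes q_nonzero: "q i j \<noteq> 0"
    and q_symm: "q i j * q j i = q i i powi a i j"
    and q_not_root: "\<forall>n>0. q i i ^ n \<noteq> 1"
    and a_nonpos: "i \<noteq> j \<Longrightarrow> a i j \<le> 0"
begin

sublocale U: scalar_algebra_ideal scale "U_ideal a q"
  by (intro scalar_algebra_ideal.intro scale.scalar_algebra_axioms)
     (simp add: U_ideal_def two_sided_ideal_genideal)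

sublocale UU: scalar_algebra_ideal scale "UU_ideal a q"
  by (intro scalar_algebra_ideal.intro scale.scalar_algebra_axioms)
     (simp add: UU_ideal_def two_sided_ideal_genideal)

sublocale UU_opp: scalar_algebra_ideal scale_opp "{x. unopp x \<in> UU_ideal a q}"
  by (intro scalar_algebra_ideal.intro scale_opp.scalar_algebra_axioms UU.two_sided_ideal_opp)

abbreviation U_cong (infix "\<approx>" 50) where "x \<approx> y \<equiv> ideal_cong (U_ideal a q) x y"
abbreviation UU_cong (infix "\<approx>\<approx>" 50) where "x \<approx>\<approx> y \<equiv> ideal_cong (UU_ideal a q) x y"

abbreviation E where "E i \<equiv> letter (Ge i)"
abbreviation F where "F i \<equiv> letter (Gf i)"
abbreviation K where "K i \<equiv> letter (Gom i)"
abbreviation Kinv where "Kinv i \<equiv> letter (Gom_inv i)"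
abbreviation L where "L i \<equiv> letter (Gom' i)"
abbreviation Linv where "Linv i \<equiv> letter (Gom'_inv i)"

section \<open>The defining relations as commutation rules\<close>

lemma relator_mem: "x \<in> relators a q \<Longrightarrow> x \<in> U_ideal a q"
  unfolding U_ideal_def by (rule genideal_incl)

lemma torus_cong:
  "x \<in> torus_generators \<Longrightarrow> y \<in> torus_generators \<Longrightarrow> letter x * letter y \<approx> letter y * letter x"
  unfolding ideal_cong_def by (intro relator_mem relators.torus_commute)

lemma torus_mem [simp]:
  "Gom i \<in> torus_generators" "Gom_inv i \<in> torus_generators"
  "Gom' i \<in> torus_generators" "Gom'_inv i \<in> torus_generators"
  by (simp_all add: torus_generators_def)

lemma K_Kinv: "K i * Kinv i \<approx> 1" and L_Linv: "L i * Linv i \<approx> 1"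
  unfolding ideal_cong_def by (intro relator_mem relators.om_inverse relators.om'_inverse)+

text \<open>Only \<omega>_i \<omega>_i^{-1} = 1 is among the relators; commuting torus generators
  give the other order, which \<open>conjugation_cong\<close> requires.\<close>

lemma Kinv_K: "Kinv i * K i \<approx> 1"
  by (rule U.cong_trans[OF torus_cong K_Kinv]) simp_all

lemma Linv_L: "Linv i * L i \<approx> 1"
  by (rule U.cong_trans[OF torus_cong L_Linv]) simp_all

lemma conjugation_cong:
  assumes "g * x * g' \<approx> scale c x" "g' * g \<approx> 1"
  shows "g * x \<approx> scale c (x * g)"
proof -
  have "g * x \<approx> g * x * (g' * g)"
    using U.cong_sym[OF U.cong_left[OF assms(2), of "g * x"]] by simp
  also have "\<dots> = g * x * g' * g" by (simp add: mult.assoc)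
  also have "\<dots> \<approx> scale c x * g" by (rule U.cong_right[OF assms(1)])
  finally show ?thesis by simp
qed

lemma K_E: "K i * E j \<approx> scale (q i j) (E j * K i)"
  by (rule conjugation_cong[OF _ Kinv_K])
     (simp add: ideal_cong_def scale_def relator_mem relators.om_e)

lemma L_E: "L i * E j \<approx> scale (inverse (q j i)) (E j * L i)"
  by (rule conjugation_cong[OF _ Linv_L])
     (simp add: ideal_cong_def scale_def relator_mem relators.om'_e)

lemma K_F: "K i * F j \<approx> scale (inverse (q i j)) (F j * K i)"
  by (rule conjugation_cong[OF _ Kinv_K])
     (simp add: ideal_cong_def scale_def relator_mem relators.om_f)

lemma L_F: "L i * F j \<approx> scale (q j i) (F j * L i)"
  by (rule conjugation_cong[OF _ Linv_L])
     (simp add: ideal_cong_def scale_def relator_mem relators.om'_f)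

lemma E_F: "E i * F j - F j * E i \<approx> (if i = j then scale (q i i / (q i i - 1)) (K i - L i) else 0)"
  using relator_mem[OF relators.e_f[of i j]] by (simp only: ideal_cong_def scale_def)

lemma serre_coeff_eq:
  "k \<le> m \<Longrightarrow> m = nat (1 - a i j) \<Longrightarrow>
    serre_coeff a q i j k = (-1) ^ k * gauss_binom (q i i) m k * q i i ^ (k * (k - 1) div 2) * q i j ^ k"
  by (simp add: serre_coeff_def gauss_binom_def)

lemma serre_e_eq:
  "(\<Sum>k\<le>nat (1 - a i j). const (serre_coeff a q i j k)
        * E i ^ (nat (1 - a i j) - k) * E j * E i ^ k) =
    scale.braided_ad (q i i) (q i j) (E i) (E j) (nat (1 - a i j))"
  by (simp add: scale.braided_ad_expand[OF q_not_root] serre_coeff_eq scale_def mult.assoc)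

text \<open>Reversal turns x^(m-k) y x^k into x^k y x^(m-k), and the coefficients of the two
  families of Serre relations agree.\<close>

lemma serre_f_eq:
  "(\<Sum>k\<le>nat (1 - a i j). const (serre_coeff a q i j k)
        * F i ^ k * F j * F i ^ (nat (1 - a i j) - k)) =
    unopp (scale_opp.braided_ad (q i i) (q i j) (Opp (F i)) (Opp (F j)) (nat (1 - a i j)))"
  by (simp add: scale_opp.braided_ad_expand[OF q_not_root] serre_coeff_eq unopp_sum scale_def mult.assoc)

text \<open>A pure tensor factors as (p \<otimes> 1)(1 \<otimes> r), which connects it with the
  generators of \<open>UU_ideal\<close>.\<close>

lemma tensor_mem: "p \<in> U_ideal a q \<Longrightarrow> p \<^bold>\<otimes> r \<in> UU_ideal a q" "r \<in> U_ideal a q \<Longrightarrow> p \<^bold>\<otimes> r \<in> UU_ideal a q"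
proof -
  assume "p \<in> U_ideal a q"
  then have "p \<^bold>\<otimes> 1 \<in> UU_ideal a q" unfolding UU_ideal_def by (intro genideal_incl) auto
  then have "(p \<^bold>\<otimes> 1) * (1 \<^bold>\<otimes> r) \<in> UU_ideal a q" by (rule UU.mult_right_mem)
  then show "p \<^bold>\<otimes> r \<in> UU_ideal a q" by (simp add: free_tensor_mult)
next
  assume "r \<in> U_ideal a q"
  then have "1 \<^bold>\<otimes> r \<in> UU_ideal a q" unfolding UU_ideal_def by (intro genideal_incl) auto
  then have "(p \<^bold>\<otimes> 1) * (1 \<^bold>\<otimes> r) \<in> UU_ideal a q" by (rule UU.mult_left_mem)
  then show "p \<^bold>\<otimes> r \<in> UU_ideal a q" by (simp add: free_tensor_mult)
qed

lemma tensor_cong: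
  assumes "p \<approx> p'" "r \<approx> r'"
  shows "p \<^bold>\<otimes> r \<approx>\<approx> p' \<^bold>\<otimes> r'"
proof -
  have "(p - p') \<^bold>\<otimes> r + p' \<^bold>\<otimes> (r - r') \<in> UU_ideal a q"
    using assms by (intro UU.add_mem tensor_mem) (simp_all add: ideal_cong_def)
  then show ?thesis by (simp add: ideal_cong_def free_tensor_diff)
qed

lemma tensor_cong_left: "p \<approx> p' \<Longrightarrow> p \<^bold>\<otimes> r \<approx>\<approx> p' \<^bold>\<otimes> r"
  and tensor_cong_right: "r \<approx> r' \<Longrightarrow> p \<^bold>\<otimes> r \<approx>\<approx> p \<^bold>\<otimes> r'"
  by (simp_all add: tensor_cong)

lemma power_commute_cong:
  assumes "g * h \<approx> h * g"
  shows "g ^ m * h * g \<approx> g ^ Suc m * h"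
proof -
  have "g ^ m * (h * g) \<approx> g ^ m * (g * h)" by (intro U.cong_left U.cong_sym[OF assms])
  then show ?thesis by (simp add: power_commutes mult.assoc[symmetric])
qed

text \<open>Since g and h commute, both terms of a commutator step have first factor g^(m+1) h up to
  congruence, and the commutator takes place in the second factor alone.\<close>

lemma braided_ad_tensor:
  assumes "g * h \<approx> h * g"
  shows "scale.braided_ad v s (g \<^bold>\<otimes> x) (h \<^bold>\<otimes> y) m \<approx>\<approx> g ^ m * h \<^bold>\<otimes> scale.braided_ad v s x y m"
proof (induction m)
  case (Suc m)
  let ?A = "scale.braided_ad v s (g \<^bold>\<otimes> x) (h \<^bold>\<otimes> y) m" and ?B = "scale.braided_ad v s x y m"
  have "scale.braided_ad v s (g \<^bold>\<otimes> x) (h \<^bold>\<otimes> y) (Suc m) \<approx>\<approx>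
      (g \<^bold>\<otimes> x) * (g ^ m * h \<^bold>\<otimes> ?B) - scale (v ^ m * s) ((g ^ m * h \<^bold>\<otimes> ?B) * (g \<^bold>\<otimes> x))"
    unfolding scale.braided_ad.simps by (intro UU.cong_diff UU.cong_sc UU.cong_left UU.cong_right Suc.IH)
  also have "\<dots> = (g ^ Suc m * h \<^bold>\<otimes> x * ?B) - scale (v ^ m * s) (g ^ m * h * g \<^bold>\<otimes> ?B * x)"
    by (simp add: free_tensor_mult mult.assoc)
  also have "\<dots> \<approx>\<approx> (g ^ Suc m * h \<^bold>\<otimes> x * ?B) - scale (v ^ m * s) (g ^ Suc m * h \<^bold>\<otimes> ?B * x)"
    by (intro UU.cong_diff UU.cong_sc tensor_cong_left power_commute_cong assms UU.cong_refl)
  also have "\<dots> = g ^ Suc m * h \<^bold>\<otimes> scale.braided_ad v s x y (Suc m)"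
    by (simp add: free_tensor_diff)
  finally show ?case .
qed simp

lemma braided_ad_opp_tensor:
  assumes "g * h \<approx> h * g"
  shows "unopp (scale_opp.braided_ad v s (Opp (x \<^bold>\<otimes> g)) (Opp (y \<^bold>\<otimes> h)) m) \<approx>\<approx>
    unopp (scale_opp.braided_ad v s (Opp x) (Opp y) m) \<^bold>\<otimes> g ^ m * h"
proof (induction m)
  case (Suc m)
  let ?A = "unopp (scale_opp.braided_ad v s (Opp (x \<^bold>\<otimes> g)) (Opp (y \<^bold>\<otimes> h)) m)"
    and ?B = "unopp (scale_opp.braided_ad v s (Opp x) (Opp y) m)"
  have "unopp (scale_opp.braided_ad v s (Opp (x \<^bold>\<otimes> g)) (Opp (y \<^bold>\<otimes> h)) (Suc m)) =
      ?A * (x \<^bold>\<otimes> g) - scale (v ^ m * s) ((x \<^bold>\<otimes> g) * ?A)"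
    by simp
  also have "\<dots> \<approx>\<approx> (?B \<^bold>\<otimes> g ^ m * h) * (x \<^bold>\<otimes> g) - scale (v ^ m * s) ((x \<^bold>\<otimes> g) * (?B \<^bold>\<otimes> g ^ m * h))"
    by (intro UU.cong_diff UU.cong_sc UU.cong_left UU.cong_right Suc.IH)
  also have "\<dots> = (?B * x \<^bold>\<otimes> g ^ m * h * g) - scale (v ^ m * s) (x * ?B \<^bold>\<otimes> g ^ Suc m * h)"
    by (simp add: free_tensor_mult mult.assoc)
  also have "\<dots> \<approx>\<approx> (?B * x \<^bold>\<otimes> g ^ Suc m * h) - scale (v ^ m * s) (x * ?B \<^bold>\<otimes> g ^ Suc m * h)"
    by (intro UU.cong_diff tensor_cong_right power_commute_cong assms UU.cong_refl)
  also have "\<dots> = unopp (scale_opp.braided_ad v s (Opp x) (Opp y) (Suc m)) \<^bold>\<otimes> g ^ Suc m * h"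
    by (simp add: free_tensor_diff)
  finally show ?case .
qed simp

text \<open>With m = -a_ij, the relation q_ij q_ji = q_ii^(a_ij) becomes the condition under which
  \<open>braided_ad_serre\<close> applies at exponent m + 1.\<close>

lemma q_serre_exponent:
  assumes "i \<noteq> j"
  obtains m where "nat (1 - a i j) = Suc m" "q i i ^ m * (q i j * q j i) = 1"
proof
  have a: "a i j = - int (nat (- a i j))" using a_nonpos[OF assms] by simp
  show "nat (1 - a i j) = Suc (nat (- a i j))" using a_nonpos[OF assms] by simp
  have "q i j * q j i = inverse (q i i ^ nat (- a i j))"
    unfolding q_symm by (subst a) (simp only: power_int_minus power_int_of_nat)
  then show "q i i ^ nat (- a i j) * (q i j * q j i) = 1"
    using q_nonzero by simp
qed

section \<open>Compatibility of the coproduct with the relators\<close>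

abbreviation \<Delta> :: "('i gen, 'k) free_alg \<Rightarrow> ('i gen, 'k) free_alg2" where
  "\<Delta> \<equiv> free_lift coproduct_gen"

text \<open>With x = e_i \<otimes> 1 and y = \<omega>_i \<otimes> e_i, and p, w the same for j, no
  mixed terms remain. In each of the two surviving terms one tensor factor is the Serre element,
  hence in \<open>U_ideal\<close>.\<close>

lemma \<Delta>_serre_e:
  assumes "i \<noteq> j"
  shows "\<Delta> (scale.braided_ad (q i i) (q i j) (E i) (E j) (nat (1 - a i j))) \<in> UU_ideal a q"
proof -
  obtain m where m: "nat (1 - a i j) = Suc m" "q i i ^ m * (q i j * q j i) = 1"
    using q_serre_exponent[OF assms] .
  let ?ad = "scale.braided_ad (q i i) (q i j)"
  have serre: "?ad (E i) (E j) (Suc m) \<in> U_ideal a q"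
    using relator_mem[OF relators.serre_e[OF assms]] unfolding serre_e_eq unfolding m .
  \<comment> \<open>This one rule yields all three commutation hypotheses of
    \<open>braided_ad_serre\<close>: (k, l) = (i, i), (i, j), (j, i) give the scalars v, s,
    r.\<close>
  have K_E_tensor: "(K k \<^bold>\<otimes> E k) * (E l \<^bold>\<otimes> 1) \<approx>\<approx> scale (q k l) ((E l \<^bold>\<otimes> 1) * (K k \<^bold>\<otimes> E k))" for k l
    using tensor_cong_left[OF K_E] by (simp add: free_tensor_mult)
  have "\<Delta> (?ad (E i) (E j) (Suc m)) = ?ad (\<Delta> (E i)) (\<Delta> (E j)) (Suc m)"
    by (rule hom_braided_ad(1)) (simp_all only: free_lift_diff free_lift_mult free_lift_scale)
  also have "\<dots> \<approx>\<approx> ?ad (E i \<^bold>\<otimes> 1) (E j \<^bold>\<otimes> 1) (Suc m) + ?ad (K i \<^bold>\<otimes> E i) (K j \<^bold>\<otimes> E j) (Suc m)"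
    unfolding free_lift_letter coproduct_gen.simps
    by (rule UU.braided_ad_serre[OF q_not_root K_E_tensor K_E_tensor K_E_tensor m(2)])
  also have "?ad (E i \<^bold>\<otimes> 1) (E j \<^bold>\<otimes> 1) (Suc m) = ?ad (E i) (E j) (Suc m) \<^bold>\<otimes> 1"
    by (rule hom_braided_ad(1)[symmetric]) (simp_all add: free_tensor_diff free_tensor_mult)
  also have "\<dots> + ?ad (K i \<^bold>\<otimes> E i) (K j \<^bold>\<otimes> E j) (Suc m) \<approx>\<approx>
      ?ad (E i) (E j) (Suc m) \<^bold>\<otimes> 1 + (K i ^ Suc m * K j \<^bold>\<otimes> ?ad (E i) (E j) (Suc m))"
    by (intro UU.cong_add braided_ad_tensor torus_cong UU.cong_refl torus_mem)
  finally have "\<Delta> (?ad (E i) (E j) (Suc m)) \<approx>\<approx>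
      ?ad (E i) (E j) (Suc m) \<^bold>\<otimes> 1 + (K i ^ Suc m * K j \<^bold>\<otimes> ?ad (E i) (E j) (Suc m))" .
  then show ?thesis
    unfolding m by (rule UU.cong_mem) (intro UU.add_mem tensor_mem serre)
qed

lemma \<Delta>_serre_f:
  assumes "i \<noteq> j"
  shows "\<Delta> (unopp (scale_opp.braided_ad (q i i) (q i j) (Opp (F i)) (Opp (F j)) (nat (1 - a i j)))) \<in> UU_ideal a q"
proof -
  obtain m where m: "nat (1 - a i j) = Suc m" "q i i ^ m * (q i j * q j i) = 1"
    using q_serre_exponent[OF assms] .
  let ?ad = "scale_opp.braided_ad (q i i) (q i j)"
  let ?f = "\<lambda>x y. unopp (?ad (Opp x) (Opp y) (Suc m))"
  have serre: "?f (F i) (F j) \<in> U_ideal a q"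
    using relator_mem[OF relators.serre_f[OF assms]] unfolding serre_f_eq unfolding m .
  have L_F_tensor: "ideal_cong {x. unopp x \<in> UU_ideal a q} (Opp (1 \<^bold>\<otimes> F l) * Opp (F k \<^bold>\<otimes> L k))
      (scale_opp (q l k) (Opp (F k \<^bold>\<otimes> L k) * Opp (1 \<^bold>\<otimes> F l)))" for k l
    using tensor_cong_right[OF L_F] by (simp add: ideal_cong_opp free_tensor_mult)
  have "\<Delta> (?f (F i) (F j)) = ?f (\<Delta> (F i)) (\<Delta> (F j))"
    by (rule hom_braided_ad(2)) (simp_all only: free_lift_diff free_lift_mult free_lift_scale)
  \<comment> \<open>The summands change places: under reversed multiplication it is 1 \<otimes> f_i
    that moves past f_k \<otimes> \<omega>'_k with the scalar q_ik, so it plays the part of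
    y.\<close>
  also have "\<dots> = unopp (?ad (Opp (F i \<^bold>\<otimes> L i) + Opp (1 \<^bold>\<otimes> F i)) (Opp (F j \<^bold>\<otimes> L j) + Opp (1 \<^bold>\<otimes> F j)) (Suc m))"
    unfolding free_lift_letter coproduct_gen.simps plus_opp_def by (simp only: opp.sel add.commute)
  also have "\<dots> \<approx>\<approx> unopp (?ad (Opp (F i \<^bold>\<otimes> L i)) (Opp (F j \<^bold>\<otimes> L j)) (Suc m)
      + ?ad (Opp (1 \<^bold>\<otimes> F i)) (Opp (1 \<^bold>\<otimes> F j)) (Suc m))"
    unfolding ideal_cong_opp[symmetric]
    by (rule UU_opp.braided_ad_serre[OF q_not_root L_F_tensor L_F_tensor L_F_tensor m(2)])
  also have "\<dots> = ?f (F i \<^bold>\<otimes> L i) (F j \<^bold>\<otimes> L j) + ?f (1 \<^bold>\<otimes> F i) (1 \<^bold>\<otimes> F j)"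
    by (rule unopp_simps)
  also have "?f (1 \<^bold>\<otimes> F i) (1 \<^bold>\<otimes> F j) = 1 \<^bold>\<otimes> ?f (F i) (F j)"
    by (rule hom_braided_ad(2)[symmetric]) (simp_all add: free_tensor_diff free_tensor_mult)
  also have "?f (F i \<^bold>\<otimes> L i) (F j \<^bold>\<otimes> L j) + \<dots> \<approx>\<approx>
      (?f (F i) (F j) \<^bold>\<otimes> L i ^ Suc m * L j) + (1 \<^bold>\<otimes> ?f (F i) (F j))"
    by (intro UU.cong_add braided_ad_opp_tensor torus_cong UU.cong_refl torus_mem)
  finally have "\<Delta> (?f (F i) (F j)) \<approx>\<approx>
      (?f (F i) (F j) \<^bold>\<otimes> L i ^ Suc m * L j) + (1 \<^bold>\<otimes> ?f (F i) (F j))" .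
  then show ?thesis
    unfolding m by (rule UU.cong_mem) (intro UU.add_mem tensor_mem serre)
qed

lemma \<Delta>_torus: "x \<in> torus_generators \<Longrightarrow> coproduct_gen x = letter x \<^bold>\<otimes> letter x"
  by (auto simp: torus_generators_def)

text \<open>A group-like element conjugates both tensor factors. It commutes with \<omega>_j, so
  both summands of \<Delta>(e_j) are scaled by the same \<open>c\<close>.\<close>

lemma \<Delta>_conjugation_e:
  assumes g: "g \<in> torus_generators" "g' \<in> torus_generators" "letter g * letter g' \<approx> 1"
    and conj: "letter g * E j * letter g' \<approx> scale c (E j)"
  shows "\<Delta> (letter g * E j * letter g') \<approx>\<approx> \<Delta> (scale c (E j))"
proof -
  let ?g = "letter g" and ?g' = "letter g'"
  have "?g * K j * ?g' \<approx> K j * ?g * ?g'" by (intro U.cong_right torus_cong g) simp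
  also have "\<dots> = K j * (?g * ?g')" by (simp add: mult.assoc)
  also have "\<dots> \<approx> K j * 1" by (intro U.cong_left g)
  finally have gK: "?g * K j * ?g' \<approx> K j" by simp
  have "\<Delta> (?g * E j * ?g') = (?g * E j * ?g' \<^bold>\<otimes> ?g * ?g') + (?g * K j * ?g' \<^bold>\<otimes> ?g * E j * ?g')"
    by (simp add: free_lift_mult \<Delta>_torus g free_tensor_mult distrib_left distrib_right)
  also have "\<dots> \<approx>\<approx> (scale c (E j) \<^bold>\<otimes> 1) + (K j \<^bold>\<otimes> scale c (E j))"
    by (intro UU.cong_add tensor_cong conj g gK)
  also have "\<dots> = \<Delta> (scale c (E j))"
    by (simp add: free_lift_scale scale.sc_add_right)
  finally show ?thesis .
qed

lemma \<Delta>_conjugation_f: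
  assumes g: "g \<in> torus_generators" "g' \<in> torus_generators" "letter g * letter g' \<approx> 1"
    and conj: "letter g * F j * letter g' \<approx> scale c (F j)"
  shows "\<Delta> (letter g * F j * letter g') \<approx>\<approx> \<Delta> (scale c (F j))"
proof -
  let ?g = "letter g" and ?g' = "letter g'"
  have "?g * L j * ?g' \<approx> L j * ?g * ?g'" by (intro U.cong_right torus_cong g) simp
  also have "\<dots> = L j * (?g * ?g')" by (simp add: mult.assoc)
  also have "\<dots> \<approx> L j * 1" by (intro U.cong_left g)
  finally have gL: "?g * L j * ?g' \<approx> L j" by simp
  have "\<Delta> (?g * F j * ?g') = (?g * ?g' \<^bold>\<otimes> ?g * F j * ?g') + (?g * F j * ?g' \<^bold>\<otimes> ?g * L j * ?g')"
    by (simp add: free_lift_mult \<Delta>_torus g free_tensor_mult distrib_left distrib_right)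
  also have "\<dots> \<approx>\<approx> (1 \<^bold>\<otimes> scale c (F j)) + (scale c (F j) \<^bold>\<otimes> L j)"
    by (intro UU.cong_add tensor_cong conj g gL)
  also have "\<dots> = \<Delta> (scale c (F j))"
    by (simp add: free_lift_scale scale.sc_add_right)
  finally show ?thesis .
qed

text \<open>The factor q_ij^{-1} from moving \<omega>_i past f_j on the left is absorbed on the
  right by exchanging e_i and \<omega>'_j, so the cross terms cancel. What is left for i = j
  telescopes: (\<omega> - \<omega>') \<otimes> \<omega>' + \<omega> \<otimes> (\<omega> - \<omega>')
  = \<omega> \<otimes> \<omega> - \<omega>' \<otimes> \<omega>'.\<close>

lemma \<Delta>_e_f:
  "\<Delta> (E i * F j - F j * E i) \<approx>\<approx> \<Delta> (if i = j then scale (q i i / (q i i - 1)) (K i - L i) else 0)"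
proof -
  let ?R = "if i = j then scale (q i i / (q i i - 1)) (K i - L i) else 0"
  let ?c = "inverse (q i j)" and ?d = "q i i / (q i i - 1)"
  have cross: "K i * F j \<^bold>\<otimes> E i * L j \<approx>\<approx> F j * K i \<^bold>\<otimes> L j * E i"
  proof -
    have "K i * F j \<^bold>\<otimes> E i * L j \<approx>\<approx> scale ?c (F j * K i) \<^bold>\<otimes> E i * L j"
      by (rule tensor_cong_left[OF K_F])
    also have "\<dots> = F j * K i \<^bold>\<otimes> scale ?c (E i * L j)" by simp
    also have "\<dots> \<approx>\<approx> F j * K i \<^bold>\<otimes> L j * E i"
      by (rule tensor_cong_right[OF U.cong_sym[OF L_E]])
    finally show ?thesis .
  qed
  have 1: "\<Delta> (E i * F j) = (E i \<^bold>\<otimes> F j) + (E i * F j \<^bold>\<otimes> L j) + (K i \<^bold>\<otimes> E i * F j) + (K i * F j \<^bold>\<otimes> E i * L j)"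
    by (simp only: free_lift_mult free_lift_letter coproduct_gen.simps free_tensor_mult
        distrib_left distrib_right mult_1_left mult_1_right add_ac)
  have 2: "\<Delta> (F j * E i) = (E i \<^bold>\<otimes> F j) + (F j * E i \<^bold>\<otimes> L j) + (K i \<^bold>\<otimes> F j * E i) + (F j * K i \<^bold>\<otimes> L j * E i)"
    by (simp only: free_lift_mult free_lift_letter coproduct_gen.simps free_tensor_mult
        distrib_left distrib_right mult_1_left mult_1_right add_ac)
  have cancel: "(A + B + C + D) - (A + B' + C' + D') = (B - B') + (C - C') + (D - D')"
    for A B B' C C' D D' :: "('i gen, 'k) free_alg2"
    by (simp add: algebra_simps)
  have 3: "\<Delta> (E i * F j - F j * E i) =
      ((E i * F j - F j * E i) \<^bold>\<otimes> L j) + (K i \<^bold>\<otimes> (E i * F j - F j * E i))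
      + ((K i * F j \<^bold>\<otimes> E i * L j) - (F j * K i \<^bold>\<otimes> L j * E i))"
    unfolding free_lift_diff 1 2 free_tensor_diff by (rule cancel)
  have 4: "((E i * F j - F j * E i) \<^bold>\<otimes> L j) + (K i \<^bold>\<otimes> (E i * F j - F j * E i))
      + ((K i * F j \<^bold>\<otimes> E i * L j) - (F j * K i \<^bold>\<otimes> L j * E i)) \<approx>\<approx>
      (?R \<^bold>\<otimes> L j) + (K i \<^bold>\<otimes> ?R) + ((F j * K i \<^bold>\<otimes> L j * E i) - (F j * K i \<^bold>\<otimes> L j * E i))"
    by (intro UU.cong_add tensor_cong_left tensor_cong_right E_F UU.cong_diff[OF cross UU.cong_refl])
  have 5: "(?R \<^bold>\<otimes> L j) + (K i \<^bold>\<otimes> ?R) = \<Delta> ?R"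
  proof (cases "i = j")
    case True
    have "scale ?d ((K j \<^bold>\<otimes> L j) - (L j \<^bold>\<otimes> L j)) + scale ?d ((K j \<^bold>\<otimes> K j) - (K j \<^bold>\<otimes> L j)) =
        scale ?d ((K j \<^bold>\<otimes> K j) - (L j \<^bold>\<otimes> L j))"
      unfolding scale.sc_add_right[symmetric] by simp
    then show ?thesis
      using True by (simp add: free_tensor_diff free_lift_scale free_lift_diff)
  qed simp
  show ?thesis
    unfolding 3 using 4 unfolding diff_self add_0_right 5 .
qed

lemma \<Delta>_relator:
  assumes "x \<in> relators a q"
  shows "\<Delta> x \<in> UU_ideal a q"
  using assms
proof cases
  case (torus_commute y z)
  have "\<Delta> (letter y * letter z) = letter y * letter z \<^bold>\<otimes> letter y * letter z"
    using torus_commute by (simp add: free_lift_mult \<Delta>_torus free_tensor_mult)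
  also have "\<dots> \<approx>\<approx> letter z * letter y \<^bold>\<otimes> letter z * letter y"
    using torus_commute by (intro tensor_cong torus_cong)
  also have "\<dots> = \<Delta> (letter z * letter y)"
    using torus_commute by (simp add: free_lift_mult \<Delta>_torus free_tensor_mult)
  finally show ?thesis using torus_commute by (simp add: ideal_cong_def free_lift_diff)
next
  case (om_inverse i)
  have "\<Delta> (K i * Kinv i) = K i * Kinv i \<^bold>\<otimes> K i * Kinv i"
    by (simp add: free_lift_mult free_tensor_mult)
  also have "\<dots> \<approx>\<approx> 1 \<^bold>\<otimes> 1" by (intro tensor_cong K_Kinv)
  finally show ?thesis using om_inverse by (simp add: ideal_cong_def free_lift_diff)
next
  case (om'_inverse i)
  have "\<Delta> (L i * Linv i) = L i * Linv i \<^bold>\<otimes> L i * Linv i"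
    by (simp add: free_lift_mult free_tensor_mult)
  also have "\<dots> \<approx>\<approx> 1 \<^bold>\<otimes> 1" by (intro tensor_cong L_Linv)
  finally show ?thesis using om'_inverse by (simp add: ideal_cong_def free_lift_diff)
next
  case (om_e i j)
  have "K i * E j * Kinv i \<approx> scale (q i j) (E j)"
    using om_e relator_mem[OF assms] by (simp add: ideal_cong_def scale_def)
  from \<Delta>_conjugation_e[OF _ _ K_Kinv this] show ?thesis
    using om_e by (simp add: ideal_cong_def free_lift_diff scale_def)
next
  case (om'_e i j)
  have "L i * E j * Linv i \<approx> scale (inverse (q j i)) (E j)"
    using om'_e relator_mem[OF assms] by (simp add: ideal_cong_def scale_def)
  from \<Delta>_conjugation_e[OF _ _ L_Linv this] show ?thesis
    using om'_e by (simp add: ideal_cong_def free_lift_diff scale_def)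
next
  case (om_f i j)
  have "K i * F j * Kinv i \<approx> scale (inverse (q i j)) (F j)"
    using om_f relator_mem[OF assms] by (simp add: ideal_cong_def scale_def)
  from \<Delta>_conjugation_f[OF _ _ K_Kinv this] show ?thesis
    using om_f by (simp add: ideal_cong_def free_lift_diff scale_def)
next
  case (om'_f i j)
  have "L i * F j * Linv i \<approx> scale (q j i) (F j)"
    using om'_f relator_mem[OF assms] by (simp add: ideal_cong_def scale_def)
  from \<Delta>_conjugation_f[OF _ _ L_Linv this] show ?thesis
    using om'_f by (simp add: ideal_cong_def free_lift_diff scale_def)
next
  case (e_f i j)
  show ?thesis
    using \<Delta>_e_f[of i j] unfolding e_f by (simp only: ideal_cong_def free_lift_diff scale_def)
next
  case (serre_e i j)
  then show ?thesis using \<Delta>_serre_e by (simp only: serre_e_eq)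
next
  case (serre_f i j)
  then show ?thesis using \<Delta>_serre_f by (simp only: serre_f_eq)
qed

lemma \<Delta>_mem:
  assumes "x \<in> U_ideal a q"
  shows "\<Delta> x \<in> UU_ideal a q"
proof -
  have "two_sided_ideal {x. \<Delta> x \<in> UU_ideal a q}"
    by (intro two_sided_ideal_vimage UU.two_sided_ideal_axioms free_lift_add free_lift_mult)
  then have "U_ideal a q \<subseteq> {x. \<Delta> x \<in> UU_ideal a q}"
    unfolding U_ideal_def by (rule genideal_subset) (auto intro: \<Delta>_relator)
  then show ?thesis using assms by auto
qed

lemma \<Delta>_cong: "x \<approx> y \<Longrightarrow> \<Delta> x \<approx>\<approx> \<Delta> y"
  using \<Delta>_mem[of "x - y"] by (simp add: ideal_cong_def free_lift_diff)

end

section \<open>Skew derivations of the free algebra\<close>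

lemma keys_lin_ext: "Poly_Mapping.keys (lin_ext f p) \<subseteq> (\<Union>m\<in>Poly_Mapping.keys p. Poly_Mapping.keys (f m))"
proof
  fix n assume "n \<in> Poly_Mapping.keys (lin_ext f p)"
  then have "(\<Sum>m\<in>Poly_Mapping.keys p. Poly_Mapping.lookup p m * Poly_Mapping.lookup (f m) n) \<noteq> 0"
    by (simp add: in_keys_iff lin_ext_def lookup_sum lookup_const_mult)
  then obtain m where "m \<in> Poly_Mapping.keys p" "Poly_Mapping.lookup p m * Poly_Mapping.lookup (f m) n \<noteq> 0"
    by (rule sum.not_neutral_contains_not_neutral)
  then show "n \<in> (\<Union>m\<in>Poly_Mapping.keys p. Poly_Mapping.keys (f m))"
    by (auto simp: in_keys_iff)
qed

lemma lookup_scale [simp]: "Poly_Mapping.lookup (scale c p) m = c * Poly_Mapping.lookup p m"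
  by (simp add: scale_def lookup_const_mult)

lemma keys_scale: "Poly_Mapping.keys (scale c p) \<subseteq> Poly_Mapping.keys p"
  by (auto simp: in_keys_iff)

lemma lin_ext_scale: "lin_ext f (scale c (p :: 'm::monoid_add \<Rightarrow>\<^sub>0 'k::field)) = scale c (lin_ext f p)"
  by (simp add: scale_def lin_ext_const_mult)

lemma scale_single: "scale c (Poly_Mapping.single m d) = Poly_Mapping.single m (c * d)"
  by (simp add: scale_def const_times_single)

lemma word_degree_eq_iff: "word_degree u = word_degree v \<longleftrightarrow> mset u = mset v"
  by (auto simp: word_degree_def multiset_eq_iff fun_eq_iff count_mset)

lemma word_degree_append: "word_degree (u @ v) = (\<lambda>k. word_degree u k + word_degree v k)"
  by (simp add: word_degree_def)

lemma q_pairing_add: "q_pairing q \<mu> (\<lambda>k. \<nu> k + \<nu>' k) = q_pairing q \<mu> \<nu> * q_pairing q \<mu> \<nu>'"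
  by (simp add: q_pairing_def distrib_left power_add prod.distrib)

text \<open>Deletes each occurrence of i, weighted by the pairing of \<alpha>_i with the letters to
  its right. The weight is the scalar picked up when the \<omega>_i that e_i leaves behind in the
  coproduct moves to the end of the word.\<close>

primrec deriv_word :: "('i::finite \<Rightarrow> 'i \<Rightarrow> 'k::field) \<Rightarrow> 'i \<Rightarrow> 'i list \<Rightarrow> ('i, 'k) free_alg" where
  "deriv_word q i [] = 0"
| "deriv_word q i (j # w) = letter j * deriv_word q i w +
     (if j = i then scale (q_pairing q (simple_root i) (word_degree w)) (word w) else 0)"

definition deriv :: "('i::finite \<Rightarrow> 'i \<Rightarrow> 'k::field) \<Rightarrow> 'i \<Rightarrow> ('i, 'k) free_alg \<Rightarrow> ('i, 'k) free_alg" where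
  "deriv q i = lin_ext (\<lambda>m. deriv_word q i (letters m))"

lemma deriv_0 [simp]: "deriv q i 0 = 0"
  by (simp add: deriv_def)

lemma deriv_single: "deriv q i (Poly_Mapping.single m c) = scale c (deriv_word q i (letters m))"
  by (simp add: deriv_def lin_ext_single scale_def)

lemma deriv_add: "deriv q i (p + r) = deriv q i p + deriv q i r"
  by (simp add: deriv_def lin_ext_add)

lemma deriv_sum: "deriv q i (\<Sum>x\<in>S. f x) = (\<Sum>x\<in>S. deriv q i (f x))"
  by (simp add: deriv_def lin_ext_sum)

lemma deriv_scale: "deriv q i (scale c p) = scale c (deriv q i p)"
  by (simp add: deriv_def lin_ext_scale)

lemma deriv_word_append:
  "deriv_word q i (u @ v) = word u * deriv_word q i v +
     scale (q_pairing q (simple_root i) (word_degree v)) (deriv_word q i u * word v)"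
proof (induction u)
  case (Cons j u)
  show ?case
    by (simp add: Cons.IH word_degree_append q_pairing_add word_append word_Cons distrib_left
        distrib_right scale.sc_add_right mult.assoc mult.commute[of "q_pairing q (simple_root i) (word_degree v)"]
        add.assoc)
qed simp

text \<open>Only the right factor has to be homogeneous, since its degree alone determines the
  scalar.\<close>

lemma deriv_mult:
  assumes "\<And>m. m \<in> Poly_Mapping.keys r \<Longrightarrow> word_degree (letters m) = \<gamma>"
  shows "deriv q i (p * r) = p * deriv q i r + scale (q_pairing q (simple_root i) \<gamma>) (deriv q i p * r)"
proof (rule additive_eqI[of p UNIV])
  fix m :: "'a fmon" and c :: 'b
  let ?p = "Poly_Mapping.single m c"
  show "deriv q i (?p * r) = ?p * deriv q i r + scale (q_pairing q (simple_root i) \<gamma>) (deriv q i ?p * r)"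
  proof (rule additive_eqI[of r "{n. word_degree (letters n) = \<gamma>}"])
    fix n :: "'a fmon" and d assume n: "n \<in> {n. word_degree (letters n) = \<gamma>}"
    have single: "Poly_Mapping.single k e = scale e (word (letters k))" for k :: "'a fmon" and e :: 'b
      by (simp add: scale_single)
    show "deriv q i (?p * Poly_Mapping.single n d) = ?p * deriv q i (Poly_Mapping.single n d)
        + scale (q_pairing q (simple_root i) \<gamma>) (deriv q i ?p * Poly_Mapping.single n d)"
      using n
      by (simp add: mult_single deriv_single deriv_word_append scale.sc_add_right)
        (simp add: single[of m c] single[of n d] mult_ac)
  qed (use assms in \<open>auto simp: deriv_add distrib_left distrib_right scale.sc_add_right\<close>)
qed (auto simp: deriv_add distrib_left distrib_right scale.sc_add_right)

text \<open>Stated additively with multisets, so that lengths and degrees of derivatives follow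
  without truncated subtraction.\<close>

lemma mset_deriv_word:
  "m \<in> Poly_Mapping.keys (deriv_word q i w) \<Longrightarrow> add_mset i (mset (letters m)) = mset w"
proof (induction w arbitrary: m)
  case (Cons j w)
  from Cons.prems consider "m \<in> Poly_Mapping.keys (letter j * deriv_word q i w)"
    | "j = i" "m \<in> Poly_Mapping.keys (scale (q_pairing q (simple_root i) (word_degree w)) (word w))"
    using Poly_Mapping.keys_add by (fastforce split: if_splits)
  then show ?case
  proof cases
    case 1
    then obtain n where "n \<in> Poly_Mapping.keys (deriv_word q i w)" "m = Word [j] + n"
      using keys_mult[of "letter j" "deriv_word q i w"] by (auto simp: letter_def)
    then show ?thesis using Cons.IH by (auto simp: add_mset_commute)
  next
    case 2
    then show ?thesis by (auto simp: scale_single split: if_splits)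
  qed
qed simp

lemma mset_deriv:
  assumes "m \<in> Poly_Mapping.keys (deriv q i p)"
  obtains n where "n \<in> Poly_Mapping.keys p" "add_mset i (mset (letters m)) = mset (letters n)"
proof -
  obtain n where "n \<in> Poly_Mapping.keys p" "m \<in> Poly_Mapping.keys (deriv_word q i (letters n))"
    using assms keys_lin_ext[of "\<lambda>m. deriv_word q i (letters m)" p] by (auto simp: deriv_def)
  then show ?thesis using that mset_deriv_word by blast
qed

definition deriv_const :: "('i \<Rightarrow> 'i \<Rightarrow> 'k::field) \<Rightarrow> 'i \<Rightarrow> 'k" where
  "deriv_const q i = q i i / (1 - q i i)"

definition deriv_seq :: "('i::finite \<Rightarrow> 'i \<Rightarrow> 'k::field) \<Rightarrow> 'i list \<Rightarrow> ('i, 'k) free_alg \<Rightarrow> ('i, 'k) free_alg" where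
  "deriv_seq q = foldr (\<lambda>i p. scale (deriv_const q i) (deriv q i p))"

lemma deriv_seq_add: "deriv_seq q w (p + r) = deriv_seq q w p + deriv_seq q w r"
  by (induction w) (simp_all add: deriv_seq_def deriv_add scale.sc_add_right)

lemma deriv_seq_0 [simp]: "deriv_seq q w 0 = 0"
  by (induction w) (simp_all add: deriv_seq_def)

lemma deriv_seq_scale: "deriv_seq q w (scale c p) = scale c (deriv_seq q w p)"
  by (induction w) (simp_all add: deriv_seq_def deriv_scale mult.commute)

lemma mset_deriv_seq:
  assumes "m \<in> Poly_Mapping.keys (deriv_seq q w p)"
  obtains n where "n \<in> Poly_Mapping.keys p" "mset w + mset (letters m) = mset (letters n)"
  using assms
proof (induction w arbitrary: m thesis)
  case Nil then show ?case by (auto simp: deriv_seq_def)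
next
  case (Cons i w)
  have "m \<in> Poly_Mapping.keys (deriv q i (deriv_seq q w p))"
    using Cons.prems(2) keys_scale by (fastforce simp: deriv_seq_def)
  then obtain n where n: "n \<in> Poly_Mapping.keys (deriv_seq q w p)" "add_mset i (mset (letters m)) = mset (letters n)"
    by (rule mset_deriv)
  obtain k where "k \<in> Poly_Mapping.keys p" "mset w + mset (letters n) = mset (letters k)"
    using Cons.IH[OF _ n(1)] by blast
  then show ?case using n(2) Cons.prems(1) by (metis add_mset_add_single mset.simps(2) union_mset_add_mset_left union_mset_add_mset_right)
qed


section \<open>The shuffle homomorphism on the free algebra\<close>

text \<open>Indexing by length instead of degree lets the last letter be split off over all i at
  once. On an element of length n, n derivations leave a scalar, which is the coefficient read off
  at 0.\<close>

definition Gamma_len :: "('i::finite \<Rightarrow> 'i \<Rightarrow> 'k::field) \<Rightarrow> nat \<Rightarrow> ('i, 'k) free_alg \<Rightarrow> ('i, 'k) free_alg" where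
  "Gamma_len q n p = (\<Sum>w | length w = n. Poly_Mapping.single (Word w) (Poly_Mapping.lookup (deriv_seq q w p) 0))"

lemma finite_words: "finite {w :: 'i::finite list. length w = n}"
  using finite_lists_length_eq[of "UNIV :: 'i set" n] by simp

lemma Gamma_len_add: "Gamma_len q n (p + r) = Gamma_len q n p + Gamma_len q n r"
  by (simp add: Gamma_len_def deriv_seq_add lookup_add single_add sum.distrib)

lemma Gamma_len_scale: "Gamma_len q n (scale c p) = scale c (Gamma_len q n p)"
  by (simp add: Gamma_len_def deriv_seq_scale scale.sc_sum scale_single)

lemma Gamma_len_zero [simp]: "Gamma_len q 0 p = const (Poly_Mapping.lookup p 0)"
  by (simp add: Gamma_len_def deriv_seq_def const_def flip: zero_fmon_def)

lemma Gamma_len_Suc: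
  "Gamma_len q (Suc n) p = (\<Sum>i\<in>UNIV. Gamma_len q n (scale (deriv_const q i) (deriv q i p)) * letter i)"
proof -
  let ?W = "{w :: 'a list. length w = n}"
  let ?f = "\<lambda>w. Poly_Mapping.single (Word w) (Poly_Mapping.lookup (deriv_seq q w p) 0)"
  have "bij_betw (\<lambda>(i, w). w @ [i]) (UNIV \<times> ?W) {w :: 'a list. length w = Suc n}"
  proof (rule bij_betw_imageI)
    show "(\<lambda>(i, w). w @ [i]) ` (UNIV \<times> ?W) = {w :: 'a list. length w = Suc n}"
    proof (intro equalityI subsetI)
      fix w :: "'a list" assume "w \<in> {w. length w = Suc n}"
      then have "w = butlast w @ [last w]" "length (butlast w) = n" by (auto simp: length_Suc_conv)
      then show "w \<in> (\<lambda>(i, w). w @ [i]) ` (UNIV \<times> ?W)"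
        by (intro image_eqI[of _ _ "(last w, butlast w)"]) auto
    qed auto
  qed (auto simp: inj_on_def)
  then have "Gamma_len q (Suc n) p = (\<Sum>(i, w)\<in>UNIV \<times> ?W. ?f (w @ [i]))"
    unfolding Gamma_len_def by (subst sum.reindex_bij_betw[symmetric]) (auto simp: case_prod_unfold)
  also have "\<dots> = (\<Sum>i\<in>UNIV. \<Sum>w\<in>?W. ?f (w @ [i]))"
    by (simp add: sum.cartesian_product)
  also have "\<dots> = (\<Sum>i\<in>UNIV. Gamma_len q n (scale (deriv_const q i) (deriv q i p)) * letter i)"
    unfolding Gamma_len_def sum_distrib_right
    by (intro sum.cong refl) (simp add: letter_def mult_single Word_plus deriv_seq_def)
  finally show ?thesis .
qed

lemma Gamma_len_keys:
  assumes "\<And>m. m \<in> Poly_Mapping.keys p \<Longrightarrow> word_degree (letters m) = \<gamma>"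
    and "w \<in> Poly_Mapping.keys (Gamma_len q n p)"
  shows "word_degree (letters w) = \<gamma>"
proof -
  obtain v where "w \<in> Poly_Mapping.keys (Poly_Mapping.single (Word v) (Poly_Mapping.lookup (deriv_seq q v p) 0))"
    using assms(2) unfolding Gamma_len_def in_keys_iff lookup_sum
    by (meson sum.not_neutral_contains_not_neutral)
  then have v: "w = Word v" "0 \<in> Poly_Mapping.keys (deriv_seq q v p)"
    by (auto simp: in_keys_iff split: if_splits)
  then obtain m where "m \<in> Poly_Mapping.keys p" "mset v = mset (letters m)"
    using mset_deriv_seq[OF v(2)] by auto
  then show ?thesis using assms(1) v(1) word_degree_eq_iff by (metis fmon.sel)
qed

lemma quantum_shuffle_scale_left:
  fixes p r :: "('a::finite, 'k::field) free_alg"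
  shows "quantum_shuffle q (scale c p) r = scale c (quantum_shuffle q p r)"
proof (rule additive_eqI[of p UNIV])
  fix m :: "'a fmon" and d :: 'k
  show "quantum_shuffle q (scale c (Poly_Mapping.single m d)) r = scale c (quantum_shuffle q (Poly_Mapping.single m d) r)"
  proof (rule additive_eqI[of r UNIV])
    fix n :: "'a fmon" and e :: 'k
    show "quantum_shuffle q (scale c (Poly_Mapping.single m d)) (Poly_Mapping.single n e) =
        scale c (quantum_shuffle q (Poly_Mapping.single m d) (Poly_Mapping.single n e))"
      by (simp add: scale_single quantum_shuffle_single) (simp add: scale_def const_mult mult.assoc)
  qed (auto simp: quantum_shuffle_add_right scale.sc_add_right)
qed (auto simp: quantum_shuffle_add_left scale.sc_add_right)

lemma quantum_shuffle_scale_right: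
  fixes p r :: "('a::finite, 'k::field) free_alg"
  shows "quantum_shuffle q p (scale c r) = scale c (quantum_shuffle q p r)"
proof (rule additive_eqI[of p UNIV])
  fix m :: "'a fmon" and d :: 'k
  show "quantum_shuffle q (Poly_Mapping.single m d) (scale c r) = scale c (quantum_shuffle q (Poly_Mapping.single m d) r)"
  proof (rule additive_eqI[of r UNIV])
    fix n :: "'a fmon" and e :: 'k
    show "quantum_shuffle q (Poly_Mapping.single m d) (scale c (Poly_Mapping.single n e)) =
        scale c (quantum_shuffle q (Poly_Mapping.single m d) (Poly_Mapping.single n e))"
      by (simp add: scale_single quantum_shuffle_single mult.left_commute[of d])
        (simp add: scale_def const_mult mult.assoc)
  qed (auto simp: quantum_shuffle_add_right scale.sc_add_right)
qed (auto simp: quantum_shuffle_add_left scale.sc_add_right)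

lemma quantum_shuffle_sum_left: "quantum_shuffle q (\<Sum>x\<in>S. f x) r = (\<Sum>x\<in>S. quantum_shuffle q (f x) r)"
  by (induction S rule: infinite_finite_induct) (simp_all add: quantum_shuffle_add_left)

lemma quantum_shuffle_sum_right: "quantum_shuffle q p (\<Sum>x\<in>S. f x) = (\<Sum>x\<in>S. quantum_shuffle q p (f x))"
  by (induction S rule: infinite_finite_induct) (simp_all add: quantum_shuffle_add_right)

lemma length_zero_const:
  fixes p :: "('a, 'k::field) free_alg"
  assumes "\<And>m. m \<in> Poly_Mapping.keys p \<Longrightarrow> length (letters m) = 0"
  shows "p = scale (Poly_Mapping.lookup p 0) 1"
proof (rule poly_mapping_eqI)
  fix m :: "'a fmon"
  have "letters m \<noteq> []" if "m \<noteq> 0" using that by (cases m) (auto simp: zero_fmon_def)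
  then show "Poly_Mapping.lookup p m = Poly_Mapping.lookup (scale (Poly_Mapping.lookup p 0) 1) m"
    using assms[of m] by (auto simp: in_keys_iff lookup_one when_def)
qed

text \<open>Induction on the total length; a factor of length 0 is a scalar. Otherwise p D_i(r) and
  D_i(p) r are shorter, and expanding the remaining factor of each by its last letter produces the
  two terms of the shuffle recursion for every pair (i, j). Only r has a fixed degree, because the
  scalar of the recursion involves the degree of the right factor alone.\<close>

lemma Gamma_len_mult:
  assumes "\<And>u. u \<in> Poly_Mapping.keys p \<Longrightarrow> length (letters u) = m"
    and "\<And>v. v \<in> Poly_Mapping.keys r \<Longrightarrow> length (letters v) = n"
    and "\<And>v. v \<in> Poly_Mapping.keys r \<Longrightarrow> word_degree (letters v) = \<gamma>"
  shows "Gamma_len q (m + n) (p * r) = quantum_shuffle q (Gamma_len q m p) (Gamma_len q n r)"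
  using assms
proof (induction "m + n" arbitrary: m n p r \<gamma> rule: less_induct)
  case less
  show ?case
  proof (cases m)
    case 0
    define c where "c = Poly_Mapping.lookup p 0"
    have "p = scale c 1" unfolding c_def using length_zero_const[of p] less.prems(1) 0 by auto
    then show ?thesis
      using 0 by (simp add: Gamma_len_scale quantum_shuffle_unit quantum_shuffle_scale_left
          flip: scale_1_left)
  next
    case m: (Suc m')
    show ?thesis
    proof (cases n)
      case 0
      define c where "c = Poly_Mapping.lookup r 0"
      have "r = scale c 1" unfolding c_def using length_zero_const[of r] less.prems(2) 0 by auto
      then show ?thesis
        using 0 by (simp add: Gamma_len_scale quantum_shuffle_unit quantum_shuffle_scale_right
            flip: scale_1_left)
    next
      case n: (Suc n')
      define dp dr where "dp i = scale (deriv_const q i) (deriv q i p)"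
        and "dr i = scale (deriv_const q i) (deriv q i r)" for i
      define P R where "P i = Gamma_len q m' (dp i)" and "R i = Gamma_len q n' (dr i)" for i
      let ?Q = "\<lambda>i. q_pairing q (simple_root i) \<gamma>"
      have len_dp: "length (letters u) = m'" if "u \<in> Poly_Mapping.keys (dp i)" for u i
      proof -
        have "u \<in> Poly_Mapping.keys (deriv q i p)" using that keys_scale by (fastforce simp: dp_def)
        then obtain k where "k \<in> Poly_Mapping.keys p" "add_mset i (mset (letters u)) = mset (letters k)"
          by (rule mset_deriv)
        then have "Suc (length (letters u)) = m" using less.prems(1) by (metis size_add_mset size_mset)
        then show ?thesis using m by simp
      qed
      have dr_mset: "\<exists>k\<in>Poly_Mapping.keys r. add_mset i (mset (letters u)) = mset (letters k)"
        if "u \<in> Poly_Mapping.keys (dr i)" for u i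
      proof -
        have "u \<in> Poly_Mapping.keys (deriv q i r)" using that keys_scale by (fastforce simp: dr_def)
        then show ?thesis by (rule mset_deriv) blast
      qed
      have len_dr: "length (letters u) = n'" if u: "u \<in> Poly_Mapping.keys (dr i)" for u i
      proof -
        obtain k where "k \<in> Poly_Mapping.keys r" "add_mset i (mset (letters u)) = mset (letters k)"
          using dr_mset[OF u] by blast
        then have "Suc (length (letters u)) = n" using less.prems(2) by (metis size_add_mset size_mset)
        then show ?thesis using n by simp
      qed
      have deg_dr': "(\<lambda>k. word_degree (letters u) k + simple_root i k) = \<gamma>" if u: "u \<in> Poly_Mapping.keys (dr i)" for u i
      proof -
        obtain k where k: "k \<in> Poly_Mapping.keys r" "mset (i # letters u) = mset (letters k)"
          using dr_mset[OF u] by auto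
        then have "word_degree (i # letters u) = \<gamma>"
          using less.prems(3)[OF k(1)] word_degree_eq_iff by metis
        then show ?thesis by (simp add: word_degree_Cons)
      qed
      have deg_dr: "word_degree (letters u) = (\<lambda>k. \<gamma> k - simple_root i k)" if "u \<in> Poly_Mapping.keys (dr i)" for u i
        unfolding deg_dr'[OF that, symmetric] by simp
      have IH1: "Gamma_len q (m + n') (p * dr i) = quantum_shuffle q (Gamma_len q m p) (R i)" for i
        unfolding R_def by (rule less.hyps) (use n less.prems len_dr deg_dr in auto)
      have IH2: "Gamma_len q (m' + n) (dp i * r) = quantum_shuffle q (P i) (Gamma_len q n r)" for i
        unfolding P_def by (rule less.hyps) (use m less.prems len_dp in auto)
      have d: "scale (deriv_const q i) (deriv q i (p * r)) = p * dr i + scale (?Q i) (dp i * r)" for i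
        by (simp add: deriv_mult[OF less.prems(3)] dp_def dr_def scale.sc_add_right mult.commute)
      have Gp: "Gamma_len q m p = (\<Sum>i\<in>UNIV. P i * letter i)"
        by (simp add: m Gamma_len_Suc P_def dp_def)
      have Gr: "Gamma_len q n r = (\<Sum>i\<in>UNIV. R i * letter i)"
        by (simp add: n Gamma_len_Suc R_def dr_def)
      have "Gamma_len q (m + n) (p * r) = (\<Sum>i\<in>UNIV. Gamma_len q (m + n') (p * dr i) * letter i)
          + (\<Sum>i\<in>UNIV. scale (?Q i) (Gamma_len q (m' + n) (dp i * r) * letter i))"
        by (simp add: n m Gamma_len_Suc d Gamma_len_add Gamma_len_scale distrib_right sum.distrib)
      also have "\<dots> = (\<Sum>i\<in>UNIV. quantum_shuffle q (Gamma_len q m p) (R i) * letter i)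
          + (\<Sum>i\<in>UNIV. scale (?Q i) (quantum_shuffle q (P i) (Gamma_len q n r) * letter i))"
        by (simp only: IH1 IH2)
      also have "(\<Sum>i\<in>UNIV. quantum_shuffle q (Gamma_len q m p) (R i) * letter i) =
          (\<Sum>i\<in>UNIV. \<Sum>j\<in>UNIV. quantum_shuffle q (P i * letter i) (R j) * letter j)"
        unfolding Gp by (subst sum.swap) (simp add: quantum_shuffle_sum_left sum_distrib_right)
      also have "(\<Sum>i\<in>UNIV. scale (?Q i) (quantum_shuffle q (P i) (Gamma_len q n r) * letter i)) =
          (\<Sum>i\<in>UNIV. \<Sum>j\<in>UNIV. scale (?Q i) (quantum_shuffle q (P i) (R j * letter j) * letter i))"
        unfolding Gr by (simp add: quantum_shuffle_sum_right sum_distrib_right scale.sc_sum)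
      also have "(\<Sum>i\<in>UNIV. \<Sum>j\<in>UNIV. quantum_shuffle q (P i * letter i) (R j) * letter j) + \<dots> =
          (\<Sum>i\<in>UNIV. \<Sum>j\<in>UNIV. quantum_shuffle q (P i * letter i) (R j * letter j))"
        unfolding sum.distrib[symmetric]
      proof (intro sum.cong refl)
        fix i j
        show "quantum_shuffle q (P i * letter i) (R j) * letter j + scale (?Q i) (quantum_shuffle q (P i) (R j * letter j) * letter i)
            = quantum_shuffle q (P i * letter i) (R j * letter j)"
        \<comment> \<open>If the derivative of r at j is 0, both sides vanish. Otherwise one of its
          words witnesses that \<nu> + \<alpha>_j = \<gamma> for the degree \<nu> of
          \<open>R j\<close>, so the scalar of the recursion does not depend on j.\<close>
        proof (cases "dr j = 0")
          case True
          then have "R j = 0" by (simp add: R_def Gamma_len_def)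
          then show ?thesis by simp
        next
          case False
          then obtain u where u: "u \<in> Poly_Mapping.keys (dr j)" by (metis all_not_in_conv keys_eq_empty)
          have \<gamma>: "(\<lambda>k. word_degree (letters u) k + simple_root j k) = \<gamma>" by (rule deg_dr'[OF u])
          have "word_degree (letters v) = word_degree (letters u)" if "v \<in> Poly_Mapping.keys (R j)" for v
            using that unfolding R_def by (rule Gamma_len_keys[rotated]) (simp add: deg_dr[OF u] deg_dr)
          then show ?thesis
            by (subst quantum_shuffle_rec[where \<nu> = "word_degree (letters u)"]) (auto simp: \<gamma> scale_def mult.assoc)
        qed
      qed
      also have "\<dots> = quantum_shuffle q (Gamma_len q m p) (Gamma_len q n r)"
        unfolding Gp Gr by (subst sum.swap) (simp add: quantum_shuffle_sum_left quantum_shuffle_sum_right)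
      finally show ?thesis .
    qed
  qed
qed

text \<open>Each word is paired only with derivation sequences of its own length; in this form
  \<open>Gamma_len_mult\<close> extends bilinearly to inhomogeneous elements.\<close>

definition Gamma_free :: "('i::finite \<Rightarrow> 'i \<Rightarrow> 'k::field) \<Rightarrow> ('i, 'k) free_alg \<Rightarrow> ('i, 'k) free_alg" where
  "Gamma_free q = lin_ext (\<lambda>m. Gamma_len q (length (letters m)) (Poly_Mapping.single m 1))"

lemma Gamma_free_add: "Gamma_free q (p + r) = Gamma_free q p + Gamma_free q r"
  by (simp add: Gamma_free_def lin_ext_add)

lemma Gamma_free_single:
  "Gamma_free q (Poly_Mapping.single m c) = Gamma_len q (length (letters m)) (Poly_Mapping.single m c)"
  by (simp add: Gamma_free_def lin_ext_single scale_single flip: scale_def Gamma_len_scale)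

lemma Gamma_free_mult:
  fixes p r :: "('a::finite, 'k::field) free_alg"
  shows "Gamma_free q (p * r) = quantum_shuffle q (Gamma_free q p) (Gamma_free q r)"
proof (rule additive_eqI[of p UNIV])
  fix m :: "'a fmon" and c :: 'k
  show "Gamma_free q (Poly_Mapping.single m c * r) =
      quantum_shuffle q (Gamma_free q (Poly_Mapping.single m c)) (Gamma_free q r)"
  proof (rule additive_eqI[of r UNIV])
    fix n :: "'a fmon" and d :: 'k
    show "Gamma_free q (Poly_Mapping.single m c * Poly_Mapping.single n d) =
        quantum_shuffle q (Gamma_free q (Poly_Mapping.single m c)) (Gamma_free q (Poly_Mapping.single n d))"
    proof -
      have "Gamma_len q (length (letters m) + length (letters n)) (Poly_Mapping.single m c * Poly_Mapping.single n d) =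
        quantum_shuffle q (Gamma_len q (length (letters m)) (Poly_Mapping.single m c))
          (Gamma_len q (length (letters n)) (Poly_Mapping.single n d))"
        by (rule Gamma_len_mult[where \<gamma> = "word_degree (letters n)"]) (auto split: if_splits)
      then show ?thesis by (simp add: mult_single Gamma_free_single)
    qed
  qed (auto simp: Gamma_free_add quantum_shuffle_add_right distrib_left)
qed (auto simp: Gamma_free_add quantum_shuffle_add_left distrib_right)

text \<open>All words of degree \<mu> have one length n. Among the words w of length n, the iterated
  derivative has a constant term only if w is a rearrangement of a word of p, so the sum over length
  n collapses to degree \<mu>.\<close>

lemma Gamma_free_homogeneous:
  assumes "\<And>m. m \<in> Poly_Mapping.keys p \<Longrightarrow> word_degree (letters m) = \<mu>"
  shows "(\<Sum>w | word_degree w = \<mu>. Poly_Mapping.single (Word w) (Poly_Mapping.lookup (deriv_seq q w p) 0)) = Gamma_free q p"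
proof (cases "p = 0")
  case True
  then show ?thesis by (simp add: Gamma_free_def)
next
  case False
  then obtain m where m: "m \<in> Poly_Mapping.keys p" by (metis all_not_in_conv keys_eq_empty)
  define n where "n = length (letters m)"
  have len: "length w = n" if "word_degree w = \<mu>" for w
    using that assms[OF m] by (metis n_def word_degree_eq_iff size_mset)
  have "(\<Sum>w | word_degree w = \<mu>. Poly_Mapping.single (Word w) (Poly_Mapping.lookup (deriv_seq q w p) 0)) = Gamma_len q n p"
    unfolding Gamma_len_def
  proof (rule sum.mono_neutral_left[OF finite_words]; (rule ballI)?)
    show "{w. word_degree w = \<mu>} \<subseteq> {w. length w = n}" using len by auto
    fix w assume w: "w \<in> {w. length w = n} - {w. word_degree w = \<mu>}"
    have "0 \<notin> Poly_Mapping.keys (deriv_seq q w p)"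
    proof
      assume "0 \<in> Poly_Mapping.keys (deriv_seq q w p)"
      then obtain k where k: "k \<in> Poly_Mapping.keys p" "mset w = mset (letters k)"
        by (rule mset_deriv_seq) auto
      have "word_degree w = \<mu>" using k(2) assms[OF k(1)] by (simp flip: word_degree_eq_iff)
      then show False using w by simp
    qed
    then show "Poly_Mapping.single (Word w) (Poly_Mapping.lookup (deriv_seq q w p) 0) = 0"
      by (simp add: in_keys_iff)
  qed
  also have "\<dots> = Gamma_free q p"
  proof (rule additive_eqI[of p "{m. word_degree (letters m) = \<mu>}"])
    fix m c assume "m \<in> {m. word_degree (letters m) = \<mu>}"
    then show "Gamma_len q n (Poly_Mapping.single m c) = Gamma_free q (Poly_Mapping.single m c)"
      using len by (simp add: Gamma_free_single)
  qed (use assms in \<open>auto simp: Gamma_len_add Gamma_free_add\<close>)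
  finally show ?thesis .
qed

section \<open>Weights\<close>

text \<open>The grading by the root lattice. The f_i have negative weight, hence integer values;
  \<open>'i \<Rightarrow>\<^sub>0 int\<close> is an abelian group type, as
  \<open>hom_part_genideal\<close> demands.\<close>

fun gen_weight :: "'i gen \<Rightarrow> 'i \<Rightarrow>\<^sub>0 int" where
  "gen_weight (Ge i) = Poly_Mapping.single i 1"
| "gen_weight (Gf i) = Poly_Mapping.single i (-1)"
| "gen_weight _ = 0"

definition weight :: "'i gen fmon \<Rightarrow> 'i \<Rightarrow>\<^sub>0 int" where
  "weight m = sum_list (map gen_weight (letters m))"

lemma weight_plus: "weight (m + n) = weight m + weight n"
  by (simp add: weight_def)

text \<open>Only the right factor counts, because the summands of \<Delta>(x) are indexed by the
  degree \<nu> of their right factor.\<close>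

definition weight2 :: "'i gen fmon \<times> 'i gen fmon \<Rightarrow> 'i \<Rightarrow>\<^sub>0 int" where
  "weight2 m = weight (snd m)"

lemma weight2_plus: "weight2 (m + n) = weight2 m + weight2 n"
  by (simp add: weight2_def weight_plus)

lemma hom_part_tensor: "hom_part weight2 g (p \<^bold>\<otimes> r) = p \<^bold>\<otimes> hom_part weight g r"
proof (rule additive_eqI[of p UNIV])
  fix u c
  show "hom_part weight2 g (Poly_Mapping.single u c \<^bold>\<otimes> r) = Poly_Mapping.single u c \<^bold>\<otimes> hom_part weight g r"
  proof (rule additive_eqI[of r UNIV])
    fix v d
    show "hom_part weight2 g (Poly_Mapping.single u c \<^bold>\<otimes> Poly_Mapping.single v d) =
        Poly_Mapping.single u c \<^bold>\<otimes> hom_part weight g (Poly_Mapping.single v d)"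
      by (simp add: free_tensor_single hom_part_single weight2_def)
  qed (auto simp: free_tensor_add_right hom_part_add)
qed (auto simp: free_tensor_add_left hom_part_add)

lemma hom_part_scale: "hom_part gr g (scale c p) = scale c (hom_part gr g p)"
  by (simp add: hom_part_def lin_ext_scale)

definition homogeneous :: "('m \<Rightarrow> 'g) \<Rightarrow> 'g \<Rightarrow> ('m \<Rightarrow>\<^sub>0 'k::zero) \<Rightarrow> bool" where
  "homogeneous gr g p \<longleftrightarrow> (\<forall>m\<in>Poly_Mapping.keys p. gr m = g)"

lemma homogeneous_0 [simp]: "homogeneous gr g 0"
  by (simp add: homogeneous_def)

lemma homogeneous_diff:
  "homogeneous gr g p \<Longrightarrow> homogeneous gr g r \<Longrightarrow> homogeneous gr g (p - (r :: _ \<Rightarrow>\<^sub>0 _::ab_group_add))"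
  by (auto simp: homogeneous_def in_keys_iff lookup_minus)

lemma homogeneous_scale: "homogeneous gr g p \<Longrightarrow> homogeneous gr g (scale c p)"
  using keys_scale by (fastforce simp: homogeneous_def)

lemma homogeneous_mult:
  assumes "\<And>m n. gr (m + n) = gr m + gr n" "homogeneous gr g p" "homogeneous gr h r"
  shows "homogeneous gr (g + h) (p * r)"
  using keys_mult[of p r] assms by (fastforce simp: homogeneous_def)

lemma hom_part_of_homogeneous:
  "homogeneous gr d p \<Longrightarrow> hom_part gr g p = (if d = g then p else 0)"
  by (rule hom_part_homogeneous) (simp add: homogeneous_def)

lemma homogeneous_hom_part: "homogeneous gr g (hom_part gr g p)"
  by (simp add: homogeneous_def keys_hom_part)

lemma homogeneous_letter: "homogeneous weight (gen_weight x) (letter x)"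
  by (simp add: homogeneous_def letter_def weight_def)

lemma homogeneous_letter_mult:
  "homogeneous weight g p \<Longrightarrow> homogeneous weight (gen_weight x + g) (letter x * p)"
  "homogeneous weight g p \<Longrightarrow> homogeneous weight (gen_weight x + g) (p * letter x)"
  using homogeneous_mult[of weight, OF weight_plus] homogeneous_letter[of x]
  by (blast, metis add.commute)

lemma homogeneous_one: "homogeneous weight 0 (1 :: ('i gen, 'k::field) free_alg)"
  by (auto simp: homogeneous_def in_keys_iff lookup_one when_def weight_def split: if_splits)

context quantum_data
begin

text \<open>The relation between e_i and f_j has weight \<alpha>_i - \<alpha>_j; for i = j this is
  0, the weight of the torus elements that occur then.\<close>

lemma homogeneous_relator:
  assumes "x \<in> relators a q"
  shows "\<exists>g. homogeneous weight g x"
proof -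
  have letter2: "homogeneous weight (gen_weight x + gen_weight y) (letter x * letter y)" for x y
    by (intro homogeneous_mult weight_plus homogeneous_letter)
  have letter2': "homogeneous weight g (letter x * letter y)" if "gen_weight x + gen_weight y = g" for x y g
    using letter2[of x y] that by simp
  have letter3: "homogeneous weight (gen_weight x + gen_weight y + gen_weight z) (letter x * letter y * letter z)" for x y z
    by (intro homogeneous_mult weight_plus homogeneous_letter)
  have letter3': "homogeneous weight g (letter x * letter y * letter z)"
    if "gen_weight x + gen_weight y + gen_weight z = g" for x y z g
    using letter3[of x y z] that by simp
  have letter1: "homogeneous weight g (letter x)" if "gen_weight x = g" for x g
    using homogeneous_letter[of x] that by simp
  have ad: "\<exists>g. homogeneous weight g (scale.braided_ad v s (letter x) (letter y) m)" for v s x y m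
  proof (induction m)
    case 0 then show ?case using homogeneous_letter by auto
  next
    case (Suc m)
    then obtain g where "homogeneous weight g (scale.braided_ad v s (letter x) (letter y) m)" by blast
    then show ?case
      by (auto intro!: exI[of _ "gen_weight x + g"] homogeneous_diff homogeneous_scale homogeneous_letter_mult)
  qed
  have ad': "\<exists>g. homogeneous weight g (unopp (scale_opp.braided_ad v s (Opp (letter x)) (Opp (letter y)) m))" for v s x y m
  proof (induction m)
    case 0 then show ?case using homogeneous_letter by auto
  next
    case (Suc m)
    then obtain g where "homogeneous weight g (unopp (scale_opp.braided_ad v s (Opp (letter x)) (Opp (letter y)) m))" by blast
    then show ?case
      by (auto intro!: exI[of _ "gen_weight x + g"] homogeneous_diff homogeneous_scale homogeneous_letter_mult)
  qed
  from assms show ?thesis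
  proof cases
    case (torus_commute y z)
    then have "gen_weight y = 0" "gen_weight z = 0" by (auto simp: torus_generators_def)
    then show ?thesis unfolding torus_commute by (intro exI[of _ 0] homogeneous_diff letter2') simp_all
  next
    case (om_inverse i)
    show ?thesis unfolding om_inverse by (intro exI[of _ 0] homogeneous_diff letter2' homogeneous_one) simp_all
  next
    case (om'_inverse i)
    show ?thesis unfolding om'_inverse by (intro exI[of _ 0] homogeneous_diff letter2' homogeneous_one) simp_all
  next
    case (om_e i j)
    show ?thesis unfolding om_e scale_def[symmetric]
      by (intro exI[of _ "gen_weight (Ge j)"] homogeneous_diff letter3' homogeneous_scale letter1) simp_all
  next
    case (om'_e i j)
    show ?thesis unfolding om'_e scale_def[symmetric]
      by (intro exI[of _ "gen_weight (Ge j)"] homogeneous_diff letter3' homogeneous_scale letter1) simp_all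
  next
    case (om_f i j)
    show ?thesis unfolding om_f scale_def[symmetric]
      by (intro exI[of _ "gen_weight (Gf j)"] homogeneous_diff letter3' homogeneous_scale letter1) simp_all
  next
    case (om'_f i j)
    show ?thesis unfolding om'_f scale_def[symmetric]
      by (intro exI[of _ "gen_weight (Gf j)"] homogeneous_diff letter3' homogeneous_scale letter1) simp_all
  next
    case (e_f i j)
    have "homogeneous weight (gen_weight (Ge i) + gen_weight (Gf j))
        (if i = j then scale (q i i / (q i i - 1)) (K i - L i) else 0)"
      by (auto intro!: homogeneous_scale homogeneous_diff letter1 simp flip: single_add)
    then show ?thesis unfolding e_f scale_def[symmetric]
      by (intro exI[of _ "gen_weight (Ge i) + gen_weight (Gf j)"] homogeneous_diff letter2')
        (simp_all only: add.commute)
  next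
    case (serre_e i j)
    then show ?thesis using ad by (simp only: serre_e_eq)
  next
    case (serre_f i j)
    then show ?thesis using ad' by (simp only: serre_f_eq)
  qed
qed

lemma hom_part_U_mem: "x \<in> U_ideal a q \<Longrightarrow> hom_part weight g x \<in> U_ideal a q"
  unfolding U_ideal_def
proof (rule hom_part_genideal[OF weight_plus])
  fix s h assume s: "s \<in> relators a q"
  obtain d where "homogeneous weight d s" using homogeneous_relator[OF s] by blast
  then show "hom_part weight h s \<in> genideal full_ring (relators a q)"
    using relator_mem[OF s] U.zero_mem by (simp add: hom_part_of_homogeneous U_ideal_def)
qed

text \<open>A component of x \<otimes> 1 is x \<otimes> 1 or 0; a component of 1 \<otimes> x is 1
  \<otimes> x' with x' a component of x, again a relation since \<open>U_ideal\<close> is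
  graded.\<close>

lemma hom_part_UU_mem: "x \<in> UU_ideal a q \<Longrightarrow> hom_part weight2 g x \<in> UU_ideal a q"
  unfolding UU_ideal_def
proof (rule hom_part_genideal[OF weight2_plus])
  fix s h
  assume "s \<in> (\<lambda>x. x \<^bold>\<otimes> 1) ` U_ideal a q \<union> (\<lambda>x. 1 \<^bold>\<otimes> x) ` U_ideal a q"
  then have "hom_part weight2 h s \<in> UU_ideal a q"
  proof (elim UnE imageE)
    fix x assume "s = x \<^bold>\<otimes> 1" "x \<in> U_ideal a q"
    then show ?thesis by (simp add: hom_part_tensor tensor_mem(1))
  next
    fix x assume "s = 1 \<^bold>\<otimes> x" "x \<in> U_ideal a q"
    then show ?thesis by (simp add: hom_part_tensor tensor_mem(2) hom_part_U_mem)
  qed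
  then show "hom_part weight2 h s \<in> genideal full_ring
      ((\<lambda>x. x \<^bold>\<otimes> 1) ` U_ideal a q \<union> (\<lambda>x. 1 \<^bold>\<otimes> x) ` U_ideal a q)"
    by (simp only: UU_ideal_def)
qed

lemma hom_part_U_cong: "x \<approx> y \<Longrightarrow> hom_part weight g x \<approx> hom_part weight g y"
  using hom_part_U_mem[of "x - y" g] by (simp add: ideal_cong_def hom_part_diff)

lemma hom_part_UU_cong: "x \<approx>\<approx> y \<Longrightarrow> hom_part weight2 g x \<approx>\<approx> hom_part weight2 g y"
  using hom_part_UU_mem[of "x - y" g] by (simp add: ideal_cong_def hom_part_diff)


section \<open>Classes in the quotients\<close>

lemma U_class_eq_iff: "U_class a q p = U_class a q r \<longleftrightarrow> p \<approx> r"
  by (simp add: U_class_def U.coset_eq_iff)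

lemma U_class_mult: "U_class a q p \<otimes>\<^bsub>Uq a q\<^esub> U_class a q r = U_class a q (p * r)"
  by (simp add: U_class_def Uq_def U.coset_mult)

lemma U_class_add: "U_class a q p \<oplus>\<^bsub>Uq a q\<^esub> U_class a q r = U_class a q (p + r)"
  by (simp add: U_class_def Uq_def U.coset_add)

lemma U_class_uminus: "\<ominus>\<^bsub>Uq a q\<^esub> U_class a q p = U_class a q (- p)"
  by (simp add: U_class_def Uq_def U.coset_uminus)

lemma U_class_zero: "\<zero>\<^bsub>Uq a q\<^esub> = U_class a q 0"
  unfolding U_class_def Uq_def by (rule U.coset_zero)

lemma U_class_one: "\<one>\<^bsub>Uq a q\<^esub> = U_class a q 1"
  unfolding U_class_def Uq_def by (rule U.coset_one)

lemma U_class_finsum: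
  "finite S \<Longrightarrow> (\<And>x. x \<in> S \<Longrightarrow> t x = U_class a q (f x)) \<Longrightarrow> finsum (Uq a q) t S = U_class a q (sum f S)"
  unfolding U_class_def Uq_def by (rule U.coset_finsum')

lemma UU_class_eq_iff: "UU_class a q p = UU_class a q r \<longleftrightarrow> p \<approx>\<approx> r"
  by (simp add: UU_class_def UU.coset_eq_iff)

lemma UU_class_add: "UU_class a q p \<oplus>\<^bsub>UUq a q\<^esub> UU_class a q r = UU_class a q (p + r)"
  by (simp add: UU_class_def UUq_def UU.coset_add)

lemma UU_class_uminus: "\<ominus>\<^bsub>UUq a q\<^esub> UU_class a q p = UU_class a q (- p)"
  by (simp add: UU_class_def UUq_def UU.coset_uminus)

lemma UU_class_zero: "\<zero>\<^bsub>UUq a q\<^esub> = UU_class a q 0"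
  unfolding UU_class_def UUq_def by (rule UU.coset_zero)

lemma UU_class_finsum:
  "finite S \<Longrightarrow> (\<And>x. x \<in> S \<Longrightarrow> t x = UU_class a q (f x)) \<Longrightarrow> finsum (UUq a q) t S = UU_class a q (sum f S)"
  unfolding UU_class_def UUq_def by (rule UU.coset_finsum')

lemma mem_U_class: "r \<in> U_class a q p \<longleftrightarrow> r \<approx> p"
  by (simp add: U_class_def U.coset_mem_iff)

text \<open>\<open>the_elem\<close> is meaningful here because, by \<open>tensor_cong\<close>, all
  representatives of the two classes give one and the same class.\<close>

lemma U_tensor_class: "U_tensor a q (U_class a q p) (U_class a q r) = UU_class a q (p \<^bold>\<otimes> r)"
proof -
  let ?f = "\<lambda>(p, r). UU_class a q (p \<^bold>\<otimes> r)"
  have "(p, r) \<in> U_class a q p \<times> U_class a q r" by (simp add: mem_U_class)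
  then have "U_class a q p \<times> U_class a q r \<noteq> {}" by blast
  then have "the_elem (?f ` (U_class a q p \<times> U_class a q r)) = ?f (p, r)"
  proof (rule the_elem_image_unique)
    fix z assume "z \<in> U_class a q p \<times> U_class a q r"
    then obtain p' r' where z: "z = (p', r')" "p' \<approx> p" "r' \<approx> r" by (auto simp: mem_U_class)
    show "?f z = ?f (p, r)"
      unfolding z(1) prod.case by (intro UU_class_eq_iff[THEN iffD2] tensor_cong z)
  qed
  then show ?thesis by (simp add: U_tensor_def)
qed

lemma coproduct_class: "coproduct a q (U_class a q p) = UU_class a q (\<Delta> p)"
proof -
  let ?f = "\<lambda>p. UU_class a q (\<Delta> p)"
  have "p \<in> U_class a q p" by (simp add: mem_U_class)
  then have "U_class a q p \<noteq> {}" by blast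
  then have "the_elem (?f ` U_class a q p) = ?f p"
  proof (rule the_elem_image_unique)
    fix r assume "r \<in> U_class a q p"
    then show "?f r = ?f p"
      by (intro UU_class_eq_iff[THEN iffD2] \<Delta>_cong) (simp only: mem_U_class)
  qed
  then show ?thesis by (simp add: coproduct_def free_coproduct_eq)
qed

text \<open>The counit, which sends e_i and f_i to 0 and the torus generators to 1, kills all
  relators. So distinct scalars stay distinct in U_q, and \<open>scalar_of\<close> recovers
  them.\<close>

lemma U_class_const_eq_iff: "U_class a q (const c) = U_class a q (const d) \<longleftrightarrow> c = d"
proof
  let ?\<epsilon> = "\<lambda>x. case x of Ge _ \<Rightarrow> 0 | Gf _ \<Rightarrow> 0 | _ \<Rightarrow> (1 :: ('i gen, 'k) free_alg)"
  have torus: "?\<epsilon> x = 1" if "x \<in> torus_generators" for x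
    using that by (auto simp: torus_generators_def)
  have "two_sided_ideal {x. free_lift ?\<epsilon> x \<in> {0}}"
    by (intro two_sided_ideal_vimage free_lift_add free_lift_mult) (unfold_locales, auto)
  moreover have "free_lift ?\<epsilon> x = 0" if "x \<in> relators a q" for x
    using that
    by cases (auto simp: free_lift_diff free_lift_mult free_lift_sum torus)
  ultimately have *: "U_ideal a q \<subseteq> {x. free_lift ?\<epsilon> x \<in> {0}}"
    unfolding U_ideal_def by (intro genideal_subset) auto
  assume "U_class a q (const c) = U_class a q (const d)"
  then have "const c - const d \<in> U_ideal a q" by (simp add: U_class_eq_iff ideal_cong_def)
  then have "const c - const d = (0 :: ('i gen, 'k) free_alg)"
    using * by (auto simp: free_lift_diff)
  then have "Poly_Mapping.lookup (const c :: ('i gen, 'k) free_alg) 0 = Poly_Mapping.lookup (const d :: ('i gen, 'k) free_alg) 0"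
    by simp
  then show "c = d" by (simp add: const_def)
qed simp

lemma scalar_of_const: "scalar_of a q (U_class a q (const c)) = c"
  by (simp add: scalar_of_def U_class_const_eq_iff)

end


section \<open>Contraction of the second tensor factor\<close>

lemma scale_vector_space: "vector_space (scale :: 'k::field \<Rightarrow> ('m::monoid_add \<Rightarrow>\<^sub>0 'k) \<Rightarrow> _)"
  by unfold_locales (simp_all add: scale.sc_add_left scale.sc_add_right)

text \<open>A basis of \<open>J\<close> stays independent after adding e, so values 0 on the basis
  and 1 at e extend linearly. The functional serves to strip e_i off y \<omega>_i \<otimes>
  e_i.\<close>

lemma exists_functional:
  fixes J :: "('m::monoid_add \<Rightarrow>\<^sub>0 'k::field) set"
  assumes "two_sided_ideal J" "e \<notin> J"
  obtains \<phi> :: "('m \<Rightarrow>\<^sub>0 'k) \<Rightarrow> 'k" where "\<And>x y. \<phi> (x + y) = \<phi> x + \<phi> y" "\<And>c x. \<phi> (scale c x) = c * \<phi> x"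
    "\<And>x. x \<in> J \<Longrightarrow> \<phi> x = 0" "\<phi> e = 1"
proof -
  interpret two_sided_ideal J by (rule assms)
  interpret V: vector_space "scale :: 'k \<Rightarrow> ('m \<Rightarrow>\<^sub>0 'k) \<Rightarrow> _" by (rule scale_vector_space)
  interpret VP: vector_space_pair "scale :: 'k \<Rightarrow> ('m \<Rightarrow>\<^sub>0 'k) \<Rightarrow> _" "(*) :: 'k \<Rightarrow> 'k \<Rightarrow> 'k"
    by unfold_locales (simp_all add: algebra_simps)
  have sub: "V.subspace J"
    by (auto simp: V.subspace_def zero_mem add_mem scale_def mult_left_mem)
  obtain B where B: "B \<subseteq> J" "V.independent B" "J \<subseteq> V.span B"
    by (rule V.maximal_independent_subset)
  have span: "V.span B = J" using B sub by (metis V.span_minimal subset_antisym)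
  have "V.independent (insert e B)" using B(2) assms(2) span by (intro V.independent_insertI) auto
  then obtain g where g: "Vector_Spaces.linear scale (*) g" "\<forall>x\<in>insert e B. g x = (if x = e then 1 else 0)"
    using VP.linear_independent_extend[where f = "\<lambda>x. if x = e then 1 else 0"] by blast
  interpret g: Vector_Spaces.linear scale "(*)" g by (rule g(1))
  have "g x = 0" if "x \<in> B" for x using that g(2) B(1) assms(2) by auto
  then have "g x = 0" if "x \<in> V.span B" for x
    using that by (rule VP.linear_eq_0_on_span[OF g(1)])
  then show ?thesis
    using that[of g] g.add g.scale g(2) span by auto
qed

text \<open>The map id \<otimes> \<phi>. It uses \<phi> on words only, so linearity of \<phi>
  becomes an assumption of \<open>contract_tensor\<close>.\<close>

definition contract :: "(('a, 'k::field) free_alg \<Rightarrow> 'k) \<Rightarrow> ('a, 'k) free_alg2 \<Rightarrow> ('a, 'k) free_alg" where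
  "contract \<phi> = lin_ext (\<lambda>(u, v). Poly_Mapping.single u (\<phi> (Poly_Mapping.single v 1)))"

lemma contract_add: "contract \<phi> (s + t) = contract \<phi> s + contract \<phi> t"
  by (simp add: contract_def lin_ext_add)

lemma contract_diff: "contract \<phi> (s - t) = contract \<phi> s - contract \<phi> t"
  by (simp add: contract_def lin_ext_diff)

lemma contract_tensor:
  assumes "\<And>x y. \<phi> (x + y) = \<phi> x + \<phi> y" "\<And>c x. \<phi> (scale c x) = c * \<phi> x"
  shows "contract \<phi> (p \<^bold>\<otimes> r) = scale (\<phi> r) p"
proof (rule additive_eqI[of p UNIV])
  fix u c
  show "contract \<phi> (Poly_Mapping.single u c \<^bold>\<otimes> r) = scale (\<phi> r) (Poly_Mapping.single u c)"
  proof (rule additive_eqI[of r UNIV])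
    fix v d
    have "\<phi> (Poly_Mapping.single v d) = d * \<phi> (Poly_Mapping.single v 1)"
      using assms(2)[of d "Poly_Mapping.single v 1"] by (simp add: scale_single)
    then show "contract \<phi> (Poly_Mapping.single u c \<^bold>\<otimes> Poly_Mapping.single v d) =
        scale (\<phi> (Poly_Mapping.single v d)) (Poly_Mapping.single u c)"
      by (simp add: contract_def free_tensor_single lin_ext_single const_times_single scale_single mult_ac)
  qed (auto simp: free_tensor_add_right contract_add assms scale.sc_add_left)
qed (auto simp: free_tensor_add_left contract_add scale.sc_add_right)

lemma (in quantum_data) contract_mem:
  assumes "\<And>x y. \<phi> (x + y) = \<phi> x + \<phi> y" "\<And>c x. \<phi> (scale c x) = c * \<phi> x"
    and "\<And>x. x \<in> U_ideal a q \<Longrightarrow> \<phi> x = 0" and "t \<in> UU_ideal a q"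
  shows "contract \<phi> t \<in> U_ideal a q"
proof -
  \<comment> \<open>Contraction is not multiplicative, so the preimage of the ideal is not obviously
    an ideal. Quantifying over all two-sided multiples makes this set one by construction; multiples
    of a generator by pure tensors are pure, with one factor in \<open>U_ideal\<close>.\<close>
  let ?K = "{t. \<forall>s s'. contract \<phi> (s * t * s') \<in> U_ideal a q}"
  have tensor: "contract \<phi> (s * (x \<^bold>\<otimes> y) * s') \<in> U_ideal a q" if xy: "x \<in> U_ideal a q \<or> y \<in> U_ideal a q" for s s' x y
  proof (induction s rule: pm_induct_UNIV)
    case (single m c)
    show ?case
    proof (induction s' rule: pm_induct_UNIV)
      case (single n d)
      have split: "Poly_Mapping.single k e = Poly_Mapping.single (fst k) e \<^bold>\<otimes> Poly_Mapping.single (snd k) 1"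
        for k :: "'i gen fmon \<times> 'i gen fmon" and e :: 'k
        by (simp add: free_tensor_single)
      show ?case unfolding split[of m] split[of n] free_tensor_mult
        using xy by (auto simp: contract_tensor[OF assms(1,2)] scale_def assms(3)
            U.mult_left_mem U.mult_right_mem U.zero_mem)
    qed (auto simp: contract_add contract_def U.zero_mem U.add_mem distrib_left lin_ext_add)
  qed (auto simp: contract_def U.zero_mem U.add_mem distrib_right lin_ext_add)
  have "two_sided_ideal ?K"
  proof
    show "0 \<in> ?K" by (simp add: contract_def U.zero_mem)
  next
    fix x y assume "x \<in> ?K" "y \<in> ?K"
    then show "x + y \<in> ?K" by (simp add: distrib_left distrib_right contract_add U.add_mem)
  next
    fix x r assume x: "x \<in> ?K"
    have "s * (r * x) * s' = (s * r) * x * s'" "s * (x * r) * s' = s * x * (r * s')" for s s'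
      by (simp_all only: mult.assoc)
    then show "r * x \<in> ?K" "x * r \<in> ?K" using x by (simp_all del: mult.assoc)
  qed
  then have "UU_ideal a q \<subseteq> ?K"
    unfolding UU_ideal_def by (rule genideal_subset) (use tensor in auto)
  then show ?thesis using assms(4) by (metis (mono_tags, lifting) mem_Collect_eq mult_1_left mult_1_right subsetD)
qed

section \<open>The positive part\<close>

definition embed :: "('i, 'k::field) free_alg \<Rightarrow> ('i gen, 'k) free_alg" where
  "embed = free_lift (\<lambda>i. letter (Ge i))"

lemma embed_word: "embed (word w) = word (map Ge w)"
  by (induction w) (simp_all add: embed_def free_lift_mult word_Cons)

lemma embed_single: "embed (Poly_Mapping.single m c) = Poly_Mapping.single (Word (map Ge (letters m))) c"
proof -
  obtain w where m: "m = Word w" by (cases m)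
  have "embed (scale c (word w)) = scale c (word (map Ge w))"
    unfolding embed_word[symmetric] by (simp add: embed_def free_lift_scale)
  then show ?thesis by (simp add: m scale_single)
qed

lemma embed_add: "embed (p + r) = embed p + embed r"
  and embed_uminus: "embed (- p) = - embed p"
  and embed_mult: "embed (p * r) = embed p * embed r"
  and embed_scale: "embed (scale c p) = scale c (embed p)"
  and embed_sum: "embed (\<Sum>x\<in>S. f x) = (\<Sum>x\<in>S. embed (f x))"
  and embed_0 [simp]: "embed 0 = 0"
  and embed_1 [simp]: "embed 1 = 1"
  and embed_const [simp]: "embed (const c) = const c"
  and embed_letter [simp]: "embed (letter i) = letter (Ge i)"
  by (simp_all add: embed_def free_lift_add free_lift_uminus free_lift_mult free_lift_scale free_lift_sum)

definition word_deg :: "'i fmon \<Rightarrow> 'i \<Rightarrow> nat" where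
  "word_deg m = word_degree (letters m)"

definition deg_weight :: "('i::finite \<Rightarrow> nat) \<Rightarrow> 'i \<Rightarrow>\<^sub>0 int" where
  "deg_weight \<beta> = (\<Sum>i\<in>UNIV. Poly_Mapping.single i (int (\<beta> i)))"

lemma deg_weight_eq_iff [simp]: "deg_weight \<beta> = deg_weight \<gamma> \<longleftrightarrow> \<beta> = \<gamma>"
proof
  have lookup: "Poly_Mapping.lookup (deg_weight \<beta>) i = int (\<beta> i)" for \<beta> :: "'a \<Rightarrow> nat" and i
    by (simp add: deg_weight_def lookup_sum lookup_single when_def)
  assume "deg_weight \<beta> = deg_weight \<gamma>"
  then show "\<beta> = \<gamma>" using lookup by (metis ext of_nat_eq_iff)
qed simp

lemma weight_Ge_word: "weight (Word (map Ge w)) = deg_weight (word_degree w)"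
proof (induction w)
  case Nil then show ?case by (simp add: weight_def deg_weight_def word_degree_def)
next
  case (Cons i w)
  have "(\<Sum>k\<in>UNIV. Poly_Mapping.single k (int (simple_root i k))) = (\<Sum>k\<in>UNIV. if k = i then Poly_Mapping.single i (1::int) else 0)"
    by (intro sum.cong refl) (simp add: simple_root_def)
  then have "deg_weight (word_degree (i # w)) = Poly_Mapping.single i 1 + deg_weight (word_degree w)"
    by (simp add: deg_weight_def word_degree_Cons single_add sum.distrib add.commute)
  then show ?case using Cons by (simp add: weight_def)
qed

lemma hom_part_embed: "hom_part weight (deg_weight \<beta>) (embed p) = embed (hom_part word_deg \<beta> p)"
  by (rule additive_eqI[of p UNIV])
    (auto simp: embed_add hom_part_add embed_single hom_part_single weight_Ge_word word_deg_def)

lemma (in quantum_data) Uplus_comp_iff: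
  "x \<in> Uplus_comp a q \<beta> \<longleftrightarrow> (\<exists>p. homogeneous word_deg \<beta> p \<and> x = U_class a q (embed p))"
proof
  assume "x \<in> Uplus_comp a q \<beta>"
  then obtain r where r: "\<forall>u\<in>Poly_Mapping.keys r. \<exists>w. u = Word (map Ge w) \<and> word_degree w = \<beta>" "x = U_class a q r"
    by (auto simp: Uplus_comp_def)
  \<comment> \<open>Strips \<open>Ge\<close> off each letter. The inverse is arbitrary on other
    generators, but these do not occur in \<open>r\<close>.\<close>
  define f :: "'i gen fmon \<Rightarrow> ('i, 'k) free_alg" where "f u = word (map (inv_into UNIV Ge) (letters u))" for u
  have inv: "map (inv_into UNIV Ge) (map Ge w) = w" for w :: "'i list"
    by (simp add: comp_def inv_f_f inj_def)
  have "embed (lin_ext f r) = r"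
  proof (rule additive_eqI[of r "{u. \<exists>w. u = Word (map Ge w) \<and> word_degree w = \<beta>}"])
    fix m :: "'i gen fmon" and c :: 'k assume "m \<in> {u. \<exists>w. u = Word (map Ge w) \<and> word_degree w = \<beta>}"
    then show "embed (lin_ext f (Poly_Mapping.single m c)) = Poly_Mapping.single m c"
      using inv by (auto simp: lin_ext_single f_def const_times_single embed_single simp del: map_map)
  qed (use r in \<open>auto simp: lin_ext_add embed_add\<close>)
  moreover have "homogeneous word_deg \<beta> (lin_ext f r)"
    unfolding homogeneous_def
  proof
    fix m assume "m \<in> Poly_Mapping.keys (lin_ext f r)"
    then obtain u where u: "u \<in> Poly_Mapping.keys r" "m \<in> Poly_Mapping.keys (f u)"
      using keys_lin_ext[of f r] by blast
    then obtain w where "u = Word (map Ge w)" "word_degree w = \<beta>" using r by blast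
    then show "word_deg m = \<beta>" using u(2) inv by (simp add: f_def word_deg_def del: map_map)
  qed
  ultimately show "\<exists>p. homogeneous word_deg \<beta> p \<and> x = U_class a q (embed p)" using r(2) by metis
next
  assume "\<exists>p. homogeneous word_deg \<beta> p \<and> x = U_class a q (embed p)"
  then obtain p where p: "homogeneous word_deg \<beta> p" "x = U_class a q (embed p)" by blast
  have "\<exists>w. u = Word (map Ge w) \<and> word_degree w = \<beta>" if "u \<in> Poly_Mapping.keys (embed p)" for u
  proof -
    have "embed p = (\<Sum>m\<in>Poly_Mapping.keys p. Poly_Mapping.single (Word (map Ge (letters m))) (Poly_Mapping.lookup p m))"
      by (subst (1) single_sum_keys[symmetric]) (simp only: embed_sum embed_single)
    then have "(\<Sum>m\<in>Poly_Mapping.keys p. Poly_Mapping.lookup (Poly_Mapping.single (Word (map Ge (letters m))) (Poly_Mapping.lookup p m)) u) \<noteq> 0"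
      using that by (simp add: in_keys_iff lookup_sum)
    then obtain m where "m \<in> Poly_Mapping.keys p"
        "Poly_Mapping.lookup (Poly_Mapping.single (Word (map Ge (letters m))) (Poly_Mapping.lookup p m)) u \<noteq> 0"
      by (rule sum.not_neutral_contains_not_neutral)
    then show ?thesis using p(1) by (auto simp: lookup_single when_def homogeneous_def word_deg_def split: if_splits)
  qed
  then show "x \<in> Uplus_comp a q \<beta>" using p(2) by (auto simp: Uplus_comp_def)
qed

locale finite_quantum_data = quantum_data a q
  for a :: "'i::finite \<Rightarrow> 'i \<Rightarrow> int" and q :: "'i \<Rightarrow> 'i \<Rightarrow> 'k::field"
begin

lemma nonzero_parts_subset:
  "{\<beta>. embed (hom_part word_deg \<beta> p) \<notin> U_ideal a q} \<subseteq> word_deg ` Poly_Mapping.keys p"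
proof
  fix \<beta> assume "\<beta> \<in> {\<beta>. embed (hom_part word_deg \<beta> p) \<notin> U_ideal a q}"
  then have "hom_part word_deg \<beta> p \<noteq> 0" using U.zero_mem by auto
  then have "Poly_Mapping.keys (hom_part word_deg \<beta> p) \<noteq> {}" by simp
  then show "\<beta> \<in> word_deg ` Poly_Mapping.keys p" by (auto simp: keys_hom_part)
qed

lemma nonzero_classes:
  "{\<beta>. U_class a q (embed (hom_part word_deg \<beta> p)) \<noteq> \<zero>\<^bsub>Uq a q\<^esub>} =
    {\<beta>. embed (hom_part word_deg \<beta> p) \<notin> U_ideal a q}"
  by (simp add: U_class_zero U_class_eq_iff U.cong_zero_iff)

lemma finite_nonzero_parts: "finite {\<beta>. embed (hom_part word_deg \<beta> p) \<notin> U_ideal a q}"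
  by (rule finite_subset[OF nonzero_parts_subset]) simp

text \<open>The definitions sum over degrees with nonzero class, whereas a representative may have
  further degrees whose component lies in the ideal. This passes between the two index sets.\<close>

lemma sum_nonzero_parts:
  fixes f :: "('i \<Rightarrow> nat) \<Rightarrow> ('i gen, 'k) free_alg"
  assumes "finite T" "S \<subseteq> T" "\<And>\<beta>. \<beta> \<in> T - S \<Longrightarrow> f \<beta> \<in> U_ideal a q"
  shows "sum f S \<approx> sum f T"
proof -
  have "sum f T = sum f S + sum f (T - S)" using assms by (simp add: sum.subset_diff add.commute)
  moreover have "sum f (T - S) \<in> U_ideal a q" using assms(3) by (rule U.sum_mem)
  ultimately show ?thesis using U.uminus_mem by (simp add: ideal_cong_def)
qed

text \<open>Uniqueness rests on the ideal being graded: applying \<open>hom_part\<close> to the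
  congruence between p and the sum of any other decomposition isolates one degree at a time.\<close>

lemma homogeneous_parts_class:
  "homogeneous_parts a q (U_class a q (embed p)) = (\<lambda>\<beta>. U_class a q (embed (hom_part word_deg \<beta> p)))"
  (is "_ = ?h")
  unfolding homogeneous_parts_def
proof (rule the_equality)
  let ?T = "word_deg ` Poly_Mapping.keys p"
  let ?S = "{\<beta>. ?h \<beta> \<noteq> \<zero>\<^bsub>Uq a q\<^esub>}"
  have fin: "finite ?S" unfolding nonzero_classes by (rule finite_nonzero_parts)
  have "finsum (Uq a q) ?h ?S = U_class a q (\<Sum>\<beta>\<in>?S. embed (hom_part word_deg \<beta> p))"
    by (rule U_class_finsum[OF fin]) simp
  also have "\<dots> = U_class a q (\<Sum>\<beta>\<in>?T. embed (hom_part word_deg \<beta> p))"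
    unfolding U_class_eq_iff nonzero_classes
    by (rule sum_nonzero_parts) (use nonzero_parts_subset in auto)
  also have "(\<Sum>\<beta>\<in>?T. embed (hom_part word_deg \<beta> p)) = embed p"
    by (simp add: sum_hom_part flip: embed_sum)
  finally have fs: "finsum (Uq a q) ?h ?S = U_class a q (embed p)" .
  show "(\<forall>\<beta>. ?h \<beta> \<in> Uplus_comp a q \<beta>) \<and> finite ?S \<and> U_class a q (embed p) = finsum (Uq a q) ?h ?S"
  proof (intro conjI allI)
    show "?h \<beta> \<in> Uplus_comp a q \<beta>" for \<beta>
      unfolding Uplus_comp_iff
      by (intro exI[of _ "hom_part word_deg \<beta> p"] conjI homogeneous_hom_part refl)
    show "finite ?S" by (rule fin)
    show "U_class a q (embed p) = finsum (Uq a q) ?h ?S" by (rule fs[symmetric])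
  qed
next
  fix h :: "('i \<Rightarrow> nat) \<Rightarrow> ('i gen, 'k) free_alg set"
  let ?S = "{\<beta>. h \<beta> \<noteq> \<zero>\<^bsub>Uq a q\<^esub>}"
  assume h: "(\<forall>\<beta>. h \<beta> \<in> Uplus_comp a q \<beta>) \<and> finite ?S \<and> U_class a q (embed p) = finsum (Uq a q) h ?S"
  then have "\<forall>\<beta>. \<exists>p. homogeneous word_deg \<beta> p \<and> h \<beta> = U_class a q (embed p)"
    by (simp add: Uplus_comp_iff)
  then obtain P where P: "\<And>\<beta>. homogeneous word_deg \<beta> (P \<beta>)" "\<And>\<beta>. h \<beta> = U_class a q (embed (P \<beta>))"
    by metis
  have "U_class a q (embed p) = U_class a q (\<Sum>\<beta>\<in>?S. embed (P \<beta>))"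
    using h U_class_finsum[of ?S h "\<lambda>\<beta>. embed (P \<beta>)"] P(2) by simp
  then have e: "embed p \<approx> embed (\<Sum>\<beta>\<in>?S. P \<beta>)" by (simp add: U_class_eq_iff embed_sum)
  have *: "embed (hom_part word_deg \<gamma> p) \<approx> embed (\<Sum>\<beta>\<in>?S. hom_part word_deg \<gamma> (P \<beta>))" for \<gamma>
    using hom_part_U_cong[OF e, of "deg_weight \<gamma>"] by (simp only: hom_part_embed hom_part_sum)
  have "h \<gamma> = ?h \<gamma>" for \<gamma>
  proof (cases "\<gamma> \<in> ?S")
    case True
    have "(\<Sum>\<beta>\<in>?S. hom_part word_deg \<gamma> (P \<beta>)) = (\<Sum>\<beta>\<in>?S. if \<beta> = \<gamma> then P \<gamma> else 0)"
      by (intro sum.cong refl) (simp add: hom_part_of_homogeneous[OF P(1)])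
    also have "\<dots> = P \<gamma>" using True h by simp
    finally show ?thesis using *[of \<gamma>] by (simp add: P(2) U_class_eq_iff U.cong_sym)
  next
    case False
    have "(\<Sum>\<beta>\<in>?S. hom_part word_deg \<gamma> (P \<beta>)) = 0"
      using False by (intro sum.neutral) (auto simp: hom_part_of_homogeneous[OF P(1)])
    then show ?thesis using *[of \<gamma>] False by (auto simp: U_class_zero U_class_eq_iff intro: U.cong_sym)
  qed
  then show "h = ?h" by blast
qed

lemma degree_support_class:
  "degree_support a q (U_class a q (embed p)) = {\<beta>. embed (hom_part word_deg \<beta> p) \<notin> U_ideal a q}"
  by (simp add: degree_support_def homogeneous_parts_class U_class_zero U_class_eq_iff U.cong_zero_iff)


section \<open>The coproduct on the positive part\<close>

text \<open>
  Modulo the relations, the coproduct of \<open>e\<^sub>w\<close> is the sum of \<open>c e\<^sub>u \<omega>\<^sub>v \<otimes> e\<^sub>v\<close> over all entries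
  \<open>(c, u, v)\<close> of \<open>splits w\<close>.
\<close>

primrec splits :: "'i list \<Rightarrow> ('k \<times> 'i list \<times> 'i list) list" where
  "splits [] = [(1, [], [])]"
| "splits (i # w) = map (\<lambda>(c, u, v). (c, i # u, v)) (splits w) @
     map (\<lambda>(c, u, v). (c * q_pairing q (simple_root i) (word_degree u), u, i # v)) (splits w)"

definition split_term :: "'k \<times> 'i list \<times> 'i list \<Rightarrow> ('i gen, 'k) free_alg2" where
  "split_term = (\<lambda>(c, u, v). scale c (embed (word u) * word (map Gom v) \<^bold>\<otimes> embed (word v)))"

definition split_sum :: "'i list \<Rightarrow> ('i gen, 'k) free_alg2" where
  "split_sum w = sum_list (map split_term (splits w))"

lemma mset_splits: "(c, u, v) \<in> set (splits w) \<Longrightarrow> mset u + mset v = mset w"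
  by (induction w arbitrary: c u v) auto

lemma q_pairing_simple_root: "q_pairing q (simple_root i) (simple_root j) = q i j"
proof -
  have "q_pairing q (simple_root i) (simple_root j) =
      (\<Prod>k\<in>UNIV. \<Prod>l\<in>UNIV. if k = i \<and> l = j then q i j else 1)"
    unfolding q_pairing_def by (intro prod.cong refl) (simp add: simple_root_def)
  also have "\<dots> = (\<Prod>k\<in>UNIV. if k = i then q i j else 1)"
    by (intro prod.cong refl) simp
  finally show ?thesis by simp
qed

lemma K_embed_word:
  "K i * embed (word u) \<approx> scale (q_pairing q (simple_root i) (word_degree u)) (embed (word u) * K i)"
proof (induction u)
  case Nil
  then show ?case by (simp add: q_pairing_def word_degree_def)
next
  case (Cons j u)
  have Q: "q_pairing q (simple_root i) (word_degree (j # u)) = q_pairing q (simple_root i) (word_degree u) * q i j"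
    by (simp add: word_degree_Cons q_pairing_add q_pairing_simple_root)
  have c1: "K i * E j * embed (word u) \<approx> scale (q i j) (E j * K i) * embed (word u)"
    by (intro U.cong_right K_E)
  have e2: "scale (q i j) (E j * K i) * embed (word u) = scale (q i j) (E j * (K i * embed (word u)))"
    by (simp add: mult.assoc)
  have c3: "scale (q i j) (E j * (K i * embed (word u))) \<approx>
      scale (q i j) (E j * scale (q_pairing q (simple_root i) (word_degree u)) (embed (word u) * K i))"
    by (intro U.cong_sc U.cong_left Cons.IH)
  have "K i * E j * embed (word u) \<approx>
      scale (q i j) (E j * scale (q_pairing q (simple_root i) (word_degree u)) (embed (word u) * K i))"
    using c1 c3 unfolding e2 by (rule U.cong_trans)
  then show ?case by (simp add: word_Cons embed_mult mult.assoc Q mult.commute[of "q i j"])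
qed

lemma sum_list_cong_UU:
  "(\<And>x. x \<in> set xs \<Longrightarrow> f x \<approx>\<approx> g x) \<Longrightarrow> sum_list (map f xs) \<approx>\<approx> sum_list (map g xs)"
  by (induction xs) (auto intro: UU.cong_add)

lemma split_term_left: "(E i \<^bold>\<otimes> 1) * split_term (c, u, v) = split_term (c, i # u, v)"
  by (simp add: split_term_def free_tensor_mult word_Cons embed_mult mult.assoc)

text \<open>The origin of the coefficients in \<open>splits\<close>: \<omega>_i has to pass e_u to
  reach the torus part, which costs the pairing of \<alpha>_i with the degree of u.\<close>

lemma split_term_right:
  "(K i \<^bold>\<otimes> E i) * split_term (c, u, v) \<approx>\<approx>
    split_term (c * q_pairing q (simple_root i) (word_degree u), u, i # v)"
proof -
  let ?Q = "q_pairing q (simple_root i) (word_degree u)"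
  have "(K i \<^bold>\<otimes> E i) * split_term (c, u, v) =
      scale c ((K i * embed (word u)) * word (map Gom v) \<^bold>\<otimes> E i * embed (word v))"
    by (simp add: split_term_def free_tensor_mult mult.assoc)
  moreover have "\<dots> \<approx>\<approx> scale c (scale ?Q (embed (word u) * K i) * word (map Gom v) \<^bold>\<otimes> E i * embed (word v))"
    by (intro UU.cong_sc tensor_cong_left U.cong_right K_embed_word)
  moreover have "scale c (scale ?Q (embed (word u) * K i) * word (map Gom v) \<^bold>\<otimes> E i * embed (word v)) =
      split_term (c * ?Q, u, i # v)"
    by (simp add: split_term_def word_Cons embed_mult mult.assoc)
  ultimately show ?thesis by simp
qed

lemma \<Delta>_embed_word: "\<Delta> (embed (word w)) \<approx>\<approx> split_sum w"
proof (induction w)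
  case Nil
  then show ?case by (simp add: split_sum_def split_term_def)
next
  case (Cons i w)
  have e1: "\<Delta> (embed (word (i # w))) = ((E i \<^bold>\<otimes> 1) + (K i \<^bold>\<otimes> E i)) * \<Delta> (embed (word w))"
    by (simp add: word_Cons embed_mult free_lift_mult)
  have c2: "((E i \<^bold>\<otimes> 1) + (K i \<^bold>\<otimes> E i)) * \<Delta> (embed (word w)) \<approx>\<approx> ((E i \<^bold>\<otimes> 1) + (K i \<^bold>\<otimes> E i)) * split_sum w"
    by (rule UU.cong_left[OF Cons.IH])
  have e3: "((E i \<^bold>\<otimes> 1) + (K i \<^bold>\<otimes> E i)) * split_sum w =
      sum_list (map (\<lambda>x. (E i \<^bold>\<otimes> 1) * split_term x) (splits w)) +
      sum_list (map (\<lambda>x. (K i \<^bold>\<otimes> E i) * split_term x) (splits w))"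
    by (simp add: split_sum_def distrib_right sum_list_const_mult)
  have c4: "sum_list (map (\<lambda>x. (E i \<^bold>\<otimes> 1) * split_term x) (splits w)) +
      sum_list (map (\<lambda>x. (K i \<^bold>\<otimes> E i) * split_term x) (splits w)) \<approx>\<approx>
      sum_list (map (\<lambda>x. split_term (case x of (c, u, v) \<Rightarrow> (c, i # u, v))) (splits w)) +
      sum_list (map (\<lambda>x. split_term (case x of (c, u, v) \<Rightarrow>
        (c * q_pairing q (simple_root i) (word_degree u), u, i # v))) (splits w))"
    by (intro UU.cong_add sum_list_cong_UU) (auto simp: split_term_left intro: split_term_right)
  have e5: "sum_list (map (\<lambda>x. split_term (case x of (c, u, v) \<Rightarrow> (c, i # u, v))) (splits w)) +
      sum_list (map (\<lambda>x. split_term (case x of (c, u, v) \<Rightarrow>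
        (c * q_pairing q (simple_root i) (word_degree u), u, i # v))) (splits w)) = split_sum (i # w)"
    by (simp add: split_sum_def comp_def)
  show ?case unfolding e1 using c2 c4 unfolding e3 e5 by (rule UU.cong_trans)
qed

text \<open>Only the split that keeps every letter on the left has an empty right part, and it picks
  up no scalar.\<close>

lemma filter_splits_Nil: "filter (\<lambda>(c, u, v). v = []) (splits w) = [(1, w, [])]"
  by (induction w) (simp_all add: filter_map comp_def case_prod_unfold)

lemma word_degree_eq_simple_root: "word_degree v = simple_root i \<longleftrightarrow> v = [i]"
proof -
  have "simple_root i = word_degree [i]" by (auto simp: word_degree_def simple_root_def)
  then show ?thesis by (simp add: word_degree_eq_iff)
qed

text \<open>Exactly one letter, an i, goes to the right. For the word jw, either j stays left and
  the claim for w applies, or j = i goes right and all of w stays left, with the pairing of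
  \<alpha>_i and the degree of w as coefficient. This is the recursion of
  \<open>deriv_word\<close>.\<close>

lemma split_sum_simple_root:
  "sum_list (map split_term (filter (\<lambda>(c, u, v). v = [i]) (splits w))) =
    embed (deriv_word q i w) * K i \<^bold>\<otimes> E i"
proof (induction w)
  case (Cons j w)
  let ?f = "\<lambda>(c, u, v). (c, j # u, v)"
  let ?g = "\<lambda>(c, u, v). (c * q_pairing q (simple_root j) (word_degree u), u, j # v)"
  have "filter (\<lambda>(c, u, v). v = [i]) (splits (j # w)) =
      map ?f (filter (\<lambda>(c, u, v). v = [i]) (splits w)) @
      (if j = i then map ?g (filter (\<lambda>(c, u, v). v = []) (splits w)) else [])"
    by (simp add: filter_map comp_def case_prod_unfold)
  then have "sum_list (map split_term (filter (\<lambda>(c, u, v). v = [i]) (splits (j # w)))) =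
      sum_list (map (\<lambda>x. split_term (?f x)) (filter (\<lambda>(c, u, v). v = [i]) (splits w))) +
      (if j = i then split_term (q_pairing q (simple_root j) (word_degree w), w, [j]) else 0)"
    by (simp add: filter_splits_Nil comp_def)
  also have "(\<lambda>x. split_term (?f x)) = (\<lambda>x. (E j \<^bold>\<otimes> 1) * split_term x)"
    by (auto simp: split_term_left)
  also have "sum_list (map (\<lambda>x. (E j \<^bold>\<otimes> 1) * split_term x) (filter (\<lambda>(c, u, v). v = [i]) (splits w))) =
      (E j \<^bold>\<otimes> 1) * (embed (deriv_word q i w) * K i \<^bold>\<otimes> E i)"
    unfolding sum_list_const_mult Cons.IH ..
  finally show ?case
    by (simp add: free_tensor_mult embed_add embed_mult embed_scale distrib_right free_tensor_add_left
        mult.assoc split_term_def word_Cons)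
qed simp

definition split_lin :: "('i, 'k) free_alg \<Rightarrow> ('i gen, 'k) free_alg2" where
  "split_lin = lin_ext (\<lambda>m. split_sum (letters m))"

lemma split_lin_add: "split_lin (p + r) = split_lin p + split_lin r"
  by (simp add: split_lin_def lin_ext_add)

lemma split_lin_single: "split_lin (Poly_Mapping.single m c) = scale c (split_sum (letters m))"
  by (simp add: split_lin_def lin_ext_single scale_def)

lemma \<Delta>_embed: "\<Delta> (embed p) \<approx>\<approx> split_lin p"
proof (induction p rule: pm_induct_UNIV)
  case zero
  then show ?case by (simp add: split_lin_def)
next
  case (single m c)
  obtain w where m: "m = Word w" by (cases m)
  have "Poly_Mapping.single m c = scale c (word w)" by (simp add: m scale_single)
  then have "\<Delta> (embed (Poly_Mapping.single m c)) = scale c (\<Delta> (embed (word w)))"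
    by (simp add: embed_scale free_lift_scale)
  then show ?case
    using UU.cong_sc[OF \<Delta>_embed_word, of c w] by (simp add: split_lin_single m)
next
  case (add p r)
  then show ?case by (simp add: embed_add free_lift_add split_lin_add UU.cong_add)
qed

section \<open>Components of the coproduct by the degree of the right factor\<close>

lemma hom_part_sum_list: "hom_part gr g (sum_list (map f xs)) = sum_list (map (\<lambda>x. hom_part gr g (f x)) xs)"
  by (induction xs) (simp_all add: hom_part_add)

lemma hom_part_split_term:
  "hom_part weight2 (deg_weight \<nu>) (split_term (c, u, v)) = (if word_degree v = \<nu> then split_term (c, u, v) else 0)"
  by (auto simp: split_term_def hom_part_scale hom_part_tensor hom_part_embed hom_part_single word_deg_def)

lemma sum_list_if: "sum_list (map (\<lambda>x. if P x then f x else 0) xs) = sum_list (map f (filter P xs))"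
  by (induction xs) auto

lemma hom_part_split_sum:
  "hom_part weight2 (deg_weight \<nu>) (split_sum w) =
    sum_list (map split_term (filter (\<lambda>(c, u, v). word_degree v = \<nu>) (splits w)))"
proof -
  have "(\<lambda>x. hom_part weight2 (deg_weight \<nu>) (split_term x)) =
      (\<lambda>x. if (case x of (c, u, v) \<Rightarrow> word_degree v = \<nu>) then split_term x else 0)"
    by (auto simp: hom_part_split_term)
  then show ?thesis unfolding split_sum_def hom_part_sum_list by (simp only: sum_list_if)
qed

lemma hom_part_split_lin_simple_root:
  "hom_part weight2 (deg_weight (simple_root i)) (split_lin p) = embed (deriv q i p) * K i \<^bold>\<otimes> E i"
proof (rule additive_eqI[of p UNIV])
  fix m :: "'i fmon" and c :: 'k
  show "hom_part weight2 (deg_weight (simple_root i)) (split_lin (Poly_Mapping.single m c)) =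
      embed (deriv q i (Poly_Mapping.single m c)) * K i \<^bold>\<otimes> E i"
    by (simp add: split_lin_single hom_part_scale hom_part_split_sum word_degree_eq_simple_root
        split_sum_simple_root deriv_single embed_scale)
qed (auto simp: split_lin_add hom_part_add deriv_add embed_add distrib_right free_tensor_add_left)

lemma finite_le: "finite {\<nu> :: 'i \<Rightarrow> nat. \<nu> \<le> \<beta>}"
proof (rule finite_subset)
  show "{\<nu>. \<nu> \<le> \<beta>} \<subseteq> (UNIV \<rightarrow>\<^sub>E {..Max (range \<beta>)})"
  proof
    fix \<nu> assume "\<nu> \<in> {\<nu>. \<nu> \<le> \<beta>}"
    then have "\<nu> i \<le> Max (range \<beta>)" for i
      by (metis Max_ge finite finite_imageI le_funD mem_Collect_eq order_trans rangeI)
    then show "\<nu> \<in> UNIV \<rightarrow>\<^sub>E {..Max (range \<beta>)}" by (simp add: PiE_def Pi_def)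
  qed
qed (simp add: finite_PiE)

lemma sum_hom_part_split_lin:
  assumes "homogeneous word_deg \<beta> p"
  shows "(\<Sum>\<nu>\<in>{\<nu>. \<nu> \<le> \<beta>}. hom_part weight2 (deg_weight \<nu>) (split_lin p)) = split_lin p"
proof (rule additive_eqI[of p "{m. word_deg m = \<beta>}"])
  have *: "(\<Sum>\<nu>\<in>{\<nu>. \<nu> \<le> \<beta>}. hom_part weight2 (deg_weight \<nu>) (sum_list (map split_term xs))) = sum_list (map split_term xs)"
    if "\<And>c u v. (c, u, v) \<in> set xs \<Longrightarrow> word_degree v \<le> \<beta>" for xs
    using that
  proof (induction xs)
    case (Cons x xs)
    obtain c u v where x: "x = (c, u, v)" by (cases x)
    have "word_degree v \<le> \<beta>" using Cons.prems[of c u v] x by simp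
    then have "(\<Sum>\<nu>\<in>{\<nu>. \<nu> \<le> \<beta>}. hom_part weight2 (deg_weight \<nu>) (split_term x)) = split_term x"
      using finite_le[of \<beta>] unfolding x hom_part_split_term by simp
    moreover have "(\<Sum>\<nu>\<in>{\<nu>. \<nu> \<le> \<beta>}. hom_part weight2 (deg_weight \<nu>) (sum_list (map split_term xs))) = sum_list (map split_term xs)"
      by (rule Cons.IH) (use Cons.prems in auto)
    ultimately show ?case by (simp add: hom_part_add sum.distrib)
  qed simp
  fix m :: "'i fmon" and c :: 'k assume m: "m \<in> {m. word_deg m = \<beta>}"
  have "word_degree v \<le> \<beta>" if "(d, u, v) \<in> set (splits (letters m))" for d u v
  proof -
    have "word_degree (u @ v) = \<beta>"
      using mset_splits[OF that] m by (simp add: word_deg_def word_degree_eq_iff[symmetric] flip: mset_append)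
    then show ?thesis by (auto simp: word_degree_append le_fun_def)
  qed
  then show "(\<Sum>\<nu>\<in>{\<nu>. \<nu> \<le> \<beta>}. hom_part weight2 (deg_weight \<nu>) (split_lin (Poly_Mapping.single m c))) =
      split_lin (Poly_Mapping.single m c)"
    using *[of "splits (letters m)"]
    by (simp add: split_lin_single hom_part_scale split_sum_def flip: scale.sc_sum)
qed (use assms in \<open>auto simp: split_lin_add hom_part_add sum.distrib homogeneous_def\<close>)

lemma word_Gom_cong:
  assumes "mset u = mset v"
  shows "word (map Gom u) \<approx> word (map Gom v)"
  using assms
proof (induction u arbitrary: v)
  case (Cons i u)
  then obtain v1 v2 where v: "v = v1 @ i # v2" by (metis in_set_conv_decomp list.set_intros(1) set_mset_mset)
  have move: "K i * word (map Gom w) \<approx> word (map Gom w) * K i" for w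
  proof (induction w)
    case (Cons j w)
    have "K i * (K j * word (map Gom w)) \<approx> K j * (K i * word (map Gom w))"
      using U.cong_right[OF torus_cong[of "Gom i" "Gom j"], of "word (map Gom w)"] by (simp add: mult.assoc)
    moreover have "K j * (K i * word (map Gom w)) \<approx> K j * (word (map Gom w) * K i)"
      by (rule U.cong_left[OF Cons.IH])
    ultimately have "K i * (K j * word (map Gom w)) \<approx> K j * (word (map Gom w) * K i)"
      by (rule U.cong_trans)
    then show ?case by (simp only: list.map word_Cons mult.assoc)
  qed simp
  have "mset u = mset (v1 @ v2)" using Cons.prems v by simp
  then have c1: "K i * word (map Gom u) \<approx> K i * word (map Gom (v1 @ v2))"
    by (intro U.cong_left Cons.IH)
  have e2: "K i * word (map Gom (v1 @ v2)) = K i * word (map Gom v1) * word (map Gom v2)"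
    by (simp add: word_append mult.assoc)
  have c3: "K i * word (map Gom v1) * word (map Gom v2) \<approx> word (map Gom v1) * K i * word (map Gom v2)"
    by (rule U.cong_right[OF move])
  have e4: "word (map Gom v1) * K i * word (map Gom v2) = word (map Gom v)"
    by (simp add: v word_append word_Cons mult.assoc)
  show ?case
    using c1 c3 unfolding e2 e4 list.map(2) word_Cons by (rule U.cong_trans)
qed simp

lemma omega_class: "word_degree v = \<nu> \<Longrightarrow> omega a q \<nu> = U_class a q (word (map Gom v))"
  unfolding omega_def U_class_eq_iff
  by (intro word_Gom_cong) (metis (mono_tags, lifting) someI word_degree_eq_iff)

lemma split_term_in_summand:
  assumes "word_degree u = (\<lambda>k. \<beta> k - \<nu> k)" "word_degree v = \<nu>"
  shows "UU_class a q (split_term (c, u, v)) \<in> coproduct_summand a q \<beta> \<nu>"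
  unfolding coproduct_summand_def
proof (rule generate.incl, rule CollectI, intro exI conjI)
  have hom: "homogeneous word_deg (word_degree w) (word w)" for w
    by (simp add: homogeneous_def word_deg_def)
  \<comment> \<open>The coefficient is put into the left factor, because the summand is only an
    additive span.\<close>
  show "U_class a q (embed (scale c (word u))) \<in> Uplus_comp a q (\<lambda>k. \<beta> k - \<nu> k)"
    unfolding Uplus_comp_iff assms(1)[symmetric] using homogeneous_scale[OF hom] by blast
  show "U_class a q (embed (word v)) \<in> Uplus_comp a q \<nu>"
    unfolding Uplus_comp_iff assms(2)[symmetric] using hom by blast
  show "UU_class a q (split_term (c, u, v)) =
      U_tensor a q (U_class a q (embed (scale c (word u))) \<otimes>\<^bsub>Uq a q\<^esub> omega a q \<nu>) (U_class a q (embed (word v)))"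
    unfolding omega_class[OF assms(2)] U_class_mult U_tensor_class
    by (simp add: split_term_def embed_scale)
qed

lemma zero_in_summand: "UU_class a q 0 \<in> coproduct_summand a q \<beta> \<nu>"
  unfolding coproduct_summand_def UU_class_zero[symmetric] using generate.one[of "add_monoid (UUq a q)"] by simp

lemma add_in_summand:
  "UU_class a q s \<in> coproduct_summand a q \<beta> \<nu> \<Longrightarrow> UU_class a q t \<in> coproduct_summand a q \<beta> \<nu> \<Longrightarrow>
    UU_class a q (s + t) \<in> coproduct_summand a q \<beta> \<nu>"
  unfolding coproduct_summand_def UU_class_add[symmetric] using generate.eng[of _ "add_monoid (UUq a q)"] by simp

lemma hom_part_split_lin_in_summand:
  assumes "homogeneous word_deg \<beta> p"
  shows "UU_class a q (hom_part weight2 (deg_weight \<nu>) (split_lin p)) \<in> coproduct_summand a q \<beta> \<nu>"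
proof -
  have *: "UU_class a q (scale d (sum_list (map split_term xs))) \<in> coproduct_summand a q \<beta> \<nu>"
    if "\<And>c u v. (c, u, v) \<in> set xs \<Longrightarrow> word_degree u = (\<lambda>k. \<beta> k - \<nu> k) \<and> word_degree v = \<nu>" for d xs
    using that
  proof (induction xs)
    case Nil
    then show ?case by (simp add: zero_in_summand)
  next
    case (Cons x xs)
    obtain c u v where x: "x = (c, u, v)" by (cases x)
    have "scale d (split_term x) = split_term (d * c, u, v)" by (simp add: x split_term_def)
    moreover have "UU_class a q (split_term (d * c, u, v)) \<in> coproduct_summand a q \<beta> \<nu>"
      using Cons.prems[of c u v] x by (intro split_term_in_summand) auto
    moreover have "UU_class a q (scale d (sum_list (map split_term xs))) \<in> coproduct_summand a q \<beta> \<nu>"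
      by (rule Cons.IH) (use Cons.prems in auto)
    ultimately show ?case by (simp add: scale.sc_add_right add_in_summand)
  qed
  from assms have "Poly_Mapping.keys p \<subseteq> {m. word_deg m = \<beta>}" by (auto simp: homogeneous_def)
  then show ?thesis
  proof (induction p rule: pm_induct)
    case zero
    then show ?case by (simp add: split_lin_def zero_in_summand)
  next
    case (single m c)
    have "word_degree u = (\<lambda>k. \<beta> k - \<nu> k)" if "(d, u, v) \<in> set (splits (letters m))" "word_degree v = \<nu>" for d u v
    proof -
      have "word_degree (u @ v) = \<beta>"
        using mset_splits[OF that(1)] single by (simp add: word_deg_def word_degree_eq_iff[symmetric] flip: mset_append)
      then show ?thesis using that(2) by (auto simp: word_degree_append)
    qed
    then show ?case unfolding split_lin_single hom_part_scale hom_part_split_sum by (intro *) auto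
  next
    case (add p r)
    then show ?case by (simp add: split_lin_add hom_part_add add_in_summand)
  qed
qed

text \<open>An element of a summand also has representatives of mixed weight; lifting the spanning
  elements one by one gives a representative on which \<open>hom_part\<close> can be
  evaluated.\<close>

lemma summand_representative:
  assumes "z \<in> coproduct_summand a q \<beta> \<nu>"
  obtains s where "z = UU_class a q s" "hom_part weight2 (deg_weight \<nu>) s = s"
proof -
  have rep: "\<exists>s. h = UU_class a q s \<and> hom_part weight2 (deg_weight \<nu>) s = s"
    if h: "h \<in> {U_tensor a q (y \<otimes>\<^bsub>Uq a q\<^esub> omega a q \<nu>) z | y z.
        y \<in> Uplus_comp a q (\<lambda>k. \<beta> k - \<nu> k) \<and> z \<in> Uplus_comp a q \<nu>}" for h
  proof -
    obtain y z where yz: "h = U_tensor a q (y \<otimes>\<^bsub>Uq a q\<^esub> omega a q \<nu>) z"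
      "y \<in> Uplus_comp a q (\<lambda>k. \<beta> k - \<nu> k)" "z \<in> Uplus_comp a q \<nu>" using h by blast
    obtain r where r: "homogeneous word_deg \<nu> r" "z = U_class a q (embed r)" using yz(3) by (auto simp: Uplus_comp_iff)
    obtain p where p: "y = U_class a q (embed p)" using yz(2) by (auto simp: Uplus_comp_iff)
    have "h = UU_class a q (embed p * word (map Gom (SOME w. word_degree w = \<nu>)) \<^bold>\<otimes> embed r)"
      by (simp add: yz(1) p r(2) omega_def U_class_mult U_tensor_class)
    then show ?thesis
      by (intro exI[of _ "embed p * word (map Gom (SOME w. word_degree w = \<nu>)) \<^bold>\<otimes> embed r"] conjI)
        (simp_all add: hom_part_tensor hom_part_embed hom_part_of_homogeneous[OF r(1)])
  qed
  have "\<exists>s. z = UU_class a q s \<and> hom_part weight2 (deg_weight \<nu>) s = s"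
    using assms unfolding coproduct_summand_def
  proof (induction z rule: generate.induct)
    case one
    then show ?case by (intro exI[of _ 0]) (simp add: UU_class_zero)
  next
    case (incl h)
    then show ?case by (rule rep)
  next
    case (inv h)
    then obtain s where "h = UU_class a q s" "hom_part weight2 (deg_weight \<nu>) s = s"
      using rep by blast
    then show ?case
      using UU_class_uminus[of s] hom_part_diff[of weight2 "deg_weight \<nu>" 0 s]
      by (intro exI[of _ "- s"]) (simp add: a_inv_def)
  next
    case (eng h1 h2)
    then obtain s t where "h1 = UU_class a q s" "hom_part weight2 (deg_weight \<nu>) s = s"
      "h2 = UU_class a q t" "hom_part weight2 (deg_weight \<nu>) t = t" by blast
    then show ?case by (intro exI[of _ "s + t"]) (simp add: UU_class_add hom_part_add)
  qed
  then show ?thesis using that by blast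
qed

end

section \<open>The skew derivations on the positive part\<close>

context finite_quantum_data
begin

lemma homogeneous_deriv:
  assumes "homogeneous word_deg \<beta> p"
  shows "homogeneous word_deg (\<lambda>k. \<beta> k - simple_root i k) (deriv q i p)"
  unfolding homogeneous_def
proof
  fix m assume "m \<in> Poly_Mapping.keys (deriv q i p)"
  then obtain n where n: "n \<in> Poly_Mapping.keys p" "mset (i # letters m) = mset (letters n)"
    by (rule mset_deriv) auto
  have "word_degree (i # letters m) = word_degree (letters n)"
    using n(2) by (simp only: word_degree_eq_iff)
  then have "word_degree (i # letters m) = \<beta>"
    using n(1) assms by (simp add: homogeneous_def word_deg_def)
  then show "word_deg m = (\<lambda>k. \<beta> k - simple_root i k)"
    by (auto simp: word_degree_Cons word_deg_def)
qed

text \<open>Matches the branch of \<open>hat_partial_comp\<close> with value 0, where truncated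
  subtraction would turn \<beta> - \<alpha>_i back into \<beta>.\<close>

lemma deriv_eq_0:
  assumes "homogeneous word_deg \<beta> p" "\<beta> i = 0"
  shows "deriv q i p = 0"
proof (rule ccontr)
  assume "deriv q i p \<noteq> 0"
  then obtain m where "m \<in> Poly_Mapping.keys (deriv q i p)" by (metis all_not_in_conv keys_eq_empty)
  then obtain n where n: "n \<in> Poly_Mapping.keys p" "mset (i # letters m) = mset (letters n)"
    by (rule mset_deriv) auto
  have "word_degree (i # letters m) = word_degree (letters n)"
    using n(2) by (simp only: word_degree_eq_iff)
  then have "word_degree (i # letters m) = \<beta>"
    using n(1) assms by (simp add: homogeneous_def word_deg_def)
  then have "word_degree (i # letters m) i = 0" using assms by simp
  then show False by (simp add: word_degree_def)
qed

text \<open>Existence comes from the degree components of \<open>split_lin\<close>, uniqueness from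
  projecting an arbitrary decomposition to weight \<alpha>_i. If e_i vanished, the condition on the
  summand at \<alpha>_i would not restrict y, and the definite description would lose its
  meaning.\<close>

lemma hat_partial_comp_class:
  assumes p: "homogeneous word_deg \<beta> p" and i: "\<beta> i \<noteq> 0" and live: "E i \<notin> U_ideal a q"
  shows "hat_partial_comp a q i \<beta> (U_class a q (embed p)) = U_class a q (embed (deriv q i p))"
proof -
  obtain \<phi> :: "('i gen, 'k) free_alg \<Rightarrow> 'k" where \<phi>:
    "\<And>x y. \<phi> (x + y) = \<phi> x + \<phi> y" "\<And>c x. \<phi> (scale c x) = c * \<phi> x"
    "\<And>x. x \<in> U_ideal a q \<Longrightarrow> \<phi> x = 0" "\<phi> (E i) = 1"
    by (rule exists_functional[OF U.two_sided_ideal_axioms live], rule that)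
  \<comment> \<open>Contraction with \<phi>(e_i) = 1 leaves x \<omega>_i and y \<omega>_i, from
    which \<omega>_i is cancelled by its inverse.\<close>
  have inj: "x \<approx> y" if "x * K i \<^bold>\<otimes> E i \<approx>\<approx> y * K i \<^bold>\<otimes> E i" for x y
  proof -
    have "contract \<phi> ((x * K i \<^bold>\<otimes> E i) - (y * K i \<^bold>\<otimes> E i)) \<in> U_ideal a q"
      using that by (intro contract_mem \<phi>) (simp_all add: ideal_cong_def)
    then have "x * K i \<approx> y * K i"
      by (simp add: contract_diff contract_tensor[OF \<phi>(1,2)] \<phi>(4) ideal_cong_def)
    then have "x * (K i * Kinv i) \<approx> y * (K i * Kinv i)"
      using U.cong_right[of "x * K i" "y * K i" "Kinv i"] by (simp add: mult.assoc)
    moreover have "z * (K i * Kinv i) \<approx> z" for z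
      using U.cong_left[OF K_Kinv, of z] by simp
    ultimately show ?thesis by (blast intro: U.cong_trans U.cong_sym)
  qed
  let ?A = "{\<nu>. \<nu> \<le> \<beta>}"
  let ?N = "\<lambda>\<nu>. hom_part weight2 (deg_weight \<nu>) (split_lin p)"
  have root_le: "simple_root i \<in> ?A" using i by (auto simp: le_fun_def simple_root_def)
  have cop: "coproduct a q (U_class a q (embed p)) = UU_class a q (split_lin p)"
    by (simp add: coproduct_class UU_class_eq_iff \<Delta>_embed)
  have tensor: "U_tensor a q (U_class a q y \<otimes>\<^bsub>Uq a q\<^esub> U_class a q (K i)) (U_class a q (E i)) =
      UU_class a q (y * K i \<^bold>\<otimes> E i)" for y
    by (simp add: U_class_mult U_tensor_class)
  show ?thesis
    unfolding hat_partial_comp_def if_not_P[OF i]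
  proof (rule the_equality)
    let ?t = "\<lambda>\<nu>. UU_class a q (?N \<nu>)"
    have "?t \<nu> \<in> coproduct_summand a q \<beta> \<nu>" for \<nu>
      by (rule hom_part_split_lin_in_summand[OF p])
    moreover have "finsum (UUq a q) ?t ?A = UU_class a q (split_lin p)"
      using UU_class_finsum[OF finite_le, of \<beta> ?t ?N] sum_hom_part_split_lin[OF p] by simp
    moreover have "?t (simple_root i) = U_tensor a q (U_class a q (embed (deriv q i p)) \<otimes>\<^bsub>Uq a q\<^esub> U_class a q (K i)) (U_class a q (E i))"
      by (simp only: tensor hom_part_split_lin_simple_root)
    moreover have "U_class a q (embed (deriv q i p)) \<in> Uplus_comp a q (\<lambda>k. \<beta> k - simple_root i k)"
      unfolding Uplus_comp_iff using homogeneous_deriv[OF p] by blast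
    ultimately show "U_class a q (embed (deriv q i p)) \<in> Uplus_comp a q (\<lambda>k. \<beta> k - simple_root i k) \<and>
      (\<exists>t. (\<forall>\<nu>\<in>?A. t \<nu> \<in> coproduct_summand a q \<beta> \<nu>) \<and>
        coproduct a q (U_class a q (embed p)) = finsum (UUq a q) t ?A \<and>
        t (simple_root i) = U_tensor a q (U_class a q (embed (deriv q i p)) \<otimes>\<^bsub>Uq a q\<^esub> U_class a q (K i)) (U_class a q (E i)))"
      unfolding cop by (intro conjI exI[of _ ?t] ballI) simp_all
  next
    fix y
    assume "y \<in> Uplus_comp a q (\<lambda>k. \<beta> k - simple_root i k) \<and>
      (\<exists>t. (\<forall>\<nu>\<in>?A. t \<nu> \<in> coproduct_summand a q \<beta> \<nu>) \<and>
        coproduct a q (U_class a q (embed p)) = finsum (UUq a q) t ?A \<and>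
        t (simple_root i) = U_tensor a q (y \<otimes>\<^bsub>Uq a q\<^esub> U_class a q (K i)) (U_class a q (E i)))"
    then obtain t where y: "y \<in> Uplus_comp a q (\<lambda>k. \<beta> k - simple_root i k)"
      and t: "\<forall>\<nu>\<in>?A. t \<nu> \<in> coproduct_summand a q \<beta> \<nu>"
        "UU_class a q (split_lin p) = finsum (UUq a q) t ?A"
        "t (simple_root i) = U_tensor a q (y \<otimes>\<^bsub>Uq a q\<^esub> U_class a q (K i)) (U_class a q (E i))"
      unfolding cop by blast
    obtain r where r: "y = U_class a q (embed r)" using y by (auto simp: Uplus_comp_iff)
    have "\<forall>\<nu>\<in>?A. \<exists>s. t \<nu> = UU_class a q s \<and> hom_part weight2 (deg_weight \<nu>) s = s"
      using t(1) summand_representative by metis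
    then obtain s where s: "\<And>\<nu>. \<nu> \<in> ?A \<Longrightarrow> t \<nu> = UU_class a q (s \<nu>)"
      "\<And>\<nu>. \<nu> \<in> ?A \<Longrightarrow> hom_part weight2 (deg_weight \<nu>) (s \<nu>) = s \<nu>"
      by metis
    \<comment> \<open>Projecting a decomposition to weight \<alpha>_i removes every summand but the
      one at \<alpha>_i, which is therefore determined by the coproduct.\<close>
    have part: "hom_part weight2 (deg_weight (simple_root i)) (s \<nu>) = (if \<nu> = simple_root i then s \<nu> else 0)"
      if "\<nu> \<in> ?A" for \<nu>
    proof -
      have "homogeneous weight2 (deg_weight \<nu>) (s \<nu>)"
        using homogeneous_hom_part[of weight2 "deg_weight \<nu>" "s \<nu>"] s(2)[OF that] by simp
      then show ?thesis by (simp add: hom_part_of_homogeneous)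
    qed
    have "finsum (UUq a q) t ?A = UU_class a q (\<Sum>\<nu>\<in>?A. s \<nu>)"
      by (rule UU_class_finsum[OF finite_le s(1)])
    then have e: "split_lin p \<approx>\<approx> (\<Sum>\<nu>\<in>?A. s \<nu>)"
      using t(2) by (simp add: UU_class_eq_iff)
    have "(\<Sum>\<nu>\<in>?A. hom_part weight2 (deg_weight (simple_root i)) (s \<nu>)) =
        (\<Sum>\<nu>\<in>?A. if \<nu> = simple_root i then s \<nu> else 0)"
      by (intro sum.cong refl part)
    also have "\<dots> = s (simple_root i)"
      using root_le by (simp add: sum.delta[OF finite_le])
    finally have "embed (deriv q i p) * K i \<^bold>\<otimes> E i \<approx>\<approx> s (simple_root i)"
      using hom_part_UU_cong[OF e, of "deg_weight (simple_root i)"]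
      by (simp only: hom_part_split_lin_simple_root hom_part_sum)
    moreover have "s (simple_root i) \<approx>\<approx> embed r * K i \<^bold>\<otimes> E i"
      using t(3) s(1)[OF root_le] by (simp only: r tensor UU_class_eq_iff)
    ultimately have "embed (deriv q i p) * K i \<^bold>\<otimes> E i \<approx>\<approx> embed r * K i \<^bold>\<otimes> E i"
      by (rule UU.cong_trans)
    then have "embed r \<approx> embed (deriv q i p)" by (intro U.cong_sym[OF inj])
    then show "y = U_class a q (embed (deriv q i p))" by (simp add: r U_class_eq_iff)
  qed
qed

text \<open>
  Whether \<open>e\<^sub>i\<close> vanishes in \<open>U\<^sub>q\<close> need not be decided: the generators that vanish can be omitted from
  the representatives of the elements of \<open>U\<^sub>q\<^sup>+\<close>.
\<close>

definition live :: "('i, 'k) free_alg \<Rightarrow> bool" where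
  "live p \<longleftrightarrow> (\<forall>m\<in>Poly_Mapping.keys p. \<forall>i\<in>set (letters m). E i \<notin> U_ideal a q)"

lemma live_0 [simp]: "live 0"
  by (simp add: live_def)

lemma live_add: "live p \<Longrightarrow> live r \<Longrightarrow> live (p + r)"
  using Poly_Mapping.keys_add[of p r] by (auto simp: live_def)

lemma live_uminus: "live p \<Longrightarrow> live (- p)"
  by (auto simp: live_def in_keys_iff)

lemma live_mult: "live p \<Longrightarrow> live r \<Longrightarrow> live (p * r)"
  using keys_mult[of p r] by (fastforce simp: live_def)

lemma live_const: "live (const c)"
  by (simp add: live_def const_def)

lemma live_scale: "live p \<Longrightarrow> live (scale c p)"
  using keys_scale by (fastforce simp: live_def)

lemma live_hom_part: "live p \<Longrightarrow> live (hom_part word_deg \<beta> p)"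
  by (auto simp: live_def keys_hom_part)

lemma live_deriv: "live p \<Longrightarrow> live (deriv q i p)"
  unfolding live_def
proof (intro ballI)
  fix m j
  assume p: "\<forall>m\<in>Poly_Mapping.keys p. \<forall>i\<in>set (letters m). E i \<notin> U_ideal a q"
    and m: "m \<in> Poly_Mapping.keys (deriv q i p)" and j: "j \<in> set (letters m)"
  from m obtain n where n: "n \<in> Poly_Mapping.keys p" "mset (i # letters m) = mset (letters n)"
    by (rule mset_deriv) auto
  have "j \<in> set (letters n)" using j mset_eq_setD[OF n(2)] by auto
  then show "E j \<notin> U_ideal a q" using p n(1) by blast
qed

lemma live_deriv_seq: "live p \<Longrightarrow> live (deriv_seq q w p)"
  by (induction w) (simp_all add: deriv_seq_def live_scale live_deriv)

text \<open>A nonzero element whose degree involves i contains the letter i. This supplies the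
  hypothesis on e_i in \<open>hat_partial_comp_class\<close>.\<close>

lemma live_letter:
  assumes "live p" "homogeneous word_deg \<beta> p" "p \<noteq> 0" "\<beta> i \<noteq> 0"
  shows "E i \<notin> U_ideal a q"
proof -
  obtain m where m: "m \<in> Poly_Mapping.keys p" using assms(3) by (metis all_not_in_conv keys_eq_empty)
  have "count_list (letters m) i \<noteq> 0"
    using m assms by (auto simp: homogeneous_def word_deg_def word_degree_def)
  then have "i \<in> set (letters m)" by (metis count_notin)
  then show ?thesis using m assms(1) by (auto simp: live_def)
qed

text \<open>The descent of D_i: p and 0 represent the same class, \<open>hat_partial_comp\<close>
  depends only on the class, and its value can be computed from either representative.\<close>

lemma deriv_part_mem:
  assumes "live p" "homogeneous word_deg \<beta> p" "embed p \<in> U_ideal a q"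
  shows "embed (deriv q i p) \<in> U_ideal a q"
proof (cases "p = 0 \<or> \<beta> i = 0")
  case True
  then have "deriv q i p = 0" using deriv_eq_0[OF assms(2)] by auto
  then show ?thesis by (simp add: U.zero_mem)
next
  case False
  then have i: "\<beta> i \<noteq> 0" and E: "E i \<notin> U_ideal a q" using live_letter[OF assms(1,2)] by auto
  have zero: "homogeneous word_deg \<beta> (0 :: ('i, 'k) free_alg)" by simp
  have "U_class a q (embed p) = U_class a q (embed 0)"
    using assms(3) by (simp add: U_class_eq_iff U.cong_zero_iff)
  then have "U_class a q (embed (deriv q i p)) = U_class a q (embed (deriv q i 0))"
    using hat_partial_comp_class[OF assms(2) i E] hat_partial_comp_class[OF zero i E] by metis
  then show ?thesis by (simp add: U_class_eq_iff U.cong_zero_iff)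
qed

text \<open>The degrees left out by \<open>degree_support\<close> contribute elements of the ideal
  by \<open>deriv_part_mem\<close>, so the sum can run over all degrees of p and reassembles
  it.\<close>

lemma hat_partial_class:
  assumes "live p"
  shows "hat_partial a q i (U_class a q (embed p)) = U_class a q (embed (deriv q i p))"
proof -
  let ?p = "\<lambda>\<beta>. hom_part word_deg \<beta> p"
  let ?S = "{\<beta>. embed (?p \<beta>) \<notin> U_ideal a q}" and ?T = "word_deg ` Poly_Mapping.keys p"
  have sub: "?S \<subseteq> ?T" by (rule nonzero_parts_subset)
  have comp: "hat_partial_comp a q i \<beta> (U_class a q (embed (?p \<beta>))) = U_class a q (embed (deriv q i (?p \<beta>)))"
    if "\<beta> \<in> ?S" for \<beta>
  proof (cases "\<beta> i = 0")
    have hom: "homogeneous word_deg \<beta> (?p \<beta>)" by (rule homogeneous_hom_part)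
    case True
    then show ?thesis
      using deriv_eq_0[OF hom True] by (simp add: hat_partial_comp_def U_class_zero)
  next
    have hom: "homogeneous word_deg \<beta> (?p \<beta>)" by (rule homogeneous_hom_part)
    case False
    have "?p \<beta> \<noteq> 0" using that U.zero_mem by auto
    then show ?thesis
      using hat_partial_comp_class[OF hom False] live_letter[OF live_hom_part[OF assms] hom _ False]
      by blast
  qed
  have "hat_partial a q i (U_class a q (embed p)) = U_class a q (\<Sum>\<beta>\<in>?S. embed (deriv q i (?p \<beta>)))"
    unfolding hat_partial_def degree_support_class homogeneous_parts_class
    by (rule U_class_finsum) (use finite_nonzero_parts comp in auto)
  moreover have "(\<Sum>\<beta>\<in>?S. embed (deriv q i (?p \<beta>))) \<approx> (\<Sum>\<beta>\<in>?T. embed (deriv q i (?p \<beta>)))"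
    by (rule sum_nonzero_parts)
      (use sub in \<open>auto intro: deriv_part_mem live_hom_part assms homogeneous_hom_part\<close>)
  moreover have "(\<Sum>\<beta>\<in>?T. embed (deriv q i (?p \<beta>))) = embed (deriv q i p)"
    by (simp add: sum_hom_part flip: embed_sum deriv_sum)
  ultimately show ?thesis by (simp add: U_class_eq_iff)
qed

lemma word_partial_class:
  assumes "live p"
  shows "word_partial a q w (U_class a q (embed p)) = U_class a q (embed (deriv_seq q w p))"
proof (induction w)
  case Nil
  then show ?case by (simp add: word_partial_def deriv_seq_def)
next
  case (Cons i w)
  have "word_partial a q (i # w) (U_class a q (embed p)) = skew_partial a q i (U_class a q (embed (deriv_seq q w p)))"
    using Cons by (simp add: word_partial_def)
  also have "\<dots> = U_class a q (const (q i i / (1 - q i i)) * embed (deriv q i (deriv_seq q w p)))"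
    by (simp only: skew_partial_def hat_partial_class[OF live_deriv_seq[OF assms]] U_class_mult)
  also have "\<dots> = U_class a q (embed (deriv_seq q (i # w) p))"
    by (simp add: deriv_seq_def deriv_const_def embed_scale) (simp add: scale_def)
  finally show ?case .
qed

text \<open>The letters of w exhaust the degree, so the iterated derivative is already a scalar in
  the free algebra and \<open>scalar_of_const\<close> reads it off.\<close>

lemma Gamma_comp_class:
  assumes "live p" "homogeneous word_deg \<mu> p"
  shows "Gamma_comp a q \<mu> (U_class a q (embed p)) = Gamma_free q p"
proof -
  have "scalar_of a q (word_partial a q w (U_class a q (embed p))) = Poly_Mapping.lookup (deriv_seq q w p) 0"
    if "word_degree w = \<mu>" for w
  proof -
    have "length (letters m) = 0" if m: "m \<in> Poly_Mapping.keys (deriv_seq q w p)" for m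
    proof -
      obtain n where n: "n \<in> Poly_Mapping.keys p" "mset w + mset (letters m) = mset (letters n)"
        using m by (rule mset_deriv_seq)
      have "mset w = mset (letters n)"
        using n(1) assms(2) \<open>word_degree w = \<mu>\<close>
        by (simp add: homogeneous_def word_deg_def flip: word_degree_eq_iff)
      then show ?thesis using n(2) by simp
    qed
    then have "deriv_seq q w p = scale (Poly_Mapping.lookup (deriv_seq q w p) 0) 1"
      by (rule length_zero_const)
    then have "embed (deriv_seq q w p) = const (Poly_Mapping.lookup (deriv_seq q w p) 0)"
      by (metis embed_const scale_1_left)
    then show ?thesis by (simp add: word_partial_class[OF assms(1)] scalar_of_const)
  qed
  then have "Gamma_comp a q \<mu> (U_class a q (embed p)) =
      (\<Sum>w | word_degree w = \<mu>. Poly_Mapping.single (Word w) (Poly_Mapping.lookup (deriv_seq q w p) 0))"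
    unfolding Gamma_comp_def by (intro sum.cong refl) simp
  then show ?thesis
    using Gamma_free_homogeneous[of p \<mu> q] assms(2) by (simp add: homogeneous_def word_deg_def)
qed

lemma Gamma_class:
  assumes "live p"
  shows "Gamma a q (U_class a q (embed p)) = Gamma_free q p"
proof -
  let ?p = "\<lambda>\<beta>. hom_part word_deg \<beta> p"
  let ?S = "{\<beta>. embed (?p \<beta>) \<notin> U_ideal a q}" and ?T = "word_deg ` Poly_Mapping.keys p"
  have comp: "Gamma_comp a q \<beta> (U_class a q (embed (?p \<beta>))) = Gamma_free q (?p \<beta>)" for \<beta>
    by (rule Gamma_comp_class[OF live_hom_part[OF assms] homogeneous_hom_part])
  \<comment> \<open>A component that vanishes in U_q has the class of 0, and
    \<open>Gamma_comp\<close> sees only the class. Here \<open>Gamma_free\<close> is seen to respect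
    the relations.\<close>
  have zero: "Gamma_free q (?p \<beta>) = 0" if "\<beta> \<notin> ?S" for \<beta>
  proof -
    have "U_class a q (embed (?p \<beta>)) = U_class a q (embed 0)"
      using that by (simp add: U_class_eq_iff U.cong_zero_iff)
    then have "Gamma_free q (?p \<beta>) = Gamma_free q 0"
      using comp[of \<beta>] Gamma_comp_class[OF live_0 homogeneous_0, of \<beta>] by metis
    then show ?thesis by (simp add: Gamma_free_def)
  qed
  have sub: "?S \<subseteq> ?T" by (rule nonzero_parts_subset)
  have "Gamma a q (U_class a q (embed p)) = (\<Sum>\<beta>\<in>?S. Gamma_free q (?p \<beta>))"
    by (simp add: Gamma_def degree_support_class homogeneous_parts_class comp)
  also have "\<dots> = (\<Sum>\<beta>\<in>?T. Gamma_free q (?p \<beta>))"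
    by (rule sum.mono_neutral_left) (use sub zero in auto)
  also have "\<dots> = Gamma_free q (\<Sum>\<beta>\<in>?T. ?p \<beta>)"
    by (simp add: Gamma_free_def lin_ext_sum)
  also have "\<dots> = Gamma_free q p" by (simp add: sum_hom_part)
  finally show ?thesis .
qed

lemma Uplus_representative:
  assumes "x \<in> Uplus a q"
  obtains p where "live p" "x = U_class a q (embed p)"
proof -
  have "\<exists>p. live p \<and> x = U_class a q (embed p)"
    using assms unfolding Uplus_def
  proof (induction x rule: generate_ring.induct)
    case one
    then show ?case using live_const[of 1] by (intro exI[of _ 1]) (simp add: U_class_one)
  next
    case (incl h)
    then consider c where "h = U_class a q (const c)" | i where "h = U_class a q (E i)" by auto
    then show ?case
    proof cases
      case 1
      then show ?thesis using live_const by (intro exI[of _ "const c"]) simp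
    next
      case 2
      show ?thesis
      proof (cases "E i \<in> U_ideal a q")
        case True
        then show ?thesis using 2 by (intro exI[of _ 0]) (simp add: U_class_eq_iff U.cong_zero_iff)
      next
        case False
        then show ?thesis using 2 by (intro exI[of _ "letter i"] conjI) (simp add: live_def letter_def, simp)
      qed
    qed
  next
    case (a_inv h)
    then show ?case using live_uminus by (metis U_class_uminus embed_uminus)
  next
    case (eng_add h1 h2)
    then show ?case using live_add by (metis U_class_add embed_add)
  next
    case (eng_mult h1 h2)
    then show ?case using live_mult by (metis U_class_mult embed_mult)
  qed
  then show ?thesis using that by blast
qed

lemma Gamma_mult:
  assumes "x \<in> Uplus a q" "y \<in> Uplus a q"
  shows "Gamma a q (x \<otimes>\<^bsub>Uq a q\<^esub> y) = quantum_shuffle q (Gamma a q x) (Gamma a q y)"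
proof -
  obtain p where p: "live p" "x = U_class a q (embed p)" using Uplus_representative[OF assms(1)] .
  obtain r where r: "live r" "y = U_class a q (embed r)" using Uplus_representative[OF assms(2)] .
  have "Gamma a q (x \<otimes>\<^bsub>Uq a q\<^esub> y) = Gamma a q (U_class a q (embed (p * r)))"
    by (simp only: p(2) r(2) U_class_mult embed_mult)
  also have "\<dots> = quantum_shuffle q (Gamma_free q p) (Gamma_free q r)"
    by (simp only: Gamma_class[OF live_mult[OF p(1) r(1)]] Gamma_free_mult)
  finally show ?thesis by (simp only: p(2) r(2) Gamma_class[OF p(1)] Gamma_class[OF r(1)])
qed

end

theorem theorem78:
  fixes a :: "'i::finite \<Rightarrow> 'i \<Rightarrow> int"
    and q :: "'i \<Rightarrow> 'i \<Rightarrow> 'k::field_char_0"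
  assumes "generalized_cartan_matrix a"
    and "symmetrizable a"
    and "quantum_parameters a q"
  shows "\<forall>x\<in>Uplus a q. \<forall>y\<in>Uplus a q.
           Gamma a q (x \<otimes>\<^bsub>Uq a q\<^esub> y) = quantum_shuffle q (Gamma a q x) (Gamma a q y)"
proof -
  interpret finite_quantum_data a q
    by unfold_locales
      (use assms in \<open>auto simp: generalized_cartan_matrix_def quantum_parameters_def\<close>)
  show ?thesis using Gamma_mult by blast
qed

end
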